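(* Let $K,\sigma,\Gamma,\varphi$ be as in the context. Let $f$ be a $\varphi$-twisted modular form on $\Gamma$ of bi-weight $(k,\ell)$ with $k,\ell\ge0$, and let $t$ be a (non-constant) modular function for $\Gamma$. Then the function $y(t)$ defined locally by $f(z)=y(t(z))$ satisfies a linear differential equation of order $(k+1)(\ell+1)$ with algebraic coefficients.
   Context: $K$ is a real quadratic field with fixed embedding in $\mathbb{R}$ and nontrivial automorphism $\sigma$; $\Gamma$ is a subgroup of a subgroup of $\mathrm{SL}_2(K)$ commensurable with $\mathrm{SL}_2(\mathcal{O})$ ($\mathcal{O}$ an order), Fuchsian in $\mathrm{SL}_2(\mathbb{R})$; $\varphi:\mathbb{H}\to\mathbb{H}$ holomorphic with $\varphi(\gamma z)=\gamma^\sigma\varphi(z)$ for $\gamma\in\Gamma$. A $\varphi$-twisted modular form of bi-weight $(k,\ell)$ is a holomorphic $f:\mathbb{H}\to\mathbb{C}$ with $f(\frac{az+b}{cz+d})=(cz+d)^k(c^\sigma\varphi(z)+d^\sigma)^\ell f(z)$ for all $\begin{pmatrix}a&b\\c&d\end{pmatrix}\in\Gamma$, bounded at the cusps in the usual sense. A modular function for $\Gamma$ is a $\Gamma$-invariant meromorphic function on $\mathbb{H}$, meromorphic at the cusps.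
   Formalization: "Fuchsian" is taken to mean Fuchsian of the first kind (the quotient of H together with the cusps is compact); for arbitrary discrete Γ the claim fails, e.g. Γ={1}, φ(z)=z, k=ℓ=0, t(z)=z, f(z)=exp(exp z). *)

theory Defs
  imports
    "HOL-Complex_Analysis.Complex_Analysis"
    "HOL-Algebra.Coset"
    "HOL-Computational_Algebra.Polynomial"
begin

section \<open>Real quadratic fields and orders\<close>

interpretation rat_real: vector_space "\<lambda>(q::rat) (x::real). of_rat q * x"
  by standard (simp_all add: distrib_left distrib_right of_rat_add of_rat_mult)

interpretation int_real: module "\<lambda>(n::int) (x::real). of_int n * x"
  by standard (simp_all add: distrib_left distrib_right)

text \<open>The field is a set of reals; this is the fixed real embedding.\<close>

definition real_quadratic_field :: "real set \<Rightarrow> bool" where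
  "real_quadratic_field K \<longleftrightarrow>
     1 \<in> K \<and> (\<forall>x\<in>K. \<forall>y\<in>K. x - y \<in> K \<and> x * y \<in> K) \<and> (\<forall>x\<in>K. inverse x \<in> K) \<and>
     rat_real.dim K = 2"

definition nontrivial_automorphism :: "real set \<Rightarrow> (real \<Rightarrow> real) \<Rightarrow> bool" where
  "nontrivial_automorphism K \<sigma> \<longleftrightarrow>
     bij_betw \<sigma> K K \<and>
     (\<forall>x\<in>K. \<forall>y\<in>K. \<sigma> (x + y) = \<sigma> x + \<sigma> y \<and> \<sigma> (x * y) = \<sigma> x * \<sigma> y) \<and>
     (\<exists>x\<in>K. \<sigma> x \<noteq> x)"

text \<open>An order of \<open>K\<close>: a subring that is the integral span of a rational basis of \<open>K\<close>.\<close>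

definition order_of_field :: "real set \<Rightarrow> real set \<Rightarrow> bool" where
  "order_of_field K R \<longleftrightarrow>
     1 \<in> R \<and> (\<forall>x\<in>R. \<forall>y\<in>R. x - y \<in> R \<and> x * y \<in> R) \<and>
     (\<exists>B. finite B \<and> \<not> rat_real.dependent B \<and> rat_real.span B = K \<and> int_real.span B = R)"

section \<open>Subgroups of SL(2)\<close>

definition SL2 :: "real set \<Rightarrow> (real^2^2) monoid" where
  "SL2 R = \<lparr>carrier = {A. det A = 1 \<and> (\<forall>i j. A $ i $ j \<in> R)}, mult = (**), one = mat 1\<rparr>"

definition commensurable :: "('a, 'b) monoid_scheme \<Rightarrow> 'a set \<Rightarrow> 'a set \<Rightarrow> bool" where
  "commensurable G A B \<longleftrightarrow>
     finite (rcosets\<^bsub>G\<lparr>carrier := A\<rparr>\<^esub> (A \<inter> B)) \<and> finite (rcosets\<^bsub>G\<lparr>carrier := B\<rparr>\<^esub> (A \<inter> B))"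

definition conj_matrix :: "(real \<Rightarrow> real) \<Rightarrow> real^2^2 \<Rightarrow> real^2^2" where
  "conj_matrix \<sigma> A = (\<chi> i j. \<sigma> (A $ i $ j))"

section \<open>Action on the upper half-plane and on the Riemann sphere\<close>

definition upper_half_plane :: "complex set" where
  "upper_half_plane = {z. Im z > 0}"

definition autfac :: "real^2^2 \<Rightarrow> complex \<Rightarrow> complex" where
  "autfac g z = of_real (g $ 2 $ 1) * z + of_real (g $ 2 $ 2)"

definition moebius_act :: "real^2^2 \<Rightarrow> complex \<Rightarrow> complex" where
  "moebius_act g z = (of_real (g $ 1 $ 1) * z + of_real (g $ 1 $ 2)) / autfac g z"

text \<open>The Riemann sphere is \<^typ>\<open>complex option\<close>, with \<^term>\<open>None\<close> as the point at infinity.\<close>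

definition moebius_sphere :: "real^2^2 \<Rightarrow> complex option \<Rightarrow> complex option" where
  "moebius_sphere g p =
     (case p of
        None \<Rightarrow> if g $ 2 $ 1 = 0 then None else Some (of_real (g $ 1 $ 1 / g $ 2 $ 1))
      | Some z \<Rightarrow> if autfac g z = 0 then None else Some (moebius_act g z))"

definition parabolic :: "real^2^2 \<Rightarrow> bool" where
  "parabolic g \<longleftrightarrow> det g = 1 \<and> \<bar>trace g\<bar> = 2 \<and> g \<noteq> mat 1 \<and> g \<noteq> - mat 1"

definition cusps :: "(real^2^2) set \<Rightarrow> complex option set" where
  "cusps \<Gamma> = {p. \<exists>\<gamma>\<in>\<Gamma>. parabolic \<gamma> \<and> moebius_sphere \<gamma> p = p}"

section \<open>Fuchsian groups\<close>

text \<open>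
  The extended upper half-plane (the upper half-plane together with the cusps) carries the usual
  horoball topology: a basis of neighbourhoods of a cusp \<open>g\<infinity>\<close> consists of the sets
  \<open>{g\<infinity>} \<union> g{z. Im z > M}\<close>.
\<close>

definition ext_half_plane_open :: "(real^2^2) set \<Rightarrow> complex option set \<Rightarrow> bool" where
  "ext_half_plane_open \<Gamma> U \<longleftrightarrow>
     U \<subseteq> Some ` upper_half_plane \<union> cusps \<Gamma> \<and>
     open {z \<in> upper_half_plane. Some z \<in> U} \<and>
     (\<forall>g\<in>carrier (SL2 UNIV). moebius_sphere g None \<in> U \<inter> cusps \<Gamma> \<longrightarrow>
        (\<exists>M>0. \<forall>z. Im z > M \<longrightarrow> Some (moebius_act g z) \<in> U))"

definition ext_half_plane :: "(real^2^2) set \<Rightarrow> complex option topology" where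
  "ext_half_plane \<Gamma> = topology (ext_half_plane_open \<Gamma>)"

lemma istopology_ext_half_plane: "istopology (ext_half_plane_open \<Gamma>)"
  unfolding istopology_def
proof (intro conjI allI impI)
  fix S T assume ST: "ext_half_plane_open \<Gamma> S" "ext_half_plane_open \<Gamma> T"
  have eq: "{z \<in> upper_half_plane. Some z \<in> S \<inter> T} =
      {z \<in> upper_half_plane. Some z \<in> S} \<inter> {z \<in> upper_half_plane. Some z \<in> T}" by blast
  have op: "open {z \<in> upper_half_plane. Some z \<in> S \<inter> T}"
    unfolding eq using ST unfolding ext_half_plane_open_def by (intro open_Int) blast+
  have "\<exists>M>0. \<forall>z. Im z > M \<longrightarrow> Some (moebius_act g z) \<in> S \<inter> T"
    if g: "g \<in> carrier (SL2 UNIV)" "moebius_sphere g None \<in> S \<inter> T \<inter> cusps \<Gamma>" for g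
  proof -
    obtain M where "M > 0" "\<forall>z. Im z > M \<longrightarrow> Some (moebius_act g z) \<in> S"
      using ST(1) g unfolding ext_half_plane_open_def by blast
    moreover obtain N where "N > 0" "\<forall>z. Im z > N \<longrightarrow> Some (moebius_act g z) \<in> T"
      using ST(2) g unfolding ext_half_plane_open_def by blast
    ultimately show ?thesis by (intro exI[of _ "max M N"]) auto
  qed
  moreover have "S \<inter> T \<subseteq> Some ` upper_half_plane \<union> cusps \<Gamma>"
    using ST unfolding ext_half_plane_open_def by (intro le_infI1) blast
  ultimately show "ext_half_plane_open \<Gamma> (S \<inter> T)"
    using op unfolding ext_half_plane_open_def by (intro conjI ballI impI) simp_all
next
  fix \<U> assume U: "\<forall>S\<in>\<U>. ext_half_plane_open \<Gamma> S"
  have eq: "{z \<in> upper_half_plane. Some z \<in> \<Union>\<U>} = (\<Union>S\<in>\<U>. {z \<in> upper_half_plane. Some z \<in> S})"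
    by blast
  have op: "open {z \<in> upper_half_plane. Some z \<in> \<Union>\<U>}"
    unfolding eq using U unfolding ext_half_plane_open_def by (intro open_UN) blast
  have "\<exists>M>0. \<forall>z. Im z > M \<longrightarrow> Some (moebius_act g z) \<in> \<Union>\<U>"
    if g: "g \<in> carrier (SL2 UNIV)" "moebius_sphere g None \<in> \<Union>\<U> \<inter> cusps \<Gamma>" for g
  proof -
    obtain S where S: "S \<in> \<U>" "moebius_sphere g None \<in> S \<inter> cusps \<Gamma>" using g by blast
    then obtain M where "M > 0" "\<forall>z. Im z > M \<longrightarrow> Some (moebius_act g z) \<in> S"
      using U g(1) unfolding ext_half_plane_open_def by blast
    with S show ?thesis by blast
  qed
  moreover have "\<Union>\<U> \<subseteq> Some ` upper_half_plane \<union> cusps \<Gamma>"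
    using U unfolding ext_half_plane_open_def by (intro Union_least) blast
  ultimately show "ext_half_plane_open \<Gamma> (\<Union>\<U>)"
    using op unfolding ext_half_plane_open_def by (intro conjI ballI impI) simp_all
qed

lemma openin_ext_half_plane: "openin (ext_half_plane \<Gamma>) U \<longleftrightarrow> ext_half_plane_open \<Gamma> U"
  by (simp add: ext_half_plane_def istopology_ext_half_plane)

text \<open>
  Fuchsian group of the first kind: a discrete subgroup of \<open>SL(2,\<real>)\<close> such that the quotient of
  the extended upper half-plane is compact.
\<close>

definition fuchsian_first_kind :: "(real^2^2) set \<Rightarrow> bool" where
  "fuchsian_first_kind \<Gamma> \<longleftrightarrow>
     subgroup \<Gamma> (SL2 UNIV) \<and> discrete \<Gamma> \<and>
     (\<exists>X. quotient_map (ext_half_plane \<Gamma>) X (\<lambda>p. (\<lambda>\<gamma>. moebius_sphere \<gamma> p) ` \<Gamma>) \<and> compact_space X)"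

section \<open>Modular functions and twisted modular forms\<close>

text \<open>
  At a cusp \<open>g\<infinity>\<close> the function \<open>t(gz)\<close> has some period \<open>h > 0\<close>; being meromorphic there does not
  depend on the choice of the period. ``Nicely meromorphic'' only fixes the value at the poles.
\<close>

definition modular_function :: "(real^2^2) set \<Rightarrow> (complex \<Rightarrow> complex) \<Rightarrow> bool" where
  "modular_function \<Gamma> t \<longleftrightarrow>
     t nicely_meromorphic_on upper_half_plane \<and>
     (\<forall>\<gamma>\<in>\<Gamma>. \<forall>z\<in>upper_half_plane. t (moebius_act \<gamma> z) = t z) \<and>
     (\<forall>g\<in>carrier (SL2 UNIV). moebius_sphere g None \<in> cusps \<Gamma> \<longrightarrow>
        (\<exists>h>0. \<exists>F M. F meromorphic_on {0} \<and>
           (\<forall>z. Im z > M \<longrightarrow>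
              t (moebius_act g z) = F (exp (2 * of_real pi * \<i> * z / of_real h)))))"

definition equivariant_map ::
  "(real \<Rightarrow> real) \<Rightarrow> (real^2^2) set \<Rightarrow> (complex \<Rightarrow> complex) \<Rightarrow> bool" where
  "equivariant_map \<sigma> \<Gamma> \<phi> \<longleftrightarrow>
     \<phi> holomorphic_on upper_half_plane \<and> \<phi> ` upper_half_plane \<subseteq> upper_half_plane \<and>
     (\<forall>\<gamma>\<in>\<Gamma>. \<forall>z\<in>upper_half_plane. \<phi> (moebius_act \<gamma> z) = moebius_act (conj_matrix \<sigma> \<gamma>) (\<phi> z))"

text \<open>
  The slash operator for arbitrary \<open>g \<in> SL(2,K)\<close>. The result is twisted by
  \<open>(g\<^sup>\<sigma>)\<^sup>-\<^sup>1 \<circ> \<phi> \<circ> g\<close>, which is \<open>\<phi>\<close> itself when \<open>g \<in> \<Gamma>\<close>.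
\<close>

definition twisted_slash ::
  "(real \<Rightarrow> real) \<Rightarrow> (complex \<Rightarrow> complex) \<Rightarrow> nat \<Rightarrow> nat \<Rightarrow> (complex \<Rightarrow> complex) \<Rightarrow> real^2^2 \<Rightarrow> complex \<Rightarrow> complex"
  where
  "twisted_slash \<sigma> \<phi> k l f g z =
     f (moebius_act g z) /
       (autfac g z ^ k *
        autfac (conj_matrix \<sigma> g)
          (moebius_act (matrix_inv (conj_matrix \<sigma> g)) (\<phi> (moebius_act g z))) ^ l)"

definition twisted_modular_form ::
  "real set \<Rightarrow> (real \<Rightarrow> real) \<Rightarrow> (real^2^2) set \<Rightarrow> (complex \<Rightarrow> complex) \<Rightarrow> nat \<Rightarrow> nat \<Rightarrow> (complex \<Rightarrow> complex) \<Rightarrow> bool"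
  where
  "twisted_modular_form K \<sigma> \<Gamma> \<phi> k l f \<longleftrightarrow>
     f holomorphic_on upper_half_plane \<and>
     (\<forall>\<gamma>\<in>\<Gamma>. \<forall>z\<in>upper_half_plane.
        f (moebius_act \<gamma> z) = autfac \<gamma> z ^ k * autfac (conj_matrix \<sigma> \<gamma>) (\<phi> z) ^ l * f z) \<and>
     (\<forall>g\<in>carrier (SL2 K). moebius_sphere g None \<in> cusps \<Gamma> \<longrightarrow>
        (\<exists>M>0. bounded (twisted_slash \<sigma> \<phi> k l f g ` {z. Im z > M})))"

section \<open>Differential equations with algebraic coefficients\<close>

text \<open>
  A multivalued algebraic function of \<open>t\<close> is represented by the single-valued function \<open>a\<close> of \<open>z\<close>
  obtained by substituting \<open>t = t(z)\<close>; \<open>p\<close> is a polynomial in two variables, the outer one for \<open>a\<close>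
  and the inner one for \<open>t\<close>.
\<close>

definition algebraic_over :: "(complex \<Rightarrow> complex) \<Rightarrow> (complex \<Rightarrow> complex) \<Rightarrow> bool" where
  "algebraic_over t a \<longleftrightarrow>
     a nicely_meromorphic_on upper_half_plane \<and>
     (\<exists>p :: complex poly poly. p \<noteq> 0 \<and>
        (\<forall>z\<in>upper_half_plane. t analytic_on {z} \<and> a analytic_on {z} \<longrightarrow>
           poly (poly p [:a z:]) (t z) = 0))"

text \<open>\<open>y\<close> is the branch, given by the region \<open>U\<close>, of the function with \<open>f(z) = y(t(z))\<close>.\<close>

definition local_branch ::
  "(complex \<Rightarrow> complex) \<Rightarrow> (complex \<Rightarrow> complex) \<Rightarrow> complex set \<Rightarrow> (complex \<Rightarrow> complex) \<Rightarrow> bool" where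
  "local_branch f t U y \<longleftrightarrow>
     open U \<and> U \<subseteq> upper_half_plane \<and> t holomorphic_on U \<and> inj_on t U \<and> (\<forall>z\<in>U. f z = y (t z))"

text \<open>
  One and the same equation, of exact order \<open>n\<close>, holds for all branches.
\<close>

definition satisfies_linear_ode ::
  "(complex \<Rightarrow> complex) \<Rightarrow> (complex \<Rightarrow> complex) \<Rightarrow> nat \<Rightarrow> bool" where
  "satisfies_linear_ode f t n \<longleftrightarrow>
     (\<exists>a :: nat \<Rightarrow> complex \<Rightarrow> complex.
        (\<forall>i\<le>n. algebraic_over t (a i)) \<and>
        (\<exists>z\<in>upper_half_plane. a n z \<noteq> 0) \<and>
        (\<forall>U y. local_branch f t U y \<longrightarrow>
           (\<forall>z\<in>U. (\<forall>i\<le>n. a i analytic_on {z}) \<longrightarrow>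
              (\<Sum>i\<le>n. a i z * (deriv ^^ i) y (t z)) = 0)))"

end

theory Submission
  imports Defs
begin

text \<open>
  Write \<open>D = d/dt\<close>. The \<open>(k+1)(l+1)\<close> functions \<open>f z\<^sup>i \<phi>\<^sup>j\<close> (\<open>i \<le> k\<close>, \<open>j \<le> l\<close>) span a space of
  functions that is stable under \<open>\<Gamma>\<close>, so the normalised linear relation of minimal order among the
  derivatives \<open>D\<^sup>r\<close> of all of them has \<open>\<Gamma>\<close>-invariant coefficients. At a cusp these functions are
  polynomials in \<open>z\<close> over the field of \<open>q\<close>-expansions: \<open>\<phi>\<close> grows at most quadratically by the Schwarz
  lemma, so it differs from a linear function by a \<open>q\<close>-expansion. As \<open>z\<close> is transcendental over the
  periodic functions, the invariant coefficients are themselves meromorphic at the cusps, hence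
  modular functions. Two modular functions \<open>t\<close>, \<open>a\<close> are algebraically dependent: for large \<open>N\<close> there are
  more monomials \<open>t\<^sup>r a\<^sup>s\<close> with \<open>r, s \<le> N\<close> than conditions for a combination to be holomorphic on the
  compactified quotient and to vanish at finitely many chosen points, and such a combination is
  zero by the maximum principle. Differentiating the relation raises its order to \<open>(k+1)(l+1)\<close>.
\<close>

text \<open>Two obstacles shape the proof. First, the functions
  \<open>f z\<^sup>i \<phi>\<^sup>j\<close> may be dependent over the constants; then their
  Wronskian vanishes and Cramer's rule yields no equation. Hence the relation of minimal order,
  which may be smaller than \<open>(k+1)(l+1)\<close>. Second, this relation comes from elimination
  among functions that are not periodic at the cusps, and periodicity of a normalised coefficient
  does not bound its growth. Elimination without division keeps numerator and denominator polynomial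
  in z; only then does invariance reduce the quotient to a q-expansion. The bounds i \<le> k and j
  \<le> l are those for which the automorphy factors clear the denominators of the Moebius maps:
  \<Gamma> acts through the k-th symmetric power of \<gamma> tensored with the l-th of its
  conjugate. In the dependence of t and a, (N+1)^2 monomials meet a number of conditions linear in
  N. Vanishing at chosen points serves to exclude a nonzero constant, which the maximum principle
  alone would permit. The linear algebra takes place in the field \<open>mero\<close> of functions
  modulo equality off a discrete set; \<open>mval\<close> leads back to values.\<close>

no_notation fps_nth (infixl "$" 75)
notation upper_half_plane (\<open>\<H>\<close>)

section \<open>Moebius transformations of the upper half-plane\<close>

lemma open_upper_half_plane: "open \<H>"
  unfolding upper_half_plane_def by (rule open_halfspace_Im_gt)

lemma connected_upper_half_plane: "connected \<H>"
  unfolding upper_half_plane_def by (intro convex_connected convex_halfspace_Im_gt)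

lemma eventually_in_upper_half_plane:
  "z \<in> \<H> \<Longrightarrow> eventually (\<lambda>w. w \<in> \<H>) (at z)"
  using open_upper_half_plane by (simp add: eventually_at_in_open')

lemma autfac_nonzero:
  assumes "det g = 1" "z \<in> \<H>"
  shows "autfac g z \<noteq> 0"
proof
  assume z: "autfac g z = 0"
  have "g $ 2 $ 1 * Im z = 0" "g $ 2 $ 1 * Re z + g $ 2 $ 2 = 0"
    using arg_cong[OF z, of Im] arg_cong[OF z, of Re] by (simp_all add: autfac_def)
  with assms show False by (auto simp: det_2 upper_half_plane_def)
qed

lemma Im_moebius_act:
  assumes "det g = 1"
  shows "Im (moebius_act g z) = Im z / (cmod (autfac g z))\<^sup>2"
proof -
  have "Im (moebius_act g z) = ((g $ 1 $ 1 * Im z) * (g $ 2 $ 1 * Re z + g $ 2 $ 2) -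
      (g $ 1 $ 1 * Re z + g $ 1 $ 2) * (g $ 2 $ 1 * Im z)) / (cmod (autfac g z))\<^sup>2"
    by (simp add: moebius_act_def Im_divide autfac_def cmod_power2)
  also have "(g $ 1 $ 1 * Im z) * (g $ 2 $ 1 * Re z + g $ 2 $ 2) -
      (g $ 1 $ 1 * Re z + g $ 1 $ 2) * (g $ 2 $ 1 * Im z) = det g * Im z"
    by (simp add: det_2 algebra_simps)
  finally show ?thesis using assms by simp
qed

lemma moebius_act_in_upper_half_plane:
  assumes "det g = 1" "z \<in> \<H>"
  shows "moebius_act g z \<in> \<H>"
  using assms autfac_nonzero[OF assms] by (simp add: upper_half_plane_def Im_moebius_act)

lemma autfac_mult:
  assumes "det g' = 1" "z \<in> \<H>"
  shows "autfac (g ** g') z = autfac g (moebius_act g' z) * autfac g' z"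
  using autfac_nonzero[OF assms]
  by (simp add: autfac_def[of "g ** g'"] autfac_def[of g] moebius_act_def
      matrix_matrix_mult_def UNIV_2 field_simps) (simp add: autfac_def algebra_simps)

lemma moebius_act_mult:
  assumes "det g = 1" "det g' = 1" "z \<in> \<H>"
  shows "moebius_act (g ** g') z = moebius_act g (moebius_act g' z)"
proof -
  have n: "autfac g' z \<noteq> 0" "autfac g (moebius_act g' z) \<noteq> 0"
    using autfac_nonzero moebius_act_in_upper_half_plane assms by blast+
  have e: "of_real (g $ 1 $ 1) * moebius_act g' z + of_real (g $ 1 $ 2) =
    (of_real ((g ** g') $ 1 $ 1) * z + of_real ((g ** g') $ 1 $ 2)) / autfac g' z"
    using n(1) by (simp add: moebius_act_def matrix_matrix_mult_def UNIV_2 field_simps)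
      (simp add: autfac_def algebra_simps)
  show ?thesis
    unfolding moebius_act_def[of "g ** g'"] moebius_act_def[of g] e autfac_mult[OF assms(2,3)]
    using n by (simp add: field_simps)
qed

lemma moebius_act_one [simp]: "moebius_act (mat 1) z = z"
  by (simp add: moebius_act_def autfac_def mat_def)

lemma moebius_act_analytic:
  assumes "det g = 1"
  shows "moebius_act g analytic_on \<H>"
  unfolding moebius_act_def[abs_def] using autfac_nonzero[OF assms]
  by (auto simp: autfac_def intro!: analytic_intros)

lemma matrix_inv_det1:
  assumes "det (g :: real^2^2) = 1"
  shows "det (matrix_inv g) = 1" "matrix_inv g ** g = mat 1" "g ** matrix_inv g = mat 1"
proof -
  have "invertible g" using assms by (simp add: invertible_det_nz)
  then show 1: "matrix_inv g ** g = mat 1" "g ** matrix_inv g = mat 1"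
    unfolding matrix_inv_def invertible_def by (rule someI2_ex; blast)+
  from arg_cong[OF this(1), of det] show "det (matrix_inv g) = 1"
    using assms by (simp add: det_mul)
qed

lemma moebius_act_inv:
  assumes "det g = 1" "z \<in> \<H>"
  shows "moebius_act g (moebius_act (matrix_inv g) z) = z"
    and "moebius_act (matrix_inv g) (moebius_act g z) = z"
  using assms matrix_inv_det1[OF assms(1)] by (simp_all flip: moebius_act_mult)

lemma inj_on_moebius_act:
  assumes "det g = 1"
  shows "inj_on (moebius_act g) \<H>"
  using moebius_act_inv(2)[OF assms] by (rule inj_on_inverseI)

text \<open>Injectivity sends punctured neighbourhoods to punctured ones, so that what holds
  eventually near \<open>moebius_act g z\<close> can be pulled back to z. The composition
  \<open>mcomp\<close> is well defined for this reason.\<close>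

lemma filterlim_moebius_act:
  assumes g: "det g = 1" and z: "z \<in> \<H>"
  shows "filterlim (moebius_act g) (at (moebius_act g z)) (at z)"
proof (rule filterlim_atI)
  have "moebius_act g analytic_on {z}"
    using moebius_act_analytic[OF g] z by (auto intro: analytic_on_subset)
  then show "(moebius_act g \<longlongrightarrow> moebius_act g z) (at z)"
    using analytic_at_imp_isCont isContD by blast
  have "eventually (\<lambda>w. w \<noteq> z) (at z)" by (simp add: eventually_at_filter)
  then show "\<forall>\<^sub>F w in at z. moebius_act g w \<noteq> moebius_act g z"
    using eventually_in_upper_half_plane[OF z]
    by eventually_elim (use inj_on_moebius_act[OF g] z in \<open>auto simp: inj_on_def\<close>)
qed

section \<open>The field of meromorphic functions on the upper half-plane\<close>

text \<open>Agreement on a punctured neighbourhood of z is agreement on a full neighbourhood of each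
  nearby w other than z, which is what \<open>deriv\<close> sees. This makes differentiation well
  defined on classes.\<close>

lemma eventually_deriv_eq:
  assumes "\<forall>\<^sub>F w in at z. u w = v w"
  shows "\<forall>\<^sub>F w in at z. deriv u w = (deriv v w :: complex)"
proof -
  obtain S where S: "open S" "z \<in> S" "\<And>w. w \<in> S \<Longrightarrow> w \<noteq> z \<Longrightarrow> u w = v w"
    using assms unfolding eventually_at_topological by blast
  have "deriv u w = deriv v w" if "w \<in> S" "w \<noteq> z" for w
  proof (rule deriv_cong_ev)
    have "\<forall>\<^sub>F x in nhds w. x \<in> S - {z}"
      using S that by (intro eventually_nhds_in_open) auto
    then show "\<forall>\<^sub>F x in nhds w. u x = v x"
      by eventually_elim (use S in auto)
  qed simp
  then show ?thesis using S unfolding eventually_at_topological by blast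
qed

lemma meromorphic_on_eventually_analytic:
  assumes "u meromorphic_on A" "z \<in> A"
  shows "\<forall>\<^sub>F w in at z. u analytic_on {w}"
  using eventually_cosparse_imp_eventually_at[OF meromorphic_on_imp_analytic_cosparse[OF assms(1)] assms(2)]
  by (simp add: eventually_mono)

\<comment> \<open>As functions, meromorphic maps may take arbitrary values on a discrete set and
  form no field; their classes modulo such changes do. The quotient is partial because only
  functions meromorphic on \<H> have a class.\<close>
quotient_type mero = "complex \<Rightarrow> complex" / partial:
  "\<lambda>u v. u meromorphic_on \<H> \<and> v meromorphic_on \<H> \<and>
     (\<forall>z\<in>\<H>. \<forall>\<^sub>F w in at z. u w = v w)"
proof (intro part_equivpI sympI transpI)
  show "\<exists>x. x meromorphic_on \<H> \<and> x meromorphic_on \<H> \<and>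
      (\<forall>z\<in>\<H>. \<forall>\<^sub>F w in at z. x w = x w)"
    by (intro exI[of _ "\<lambda>_. 0"]) auto
  fix x y :: "complex \<Rightarrow> complex"
  assume "x meromorphic_on \<H> \<and> y meromorphic_on \<H> \<and>
      (\<forall>z\<in>\<H>. \<forall>\<^sub>F w in at z. x w = y w)"
  then show "y meromorphic_on \<H> \<and> x meromorphic_on \<H> \<and>
      (\<forall>z\<in>\<H>. \<forall>\<^sub>F w in at z. y w = x w)"
    by (simp add: eq_commute)
next
  fix x y u :: "complex \<Rightarrow> complex"
  assume "x meromorphic_on \<H> \<and> y meromorphic_on \<H> \<and>
      (\<forall>z\<in>\<H>. \<forall>\<^sub>F w in at z. x w = y w)"
    and "y meromorphic_on \<H> \<and> u meromorphic_on \<H> \<and>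
      (\<forall>z\<in>\<H>. \<forall>\<^sub>F w in at z. y w = u w)"
  moreover have "\<forall>\<^sub>F w in at z. x w = u w"
    if "\<forall>\<^sub>F w in at z. x w = y w" "\<forall>\<^sub>F w in at z. y w = u w" for z
    using that by eventually_elim simp
  ultimately show "x meromorphic_on \<H> \<and> u meromorphic_on \<H> \<and>
      (\<forall>z\<in>\<H>. \<forall>\<^sub>F w in at z. x w = u w)"
    by blast
qed

lemma eventually_eq_binop:
  assumes "\<forall>z\<in>A. \<forall>\<^sub>F w in at z. u w = u' w" "\<forall>z\<in>A. \<forall>\<^sub>F w in at z. v w = v' w"
  shows "\<forall>z\<in>A. \<forall>\<^sub>F w in at z. f (u w) (v w) = f (u' w) (v' w)"
proof
  fix z assume "z \<in> A"
  with assms have "\<forall>\<^sub>F w in at z. u w = u' w" "\<forall>\<^sub>F w in at z. v w = v' w" by auto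
  then show "\<forall>\<^sub>F w in at z. f (u w) (v w) = f (u' w) (v' w)" by eventually_elim simp
qed

instantiation mero :: field
begin

lift_definition zero_mero :: mero is "\<lambda>_. 0" by auto
lift_definition one_mero :: mero is "\<lambda>_. 1" by auto
lift_definition plus_mero :: "mero \<Rightarrow> mero \<Rightarrow> mero" is "\<lambda>u v z. u z + v z"
  subgoal for u u' v v'
    using eventually_eq_binop[of \<H> u u' v v' "(+)"]
    by (auto intro!: meromorphic_intros)
  done
lift_definition minus_mero :: "mero \<Rightarrow> mero \<Rightarrow> mero" is "\<lambda>u v z. u z - v z"
  subgoal for u u' v v'
    using eventually_eq_binop[of \<H> u u' v v' "(-)"]
    by (auto intro!: meromorphic_intros)
  done
lift_definition times_mero :: "mero \<Rightarrow> mero \<Rightarrow> mero" is "\<lambda>u v z. u z * v z"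
  subgoal for u u' v v'
    using eventually_eq_binop[of \<H> u u' v v' "(*)"]
    by (auto intro!: meromorphic_intros)
  done
lift_definition uminus_mero :: "mero \<Rightarrow> mero" is "\<lambda>u z. - u z"
  by (auto intro!: meromorphic_intros dest!: bspec elim: eventually_mono)
lift_definition inverse_mero :: "mero \<Rightarrow> mero" is "\<lambda>u z. inverse (u z)"
  by (auto intro!: meromorphic_intros dest!: bspec elim: eventually_mono)
lift_definition divide_mero :: "mero \<Rightarrow> mero \<Rightarrow> mero" is "\<lambda>u v z. u z / v z"
  subgoal for u u' v v'
    using eventually_eq_binop[of \<H> u u' v v' "(/)"]
    by (auto intro!: meromorphic_intros)
  done

instance
proof
  fix a b c :: mero
  show "a * b * c = a * (b * c)"
    by (transfer, auto intro!: meromorphic_intros simp: algebra_simps divide_inverse)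
  show "a * b = b * a"
    by (transfer, auto intro!: meromorphic_intros simp: algebra_simps divide_inverse)
  show "1 * a = a"
    by (transfer, auto intro!: meromorphic_intros simp: algebra_simps divide_inverse)
  show "a + b + c = a + (b + c)"
    by (transfer, auto intro!: meromorphic_intros simp: algebra_simps divide_inverse)
  show "a + b = b + a"
    by (transfer, auto intro!: meromorphic_intros simp: algebra_simps divide_inverse)
  show "0 + a = a"
    by (transfer, auto intro!: meromorphic_intros simp: algebra_simps divide_inverse)
  show "- a + a = 0"
    by (transfer, auto intro!: meromorphic_intros simp: algebra_simps divide_inverse)
  show "a - b = a + - b"
    by (transfer, auto intro!: meromorphic_intros simp: algebra_simps divide_inverse)
  show "(a + b) * c = a * c + b * c"
    by (transfer, auto intro!: meromorphic_intros simp: algebra_simps divide_inverse)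
  show "a div b = a * inverse b"
    by (transfer, auto intro!: meromorphic_intros simp: algebra_simps divide_inverse)
  show "inverse 0 = (0 :: mero)"
    by (transfer, auto intro!: meromorphic_intros simp: algebra_simps divide_inverse)
  show "0 \<noteq> (1 :: mero)"
  proof (transfer)
    have "\<i> \<in> \<H>" by (simp add: upper_half_plane_def)
    then show "\<not> ((\<lambda>_. 0) meromorphic_on \<H> \<and> (\<lambda>_. 1) meromorphic_on \<H> \<and>
       (\<forall>z\<in>\<H>. \<forall>\<^sub>F w in at z. 0 = (1::complex)))"
      by (auto simp: eventually_False)
  qed
  show "a \<noteq> 0 \<Longrightarrow> inverse a * a = 1"
  proof (transfer, elim conjE, intro conjI)
    fix u assume u: "u meromorphic_on \<H>"
      "\<not> (u meromorphic_on \<H> \<and> (\<lambda>_. 0) meromorphic_on \<H> \<and>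
             (\<forall>z\<in>\<H>. \<forall>\<^sub>F w in at z. u w = 0))"
    show "(\<lambda>z. inverse (u z) * u z) meromorphic_on \<H>"
      using u by (intro meromorphic_intros)
    \<comment> \<open>Connectedness of \<H> enters here: a meromorphic function that is not zero
      almost everywhere is nonzero off a sparse set, so the pointwise inverse is an inverse of its
      class.\<close>
    have "\<not> eventually (\<lambda>z. u z = 0) (cosparse \<H>)"
      using u by (auto dest: eventually_cosparse_imp_eventually_at[where B = UNIV])
    then have "eventually (\<lambda>z. u z \<noteq> 0) (cosparse \<H>)"
      using meromorphic_imp_constant_or_avoid[OF u(1) open_upper_half_plane connected_upper_half_plane]
      by blast
    then show "\<forall>z\<in>\<H>. \<forall>\<^sub>F w in at z. inverse (u w) * u w = 1"
      by (auto dest!: eventually_cosparse_imp_eventually_at[where B = UNIV] elim: eventually_mono)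
  qed auto
qed

end

section \<open>Constants, differentiation and Moebius substitution on the field\<close>

lift_definition mconst :: "complex \<Rightarrow> mero" is "\<lambda>c _. c" by auto
lift_definition mid :: mero is "\<lambda>z. z" by (auto intro: meromorphic_intros)

lemma mconst_simps [simp]:
  "mconst 0 = 0" "mconst 1 = 1" "mconst (a + b) = mconst a + mconst b"
  "mconst (a - b) = mconst a - mconst b" "mconst (- a) = - mconst a"
  "mconst (a * b) = mconst a * mconst b"
  by (transfer; auto)+

lemma mconst_eq_iff [simp]: "mconst a = mconst b \<longleftrightarrow> a = b"
proof
  have "\<i> \<in> \<H>" by (simp add: upper_half_plane_def)
  then show "mconst a = mconst b \<Longrightarrow> a = b"
    by transfer (auto simp: eventually_const_iff)
qed simp

lift_definition mderiv :: "mero \<Rightarrow> mero" is deriv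
  by (auto intro!: meromorphic_intros eventually_deriv_eq)

lemma mderiv_simps [simp]:
  "mderiv (mconst c) = 0" "mderiv mid = 1" "mderiv (a + b) = mderiv a + mderiv b"
  "mderiv (a * b) = mderiv a * b + a * mderiv b"
     apply (transfer; auto)
    apply (transfer; auto intro!: meromorphic_intros)
  subgoal
  proof (transfer, elim conjE, intro conjI ballI)
    fix u v z assume uv: "u meromorphic_on \<H>" "v meromorphic_on \<H>"
      and z: "z \<in> \<H>"
    show "\<forall>\<^sub>F w in at z. deriv (\<lambda>z. u z + v z) w = deriv u w + deriv v w"
      using meromorphic_on_eventually_analytic[OF uv(1) z] meromorphic_on_eventually_analytic[OF uv(2) z]
      by eventually_elim (auto intro!: deriv_add analytic_on_imp_differentiable_at)
  qed (auto intro!: meromorphic_intros)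
  subgoal
  proof (transfer, elim conjE, intro conjI ballI)
    fix u v z assume uv: "u meromorphic_on \<H>" "v meromorphic_on \<H>"
      and z: "z \<in> \<H>"
    show "\<forall>\<^sub>F w in at z. deriv (\<lambda>z. u z * v z) w = deriv u w * v w + u w * deriv v w"
      using meromorphic_on_eventually_analytic[OF uv(1) z] meromorphic_on_eventually_analytic[OF uv(2) z]
      by eventually_elim (auto intro!: deriv_mult[THEN trans] analytic_on_imp_differentiable_at)
  qed (auto intro!: meromorphic_intros)
  done

text \<open>
  If \<open>det g \<noteq> 1\<close>, the half-plane need not be preserved; \<open>mcomp g\<close> is then the identity.
\<close>

lift_definition mcomp :: "real^2^2 \<Rightarrow> mero \<Rightarrow> mero" is
  "\<lambda>g u. if det g = 1 then (\<lambda>z. u (moebius_act g z)) else u"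
proof goal_cases
  case (1 g u v)
  show ?case
  proof (cases "det g = 1")
    case True
    have "(\<lambda>z. w (moebius_act g z)) meromorphic_on \<H>"
      if "w meromorphic_on \<H>" for w
      using meromorphic_on_compose[OF that moebius_act_analytic[OF True]]
        moebius_act_in_upper_half_plane[OF True] by blast
    moreover have "\<forall>\<^sub>F w in at z. u (moebius_act g w) = v (moebius_act g w)"
      if "z \<in> \<H>" for z
    proof -
      have "\<forall>\<^sub>F w in at (moebius_act g z). u w = v w"
        using 1 moebius_act_in_upper_half_plane[OF True that] by blast
      then show ?thesis
        using filterlim_moebius_act[OF True that] by (rule eventually_compose_filterlim)
    qed
    ultimately show ?thesis using 1 True by auto
  qed (use 1 in auto)
qed

lemma mcomp_arith [simp]:
  "mcomp g 0 = 0" "mcomp g 1 = 1" "mcomp g (mconst c) = mconst c"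
  by (transfer, auto)+

lemma meromorphic_on_moebius_act:
  assumes u: "u meromorphic_on \<H>" and g: "det g = 1"
  shows "(\<lambda>z. u (moebius_act g z)) meromorphic_on \<H>"
  using meromorphic_on_compose[OF u moebius_act_analytic[OF g]]
    moebius_act_in_upper_half_plane[OF g] by blast

lemma mcomp_simps [simp]:
  "mcomp g (a + b) = mcomp g a + mcomp g b" "mcomp g (a - b) = mcomp g a - mcomp g b"
  "mcomp g (- a) = - mcomp g a" "mcomp g (a * b) = mcomp g a * mcomp g b"
  "mcomp g (inverse a) = inverse (mcomp g a)" "mcomp g (a / b) = mcomp g a / mcomp g b"
  by (transfer, auto intro!: meromorphic_intros meromorphic_on_moebius_act)+

lemma mcomp_power [simp]: "mcomp g (a ^ n) = mcomp g a ^ n"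
  by (induction n) auto

lemma mcomp_sum [simp]: "mcomp g (sum f A) = (\<Sum>i\<in>A. mcomp g (f i))"
  by (induction A rule: infinite_finite_induct) auto

lemma mcomp_one [simp]: "mcomp (mat 1) a = a"
  by (transfer, auto)

lemma mcomp_mcomp:
  assumes "det g = 1" "det g' = 1"
  shows "mcomp g (mcomp g' a) = mcomp (g' ** g) a"
  using assms
proof (transfer, auto simp: det_mul intro!: meromorphic_on_moebius_act, goal_cases)
  case (1 g g' u z)
  then have "z \<in> \<H>" by auto
  then show ?case
    using eventually_in_upper_half_plane[of z] 1 by (auto simp: moebius_act_mult elim: eventually_mono)
qed

lemma mcomp_inj:
  assumes "det g = 1" "mcomp g a = mcomp g b"
  shows "a = b"
proof -
  have "mcomp (matrix_inv g) (mcomp g c) = c" for c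
    using assms(1) by (simp add: mcomp_mcomp matrix_inv_det1)
  then show ?thesis using assms(2) by metis
qed

text \<open>The chain rule, with \<open>mderiv (mcomp g mid)\<close> as the derivative of the
  Moebius map. The same factor occurs for every function and will cancel in quotients of
  derivatives.\<close>

lemma mderiv_mcomp:
  assumes g: "det g = 1"
  shows "mderiv (mcomp g a) = mcomp g (mderiv a) * mderiv (mcomp g mid)"
  using g
proof (transfer, auto intro!: meromorphic_on_moebius_act meromorphic_intros, goal_cases)
  case (1 g u z)
  then have z: "z \<in> \<H>" and u: "u meromorphic_on \<H>" and g: "det g = 1"
    by auto
  have "\<forall>\<^sub>F w in at (moebius_act g z). u analytic_on {w}"
    using u g z by (intro meromorphic_on_eventually_analytic[of _ \<H>] moebius_act_in_upper_half_plane)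
  then have "\<forall>\<^sub>F w in at z. u analytic_on {moebius_act g w}"
    using filterlim_moebius_act[OF g z] by (rule eventually_compose_filterlim)
  with eventually_in_upper_half_plane[OF z]
  show ?case
  proof eventually_elim
    case (elim w)
    have "moebius_act g field_differentiable at w"
      using moebius_act_analytic[OF g] elim(1) by (auto intro: analytic_on_imp_differentiable_at analytic_on_subset)
    moreover have "u field_differentiable at (moebius_act g w)"
      using elim(2) by (auto intro: analytic_on_imp_differentiable_at)
    ultimately show ?case
      using deriv_chain[of "moebius_act g" w u] by (simp add: o_def)
  qed
qed

text \<open>If this derivative vanished, the chain rule applied to g and its inverse would
  differentiate z to 0 instead of 1.\<close>

lemma mderiv_mcomp_mid_nonzero:
  assumes g: "det g = 1"
  shows "mderiv (mcomp g mid) \<noteq> 0"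
proof
  assume 0: "mderiv (mcomp g mid) = 0"
  have "mcomp g (mcomp (matrix_inv g) mid) = mid"
    using g by (simp add: mcomp_mcomp matrix_inv_det1)
  then have "mderiv mid = mcomp g (mderiv (mcomp (matrix_inv g) mid)) * 0"
    using mderiv_mcomp[OF g, of "mcomp (matrix_inv g) mid"] 0 by simp
  then show False by (simp del: mconst_simps)
qed

section \<open>Passage between classes and functions\<close>

text \<open>The representative without removable singularities; it is \<open>0\<close> at the poles.\<close>

lift_definition mval :: "mero \<Rightarrow> complex \<Rightarrow> complex" is
  "\<lambda>u z. if z \<in> \<H> then remove_sings u z else 0"
  by (auto intro!: ext remove_sings_cong)

lift_definition mero_of :: "(complex \<Rightarrow> complex) \<Rightarrow> mero" is
  "\<lambda>u. if u meromorphic_on \<H> then u else (\<lambda>_. 0)"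
  by auto

lemma eventually_mval:
  assumes "u meromorphic_on \<H>" "z \<in> \<H>"
  shows "\<forall>\<^sub>F w in at z. (if w \<in> \<H> then remove_sings u w else 0) = u w"
  using eventually_in_upper_half_plane[OF assms(2)]
    eventually_cosparse_imp_eventually_at[OF eventually_remove_sings_eq[OF assms(1)] assms(2), of UNIV]
  by eventually_elim simp

lemma eventually_mval_mero_of:
  assumes "u meromorphic_on \<H>" "z \<in> \<H>"
  shows "\<forall>\<^sub>F w in at z. mval (mero_of u) w = u w"
  using assms by transfer (simp only: if_True, simp only: eventually_mval)

lemma mval_nicely_meromorphic: "mval a nicely_meromorphic_on \<H>"
proof transfer
  fix u assume "u meromorphic_on \<H> \<and> u meromorphic_on \<H> \<and>
    (\<forall>z\<in>\<H>. \<forall>\<^sub>F w in at z. u w = u w)"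
  then have u: "u meromorphic_on \<H>" by simp
  let ?v = "\<lambda>z. if z \<in> \<H> then remove_sings u z else 0"
  have r: "remove_sings u nicely_meromorphic_on \<H>"
    by (rule remove_sings_nicely_meromorphic[OF u])
  have e: "\<forall>\<^sub>F w in at z. ?v w = remove_sings u w" if "z \<in> \<H>" for z
    using eventually_in_upper_half_plane[OF that] by eventually_elim simp
  show "?v nicely_meromorphic_on \<H>"
    unfolding nicely_meromorphic_on_def
  proof (intro conjI ballI)
    show "?v meromorphic_on \<H>"
      using r meromorphic_on_cong[OF e refl] by (auto simp: nicely_meromorphic_on_def)
    fix z assume z: "z \<in> \<H>"
    have "is_pole ?v z \<longleftrightarrow> is_pole (remove_sings u) z"
      using e[OF z] by (intro is_pole_cong) auto
    moreover have "(?v \<longlongrightarrow> remove_sings u z) (at z) \<longleftrightarrow> (remove_sings u \<longlongrightarrow> remove_sings u z) (at z)"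
      using e[OF z] by (intro filterlim_cong) auto
    ultimately show "is_pole ?v z \<and> ?v z = 0 \<or> (?v \<longlongrightarrow> ?v z) (at z)"
      using r z by (auto simp: nicely_meromorphic_on_def)
  qed
qed

lemma mval_meromorphic: "mval a meromorphic_on \<H>"
  using mval_nicely_meromorphic by (auto simp: nicely_meromorphic_on_def)

lemma mero_of_mval [simp]: "mero_of (mval a) = a"
proof -
  have "mero_of (mval a) = a"
    using mval_meromorphic[of a]
    by transfer (elim conjE, simp only: if_True, intro conjI ballI;
        (assumption | (rule eventually_mval; assumption)))
  then show ?thesis .
qed

text \<open>The way from eventual to pointwise statements: \<open>mval a\<close> is nicely
  meromorphic, so without a pole it is continuous at z, and it has the same limit there as
  v.\<close>

lemma mval_at_analytic:
  assumes z: "z \<in> \<H>" and v: "v analytic_on {z}" "\<forall>\<^sub>F w in at z. mval a w = v w"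
  shows "mval a analytic_on {z}" "mval a z = v z"
proof -
  have np: "\<not> is_pole (mval a) z"
  proof -
    have "is_pole (mval a) z \<longleftrightarrow> is_pole v z" using v(2) by (intro is_pole_cong) auto
    then show ?thesis using v(1) analytic_at_imp_no_pole by blast
  qed
  then show an: "mval a analytic_on {z}"
    using mval_nicely_meromorphic z nicely_meromorphic_on_imp_analytic_at by blast
  have "(mval a \<longlongrightarrow> mval a z) (at z)" "(v \<longlongrightarrow> v z) (at z)"
    using an v(1) analytic_at_imp_isCont isContD by blast+
  moreover have "(mval a \<longlongrightarrow> v z) (at z) \<longleftrightarrow> (v \<longlongrightarrow> v z) (at z)"
    using v(2) by (intro filterlim_cong) auto
  ultimately show "mval a z = v z" using tendsto_unique at_neq_bot by blast
qed

lemma mval_mero_of: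
  assumes "u nicely_meromorphic_on \<H>" "z \<in> \<H>"
  shows "mval (mero_of u) z = u z"
proof -
  have u: "u meromorphic_on \<H>" using assms by (simp add: nicely_meromorphic_on_def)
  have "mval (mero_of u) z = remove_sings u z" using u assms(2) by transfer simp
  then show ?thesis
    using assms by (auto simp: nicely_meromorphic_on_def)
qed

lemma mero_of_ops:
  assumes "u meromorphic_on \<H>" "v meromorphic_on \<H>"
  shows "mero_of u + mero_of v = mero_of (\<lambda>z. u z + v z)"
    and "mero_of u - mero_of v = mero_of (\<lambda>z. u z - v z)"
    and "mero_of u * mero_of v = mero_of (\<lambda>z. u z * v z)"
    and "mero_of u / mero_of v = mero_of (\<lambda>z. u z / v z)"
    and "mderiv (mero_of u) = mero_of (deriv u)"
    and "det g = 1 \<Longrightarrow> mcomp g (mero_of u) = mero_of (\<lambda>z. u (moebius_act g z))"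
  using assms by (transfer, auto intro!: meromorphic_intros meromorphic_on_moebius_act)+

text \<open>These rules hold only near z and may fail at z itself, since \<open>mval\<close> is 0 at
  poles and has removable singularities filled in.\<close>

lemma eventually_mval_ops:
  assumes z: "z \<in> \<H>"
  shows "\<forall>\<^sub>F w in at z. mval (a + b) w = mval a w + mval b w"
    and "\<forall>\<^sub>F w in at z. mval (a - b) w = mval a w - mval b w"
    and "\<forall>\<^sub>F w in at z. mval (a * b) w = mval a w * mval b w"
    and "\<forall>\<^sub>F w in at z. mval (a / b) w = mval a w / mval b w"
    and "\<forall>\<^sub>F w in at z. mval (mderiv a) w = deriv (mval a) w"
    and "det g = 1 \<Longrightarrow> \<forall>\<^sub>F w in at z. mval (mcomp g a) w = mval a (moebius_act g w)"
  using eventually_mval_mero_of[OF _ z] mero_of_ops[OF mval_meromorphic[of a] mval_meromorphic[of b]]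
    mval_meromorphic[of a] mval_meromorphic[of b]
  by (auto intro!: meromorphic_intros meromorphic_on_moebius_act)

lemma mconst_eq_mero_of: "mconst c = mero_of (\<lambda>_. c)" and mid_eq_mero_of: "mid = mero_of (\<lambda>z. z)"
  by (transfer, auto intro!: meromorphic_intros)+

lemma mval_mconst: "z \<in> \<H> \<Longrightarrow> mval (mconst c) z = c"
  unfolding mconst_eq_mero_of by (rule mval_mero_of) auto

lemma mero_eq_iff:
  "a = b \<longleftrightarrow> (\<forall>z\<in>\<H>. \<forall>\<^sub>F w in at z. mval a w = mval b w)"
proof
  assume "\<forall>z\<in>\<H>. \<forall>\<^sub>F w in at z. mval a w = mval b w"
  then have "mero_of (mval a) = mero_of (mval b)"
    using mval_meromorphic[of a] mval_meromorphic[of b] by transfer simp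
  then show "a = b" by simp
qed simp

section \<open>Linear systems and linear differential relations\<close>

definition subring_of :: "'a::comm_ring_1 set \<Rightarrow> bool" where
  "subring_of S \<longleftrightarrow> 1 \<in> S \<and> (\<forall>x\<in>S. \<forall>y\<in>S. x - y \<in> S \<and> x * y \<in> S)"

lemma subring_ofD:
  assumes "subring_of S"
  shows "0 \<in> S" "1 \<in> S" "x \<in> S \<Longrightarrow> - x \<in> S" "x \<in> S \<Longrightarrow> y \<in> S \<Longrightarrow> x + y \<in> S"
    "x \<in> S \<Longrightarrow> y \<in> S \<Longrightarrow> x - y \<in> S" "x \<in> S \<Longrightarrow> y \<in> S \<Longrightarrow> x * y \<in> S"
proof -
  show 1: "1 \<in> S" and m: "x \<in> S \<Longrightarrow> y \<in> S \<Longrightarrow> x - y \<in> S" and "x \<in> S \<Longrightarrow> y \<in> S \<Longrightarrow> x * y \<in> S" for x y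
    using assms by (auto simp: subring_of_def)
  show 0: "0 \<in> S" using m[OF 1 1] by simp
  show n: "x \<in> S \<Longrightarrow> - x \<in> S" for x using m[OF 0, of x] by simp
  show "x \<in> S \<Longrightarrow> y \<in> S \<Longrightarrow> x + y \<in> S" using m[OF _ n, of x y] by simp
qed

lemma subring_of_sum:
  assumes "subring_of S" "\<And>i. i \<in> A \<Longrightarrow> f i \<in> S"
  shows "sum f A \<in> S"
  using assms(2) by (induction A rule: infinite_finite_induct) (auto intro: subring_ofD[OF assms(1)])

text \<open>Fraction-free Gaussian elimination: the solution stays inside the subring of the entries.\<close>

lemma homogeneous_system_solvable:
  fixes A :: "'i \<Rightarrow> 'j \<Rightarrow> 'a::idom"
  assumes S: "subring_of S" and "finite I" "finite J" "card I < card J"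
    and "\<And>i j. i \<in> I \<Longrightarrow> j \<in> J \<Longrightarrow> A i j \<in> S"
  shows "\<exists>c. (\<forall>j\<in>J. c j \<in> S) \<and> (\<exists>j\<in>J. c j \<noteq> 0) \<and> (\<forall>i\<in>I. (\<Sum>j\<in>J. A i j * c j) = 0)"
  using assms(2-)
proof (induction I arbitrary: J A rule: finite_induct)
  case empty
  then have "J \<noteq> {}" by auto
  then show ?case using subring_ofD(2)[OF S] by (intro exI[of _ "\<lambda>_. 1"]) auto
next
  case (insert i0 I)
  show ?case
  proof (cases "\<forall>j\<in>J. A i0 j = 0")
    case True
    have "card I < card J" using insert by simp
    from insert.IH[OF insert.prems(1) this] insert.prems(3)
    obtain c where "\<forall>j\<in>J. c j \<in> S" "\<exists>j\<in>J. c j \<noteq> 0" "\<forall>i\<in>I. (\<Sum>j\<in>J. A i j * c j) = 0"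
      by blast
    with True show ?thesis by (intro exI[of _ c]) auto
  next
    case False
    then obtain j0 where j0: "j0 \<in> J" "A i0 j0 \<noteq> 0" by blast
    define J' where "J' = J - {j0}"
    have J': "finite J'" "card I < card J'" "J = insert j0 J'" "j0 \<notin> J'"
      using insert j0 by (auto simp: J'_def)
    define A' where "A' i j = A i0 j0 * A i j - A i j0 * A i0 j" for i j
    have "A' i j \<in> S" if "i \<in> I" "j \<in> J'" for i j
      using that insert.prems(3) J' unfolding A'_def by (intro subring_ofD[OF S]) auto
    from insert.IH[where A = A', OF J'(1,2) this] obtain c where
      c: "\<forall>j\<in>J'. c j \<in> S" "\<exists>j\<in>J'. c j \<noteq> 0" "\<forall>i\<in>I. (\<Sum>j\<in>J'. A' i j * c j) = 0" by blast
    define d where "d j = (if j = j0 then - (\<Sum>j\<in>J'. A i0 j * c j) else A i0 j0 * c j)" for j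
    have d: "(\<Sum>j\<in>J. A i j * d j) =
        (\<Sum>j\<in>J'. A i j * (A i0 j0 * c j)) - A i j0 * (\<Sum>j\<in>J'. A i0 j * c j)" for i
    proof -
      have "(\<Sum>j\<in>J'. A i j * d j) = (\<Sum>j\<in>J'. A i j * (A i0 j0 * c j))"
        using J'(4) by (intro sum.cong) (auto simp: d_def)
      then show ?thesis using J' by (simp add: d_def)
    qed
    show ?thesis
    proof (intro exI[of _ d] conjI ballI)
      fix j assume "j \<in> J"
      then show "d j \<in> S"
        using c insert.prems(3) J' j0 unfolding d_def
        by (auto intro!: subring_ofD[OF S] subring_of_sum[OF S])
    next
      show "\<exists>j\<in>J. d j \<noteq> 0" using c(2) J' j0 by (auto simp: d_def)
    next
      fix i assume i: "i \<in> insert i0 I"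
      show "(\<Sum>j\<in>J. A i j * d j) = 0"
      proof (cases "i = i0")
        case True
        then show ?thesis unfolding d by (simp add: sum_distrib_left mult_ac)
      next
        case False
        then have "(\<Sum>j\<in>J'. A' i j * c j) = 0" using i c by auto
        then show ?thesis
          unfolding d A'_def by (simp add: sum_distrib_left sum_subtractf algebra_simps)
      qed
    qed
  qed
qed

section \<open>Linear relations over a field with a derivation\<close>

definition derivation :: "('a::comm_ring_1 \<Rightarrow> 'a) \<Rightarrow> bool" where
  "derivation D \<longleftrightarrow> (\<forall>x y. D (x + y) = D x + D y \<and> D (x * y) = D x * y + x * D y)"

lemma derivationD:
  assumes "derivation D"
  shows "D (x + y) = D x + D y" "D (x * y) = D x * y + x * D y" "D 0 = 0" "D 1 = 0"
proof -
  show add: "D (x + y) = D x + D y" and mult: "D (x * y) = D x * y + x * D y" for x y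
    using assms by (auto simp: derivation_def)
  show "D 0 = 0" using add[of 0 0] by simp
  show "D 1 = 0" using mult[of 1 1] by simp
qed

lemma derivation_sum:
  assumes "derivation D"
  shows "D (sum f A) = (\<Sum>i\<in>A. D (f i))"
  by (induction A rule: infinite_finite_induct) (simp_all add: derivationD[OF assms])

lemma derivation_funpow_const_mult:
  assumes "derivation D" "D c = 0"
  shows "(D ^^ n) (c * x) = c * (D ^^ n) x"
  by (induction n) (simp_all add: derivationD[OF assms(1)] assms(2))

lemma derivation_funpow_sum:
  assumes "derivation D"
  shows "(D ^^ n) (sum f A) = (\<Sum>i\<in>A. (D ^^ n) (f i))"
  by (induction n) (simp_all add: derivation_sum[OF assms])

text \<open>
  A relation of minimal order is unique up to a factor, so the quotients of its coefficients are
  fixed by every automorphism that preserves the constant span of the functions \<open>F i\<close>.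
\<close>

lemma invariant_linear_relation:
  fixes D :: "'a::field \<Rightarrow> 'a" and F :: "'i \<Rightarrow> 'a"
  assumes D: "derivation D" and S: "subring_of S" and DS: "\<And>x. x \<in> S \<Longrightarrow> D x \<in> S"
    and I: "finite I" and FS: "\<And>i. i \<in> I \<Longrightarrow> F i \<in> S"
    and \<psi>S: "\<And>\<psi> x. \<psi> \<in> G \<Longrightarrow> x \<in> S \<Longrightarrow> \<psi> x \<in> S"
    and \<psi>: "\<And>\<psi> x y. \<psi> \<in> G \<Longrightarrow> \<psi> (x + y) = \<psi> x + \<psi> y"
      "\<And>\<psi> x y. \<psi> \<in> G \<Longrightarrow> \<psi> (x * y) = \<psi> x * \<psi> y"
      "\<And>\<psi> x. \<psi> \<in> G \<Longrightarrow> \<psi> x = 0 \<Longrightarrow> x = 0"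
      "\<And>\<psi> x. \<psi> \<in> G \<Longrightarrow> \<psi> (D x) = D (\<psi> x)"
    and span: "\<And>\<psi> i. \<psi> \<in> G \<Longrightarrow> i \<in> I \<Longrightarrow>
      \<exists>C. (\<forall>j\<in>I. D (C j) = 0) \<and> F i = (\<Sum>j\<in>I. C j * \<psi> (F j))"
  obtains m b where "m \<le> card I" "b m = 1"
    "\<And>i. i \<in> I \<Longrightarrow> (\<Sum>r\<le>m. b r * (D ^^ r) (F i)) = 0"
    "\<And>r. r \<le> m \<Longrightarrow> \<exists>p\<in>S. \<exists>q\<in>S. q \<noteq> 0 \<and> b r = p / q"
    "\<And>\<psi> r. \<psi> \<in> G \<Longrightarrow> r \<le> m \<Longrightarrow> \<psi> (b r) = b r"
proof -
  define R where "R m c \<longleftrightarrow> (\<forall>r\<le>m. c r \<in> S) \<and> c m \<noteq> 0 \<and>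
    (\<forall>i\<in>I. (\<Sum>r\<le>m. c r * (D ^^ r) (F i)) = 0)" for m :: nat and c :: "nat \<Rightarrow> 'a"
  have DF: "(D ^^ r) (F i) \<in> S" if "i \<in> I" for r i
    using that by (induction r) (auto intro: FS DS)
  have trunc: "\<exists>m'\<le>m. c m' \<noteq> 0 \<and> R m' c"
    if c: "\<forall>r\<le>m. c r \<in> S" "\<exists>r\<le>m. c r \<noteq> 0"
      "\<forall>i\<in>I. (\<Sum>r\<le>m. c r * (D ^^ r) (F i)) = 0" for m c
  proof -
    define m' where "m' = (GREATEST r. r \<le> m \<and> c r \<noteq> 0)"
    obtain r where r: "r \<le> m \<and> c r \<noteq> 0" using c(2) by auto
    have m': "m' \<le> m \<and> c m' \<noteq> 0"
      unfolding m'_def by (rule GreatestI_nat[where b = m]) (use r in auto)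
    have "c r = 0" if "m' < r" "r \<le> m" for r
    proof (rule ccontr)
      assume "c r \<noteq> 0"
      then have "r \<le> m'" unfolding m'_def using that by (intro Greatest_le_nat[where b = m]) auto
      then show False using that by simp
    qed
    then have "(\<Sum>r\<le>m. c r * (D ^^ r) (F i)) = (\<Sum>r\<le>m'. c r * (D ^^ r) (F i))" for i
      using m' by (intro sum.mono_neutral_right) auto
    then have "R m' c" using c m' by (auto simp: R_def)
    then show ?thesis using m' by blast
  qed
  \<comment> \<open>There is one equation for each function and one unknown for each order from 0 to
    \<open>card I\<close>, hence one unknown too many.\<close>
  have "card I < card {..card I}" by simp
  from homogeneous_system_solvable[OF S I _ this, of "\<lambda>i r. (D ^^ r) (F i)"] DF
  obtain c0 where "\<forall>r\<in>{..card I}. c0 r \<in> S" "\<exists>r\<in>{..card I}. c0 r \<noteq> 0"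
    "\<forall>i\<in>I. (\<Sum>r\<le>card I. (D ^^ r) (F i) * c0 r) = 0"
    by auto
  then obtain m0 where m0: "m0 \<le> card I" "\<exists>c. R m0 c"
    using trunc[of "card I" c0] by (auto simp: mult.commute)
  define m where "m = (LEAST m. \<exists>c. R m c)"
  obtain c where c: "R m c" using LeastI[of "\<lambda>m. \<exists>c. R m c" m0] m0 unfolding m_def by blast
  have least: "m \<le> m'" if "R m' c'" for m' c'
    unfolding m_def by (rule Least_le) (use that in blast)
  have cS: "\<And>r. r \<le> m \<Longrightarrow> c r \<in> S" and cm: "c m \<noteq> 0"
    and rel: "\<And>i. i \<in> I \<Longrightarrow> (\<Sum>r\<le>m. c r * (D ^^ r) (F i)) = 0"
    using c by (auto simp: R_def)
  have inv: "c m * \<psi> (c r) = \<psi> (c m) * c r" if p: "\<psi> \<in> G" and r: "r \<le> m" for \<psi> r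
  proof (rule ccontr)
    assume ne: "c m * \<psi> (c r) \<noteq> \<psi> (c m) * c r"
    \<comment> \<open>A combination of the relation and its image under \<psi> in which the
      coefficients of order m cancel. The cross-multiplied form keeps the coefficients in S.\<close>
    define e where "e r = c m * \<psi> (c r) - \<psi> (c m) * c r" for r
    have \<psi>0: "\<psi> 0 = 0" using \<psi>(1)[OF p, of 0 0] by (metis add_0 add_cancel_left_left)
    have \<psi>sum: "\<psi> (sum f A) = (\<Sum>i\<in>A. \<psi> (f i))" if "finite A" for f and A :: "nat set"
      using that by (induction A rule: finite_induct) (auto simp: \<psi>0 \<psi>(1)[OF p])
    have \<psi>D: "\<psi> ((D ^^ n) x) = (D ^^ n) (\<psi> x)" for n x
      by (induction n) (auto simp: \<psi>(4)[OF p])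
    \<comment> \<open>Applying \<psi> to the relation gives one for the functions
      \<open>\<psi> (F j)\<close>. It is linear over constants of D, so it passes to
      \<open>F i\<close>, a combination of these functions with such constants.\<close>
    have rel': "(\<Sum>r\<le>m. \<psi> (c r) * (D ^^ r) (F i)) = 0" if i: "i \<in> I" for i
    proof -
      obtain C where C: "\<forall>j\<in>I. D (C j) = 0" "F i = (\<Sum>j\<in>I. C j * \<psi> (F j))"
        using span[OF p i] by blast
      have 0: "(\<Sum>r\<le>m. \<psi> (c r) * (D ^^ r) (\<psi> (F j))) = 0" if "j \<in> I" for j
        using arg_cong[OF rel[OF that], of \<psi>] by (simp add: \<psi>sum \<psi>0 \<psi>(2)[OF p] \<psi>D)
      have "(\<Sum>r\<le>m. \<psi> (c r) * (D ^^ r) (F i)) =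
          (\<Sum>r\<le>m. \<psi> (c r) * (\<Sum>j\<in>I. C j * (D ^^ r) (\<psi> (F j))))"
        unfolding C(2) derivation_funpow_sum[OF D]
        using C(1) by (simp add: derivation_funpow_const_mult[OF D])
      also have "\<dots> = (\<Sum>j\<in>I. C j * (\<Sum>r\<le>m. \<psi> (c r) * (D ^^ r) (\<psi> (F j))))"
        by (simp add: sum_distrib_left mult_ac) (rule sum.swap)
      also have "\<dots> = 0" using 0 by simp
      finally show ?thesis .
    qed
    have "\<exists>m'\<le>m. e m' \<noteq> 0 \<and> R m' e"
    proof (rule trunc)
      show "\<forall>r\<le>m. e r \<in> S"
        unfolding e_def using cS \<psi>S[OF p] by (auto intro!: subring_ofD[OF S])
      show "\<exists>r\<le>m. e r \<noteq> 0" using ne r by (auto simp: e_def)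
      show "\<forall>i\<in>I. (\<Sum>r\<le>m. e r * (D ^^ r) (F i)) = 0"
      proof
        fix i assume i: "i \<in> I"
        have "(\<Sum>r\<le>m. e r * (D ^^ r) (F i)) =
           c m * (\<Sum>r\<le>m. \<psi> (c r) * (D ^^ r) (F i)) - \<psi> (c m) * (\<Sum>r\<le>m. c r * (D ^^ r) (F i))"
          by (simp add: e_def sum_distrib_left sum_subtractf algebra_simps)
        then show "(\<Sum>r\<le>m. e r * (D ^^ r) (F i)) = 0" using rel[OF i] rel'[OF i] by simp
      qed
    qed
    then obtain m' where m': "m' \<le> m" "e m' \<noteq> 0" "R m' e" by blast
    have "e m = 0" by (simp add: e_def)
    then show False using least[OF m'(3)] m' by auto
  qed
  show thesis
  proof (rule that[of m "\<lambda>r. c r / c m"])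
    show "m \<le> card I" using m0 least by force
    show "c m / c m = 1" using cm by simp
    show "(\<Sum>r\<le>m. c r / c m * (D ^^ r) (F i)) = 0" if "i \<in> I" for i
    proof -
      have "(\<Sum>r\<le>m. c r / c m * (D ^^ r) (F i)) = (\<Sum>r\<le>m. c r * (D ^^ r) (F i)) / c m"
        by (simp add: sum_divide_distrib)
      then show ?thesis using rel[OF that] by simp
    qed
    show "\<exists>p\<in>S. \<exists>q\<in>S. q \<noteq> 0 \<and> c r / c m = p / q" if "r \<le> m" for r
      using cS[OF that] cS[of m] cm by blast
    show "\<psi> (c r / c m) = c r / c m" if p: "\<psi> \<in> G" and "r \<le> m" for \<psi> r
    proof -
      have nz: "\<psi> (c m) \<noteq> 0" using \<psi>(3)[OF p] cm by blast
      have "\<psi> (c r / c m) * \<psi> (c m) = \<psi> (c r)"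
        using cm by (simp flip: \<psi>(2)[OF p])
      then have "\<psi> (c r / c m) = \<psi> (c r) / \<psi> (c m)" using nz by (simp add: field_simps)
      also have "\<dots> = c r / c m" using inv[OF p that(2)] nz cm by (simp add: field_simps)
      finally show ?thesis .
    qed
  qed
qed

text \<open>Differentiating a monic relation gives a monic relation of the next order, because
  \<open>D 1 = 0\<close> removes the only other contribution that could affect the leading term.
  This fills the gap between the minimal order and the prescribed one.\<close>

lemma linear_relation_raise_order:
  fixes D :: "'a::field \<Rightarrow> 'a"
  assumes D: "derivation D" and S: "subring_of S" and DS: "\<And>x. x \<in> S \<Longrightarrow> D x \<in> S"
    and "b m = 1" "\<forall>r\<le>m. b r \<in> S" "(\<Sum>r\<le>m. b r * (D ^^ r) x) = 0" and "m \<le> n"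
  shows "\<exists>b. b n = 1 \<and> (\<forall>r\<le>n. b r \<in> S) \<and> (\<Sum>r\<le>n. b r * (D ^^ r) x) = 0"
  using assms(7)
proof (induction rule: dec_induct)
  case base
  show ?case using assms by blast
next
  case (step n)
  then obtain b where b: "b n = 1" "\<forall>r\<le>n. b r \<in> S" "(\<Sum>r\<le>n. b r * (D ^^ r) x) = 0" by blast
  define b' where "b' r = (if r \<le> n then D (b r) else 0) + (if r = 0 then 0 else b (r - 1))" for r
  have "0 = D (\<Sum>r\<le>n. b r * (D ^^ r) x)" using b by (simp add: derivationD[OF D])
  also have "\<dots> = (\<Sum>r\<le>n. D (b r) * (D ^^ r) x) + (\<Sum>r\<le>n. b r * (D ^^ Suc r) x)"
    by (simp add: derivation_sum[OF D] derivationD[OF D] sum.distrib)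
  also have "(\<Sum>r\<le>n. D (b r) * (D ^^ r) x) =
      (\<Sum>r\<le>Suc n. (if r \<le> n then D (b r) else 0) * (D ^^ r) x)"
    by simp
  also have "(\<Sum>r\<le>n. b r * (D ^^ Suc r) x) =
      (\<Sum>r\<le>Suc n. (if r = 0 then 0 else b (r - 1)) * (D ^^ r) x)"
    by (subst sum.atMost_Suc_shift) simp
  also have "(\<Sum>r\<le>Suc n. (if r \<le> n then D (b r) else 0) * (D ^^ r) x) + \<dots> =
      (\<Sum>r\<le>Suc n. b' r * (D ^^ r) x)"
    unfolding b'_def sum.distrib[symmetric] distrib_right ..
  finally have "(\<Sum>r\<le>Suc n. b' r * (D ^^ r) x) = 0" by simp
  moreover have "b' (Suc n) = 1" using b by (simp add: b'_def)
  moreover have "b' r \<in> S" if "r \<le> Suc n" for r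
    unfolding b'_def using b that by (auto intro!: subring_ofD[OF S] DS)
  ultimately show ?case by blast
qed

section \<open>Expansions at infinity\<close>

definition translation :: "real \<Rightarrow> real^2^2" where
  "translation h = vector [vector [1, h], vector [0, 1]]"

lemma translation_nth [simp]:
  "translation h $ 1 $ 1 = 1" "translation h $ 1 $ 2 = h"
  "translation h $ 2 $ 1 = 0" "translation h $ 2 $ 2 = 1"
  by (simp_all add: translation_def)

lemma det_translation [simp]: "det (translation h) = 1"
  by (simp add: det_2)

lemma moebius_act_translation [simp]: "moebius_act (translation h) z = z + of_real h"
  by (simp add: moebius_act_def autfac_def)

lemma mcomp_translation_mid: "mcomp (translation h) mid = mid + mconst (of_real h)"
  unfolding mid_eq_mero_of mconst_eq_mero_of
  by (simp add: mero_of_ops[OF meromorphic_on_id meromorphic_on_const[of "of_real h"]]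
      mero_of_ops[OF meromorphic_on_id meromorphic_on_id])

definition qexp :: "real \<Rightarrow> complex \<Rightarrow> complex" where
  "qexp h z = exp (2 * of_real pi * \<i> * z / of_real h)"

lemma qexp_nonzero [simp]: "qexp h z \<noteq> 0"
  by (simp add: qexp_def)

lemma norm_qexp: "norm (qexp h z) = exp (- 2 * pi * Im z / h)"
  by (simp add: qexp_def norm_exp_eq_Re Re_divide_of_real)

lemma qexp_analytic [analytic_intros]: "qexp h analytic_on A"
  unfolding qexp_def[abs_def] by (cases "h = 0") (auto intro!: analytic_intros)

lemma deriv_qexp: "deriv (qexp h) z = (2 * of_real pi * \<i> / of_real h) * qexp h z"
  unfolding qexp_def[abs_def]
  by (intro DERIV_imp_deriv) (cases "h = 0"; auto intro!: derivative_eq_intros)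

lemma eventually_qexp:
  assumes "h > 0" "\<forall>\<^sub>F q in at 0. P q"
  obtains M where "M \<ge> 0" "\<And>z. Im z > M \<Longrightarrow> P (qexp h z)"
proof -
  obtain d where d: "d > 0" "\<And>q. q \<noteq> 0 \<Longrightarrow> norm q < d \<Longrightarrow> P q"
    using assms(2) by (auto simp: eventually_at)
  show thesis
  \<comment> \<open>The norm of \<open>qexp h z\<close> is exp (-2 pi Im z / h), which falls below d
    beyond this height; the maximum with 0 keeps the half-plane inside \<H>.\<close>
  proof (rule that[of "max 0 (- h * ln d / (2 * pi))"])
    fix z assume "Im z > max 0 (- h * ln d / (2 * pi))"
    then have "- 2 * pi * Im z / h < ln d"
      using assms(1) by (simp add: field_simps)
    then have "norm (qexp h z) < d"
      unfolding norm_qexp using d(1) by (metis exp_less_cancel_iff exp_ln)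
    then show "P (qexp h z)" by (intro d) auto
  qed simp
qed

text \<open>The field of q-expansions of period h. The expansion is required near each point rather
  than at it, since F may have arbitrary values on a discrete set.\<close>

definition Per :: "real \<Rightarrow> mero set" where
  "Per h = {a. mcomp (translation h) a = a \<and>
     (\<exists>F M. F meromorphic_on {0} \<and>
       (\<forall>z\<in>\<H>. Im z > M \<longrightarrow> (\<forall>\<^sub>F w in at z. mval a w = F (qexp h w))))}"

lemma PerI:
  assumes "mcomp (translation h) a = a" "F meromorphic_on {0}"
    "\<And>z. z \<in> \<H> \<Longrightarrow> Im z > M \<Longrightarrow> \<forall>\<^sub>F w in at z. mval a w = F (qexp h w)"
  shows "a \<in> Per h"
  using assms unfolding Per_def by blast

text \<open>A function meromorphic at 0 is analytic on a punctured disc. Above a large enough height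
  the expansion is therefore analytic and valid at every point.\<close>

lemma PerE:
  assumes "a \<in> Per h" "h > 0"
  obtains F M where "F meromorphic_on {0}" "M \<ge> 0"
    "\<And>z. Im z > M \<Longrightarrow> F analytic_on {qexp h z}"
    "\<And>z. Im z > M \<Longrightarrow> mval a analytic_on {z}"
    "\<And>z. Im z > M \<Longrightarrow> mval a z = F (qexp h z)"
    "\<And>z. Im z > M \<Longrightarrow> \<forall>\<^sub>F w in at z. mval a w = F (qexp h w)"
proof -
  obtain F M where F: "F meromorphic_on {0}"
    "\<And>z. z \<in> \<H> \<Longrightarrow> Im z > M \<Longrightarrow> \<forall>\<^sub>F w in at z. mval a w = F (qexp h w)"
    using assms unfolding Per_def by blast
  have "\<forall>\<^sub>F q in at 0. F analytic_on {q}"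
    using F(1) by (rule meromorphic_on_eventually_analytic) simp
  then obtain N where N: "N \<ge> 0" "\<And>z. Im z > N \<Longrightarrow> F analytic_on {qexp h z}"
    using eventually_qexp[OF assms(2)] by blast
  have ev: "\<forall>\<^sub>F w in at z. mval a w = F (qexp h w)" if "Im z > max M N" for z
    using that N F(2) by (auto simp: upper_half_plane_def)
  have "(\<lambda>w. F (qexp h w)) analytic_on {z}" if "Im z > max M N" for z
    using analytic_on_compose_gen[OF qexp_analytic[of h "{z}"], of F "{qexp h z}"] N(2)[of z] that
    by (simp add: o_def)
  then have "mval a analytic_on {z}" "mval a z = F (qexp h z)" if "Im z > max M N" for z
    using mval_at_analytic[of z "\<lambda>w. F (qexp h w)" a] ev that N(1) by (auto simp: upper_half_plane_def)
  then show thesis using that[of F "max M N"] F N ev by auto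
qed

lemma Per_binop:
  assumes "a \<in> Per h" "b \<in> Per h" "mcomp (translation h) c = c"
    and "\<And>z. z \<in> \<H> \<Longrightarrow> \<forall>\<^sub>F w in at z. mval c w = f (mval a w) (mval b w)"
    and "\<And>F G. F meromorphic_on {0} \<Longrightarrow> G meromorphic_on {0} \<Longrightarrow> (\<lambda>q. f (F q) (G q)) meromorphic_on {0}"
  shows "c \<in> Per h"
proof -
  obtain F M where F: "F meromorphic_on {0}"
    "\<And>z. z \<in> \<H> \<Longrightarrow> Im z > M \<Longrightarrow> \<forall>\<^sub>F w in at z. mval a w = F (qexp h w)"
    using assms(1) unfolding Per_def by blast
  obtain G N where G: "G meromorphic_on {0}"
    "\<And>z. z \<in> \<H> \<Longrightarrow> Im z > N \<Longrightarrow> \<forall>\<^sub>F w in at z. mval b w = G (qexp h w)"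
    using assms(2) unfolding Per_def by blast
  show ?thesis
  proof (rule PerI[OF assms(3) assms(5)[OF F(1) G(1)]])
    fix z assume z: "z \<in> \<H>" "Im z > max M N"
    have "\<forall>\<^sub>F w in at z. mval a w = F (qexp h w)" "\<forall>\<^sub>F w in at z. mval b w = G (qexp h w)"
      using F(2) G(2) z by auto
    then show "\<forall>\<^sub>F w in at z. mval c w = f (F (qexp h w)) (G (qexp h w))"
      using assms(4)[OF z(1)] by eventually_elim simp
  qed
qed

lemma Per_invariant: "a \<in> Per h \<Longrightarrow> mcomp (translation h) a = a"
  by (simp add: Per_def)

lemma mconst_in_Per: "mconst c \<in> Per h"
proof (rule PerI)
  show "(\<lambda>_. c) meromorphic_on {0}" by auto
  show "\<forall>\<^sub>F w in at z. mval (mconst c) w = c" if "z \<in> \<H>" for z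
    using eventually_in_upper_half_plane[OF that] by eventually_elim (rule mval_mconst)
qed simp

lemma Per_diff: "a \<in> Per h \<Longrightarrow> b \<in> Per h \<Longrightarrow> a - b \<in> Per h"
  by (rule Per_binop[where a = a and b = b and f = "(-)"])
    (auto simp: Per_invariant intro!: eventually_mval_ops meromorphic_intros)

lemma Per_mult: "a \<in> Per h \<Longrightarrow> b \<in> Per h \<Longrightarrow> a * b \<in> Per h"
  by (rule Per_binop[where a = a and b = b and f = "(*)"])
    (auto simp: Per_invariant intro!: eventually_mval_ops meromorphic_intros)

lemma Per_divide: "a \<in> Per h \<Longrightarrow> b \<in> Per h \<Longrightarrow> a / b \<in> Per h"
  by (rule Per_binop[where a = a and b = b and f = "(/)"])
    (auto simp: Per_invariant intro!: eventually_mval_ops meromorphic_intros)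

lemma subring_of_Per: "subring_of (Per h)"
  using mconst_in_Per[of 1 h] Per_diff Per_mult by (auto simp: subring_of_def)

lemma mderiv_translation: "mderiv (mcomp (translation h) a) = mcomp (translation h) (mderiv a)"
  using mderiv_mcomp[OF det_translation, of h a] by (simp add: mcomp_translation_mid)

lemma Per_mderiv:
  assumes "a \<in> Per h" "h > 0"
  shows "mderiv a \<in> Per h"
proof -
  obtain F M where F: "F meromorphic_on {0}" "M \<ge> 0"
    "\<And>z. Im z > M \<Longrightarrow> F analytic_on {qexp h z}"
    "\<And>z. Im z > M \<Longrightarrow> \<forall>\<^sub>F w in at z. mval a w = F (qexp h w)"
    using PerE[OF assms] by metis
  define c where "c = 2 * of_real pi * \<i> / of_real h"
  show ?thesis
  proof (rule PerI)
    show "mcomp (translation h) (mderiv a) = mderiv a"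
      using Per_invariant[OF assms(1)] by (metis mderiv_translation)
    \<comment> \<open>In the variable q, differentiation by z is c q d/dq, which preserves
      meromorphy at 0.\<close>
    show "(\<lambda>q. deriv F q * (c * q)) meromorphic_on {0}"
      using F(1) by (intro meromorphic_intros)
    fix z assume z: "z \<in> \<H>" "Im z > M"
    have "open {z. Im z > M}" by (rule open_halfspace_Im_gt)
    then have "\<forall>\<^sub>F w in at z. w \<in> {z. Im z > M}"
      using z(2) by (intro eventually_at_in_open') auto
    then show "\<forall>\<^sub>F w in at z. mval (mderiv a) w = deriv F (qexp h w) * (c * qexp h w)"
      using eventually_mval_ops(5)[OF z(1), of a] eventually_deriv_eq[OF F(4)[OF z(2)]]
    proof eventually_elim
      case (elim w)
      have "qexp h field_differentiable at w"
        using analytic_on_imp_differentiable_at qexp_analytic by blast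
      moreover have "F field_differentiable at (qexp h w)"
        using F(3) elim(1) analytic_on_imp_differentiable_at by blast
      ultimately have "deriv (\<lambda>w. F (qexp h w)) w = deriv F (qexp h w) * deriv (qexp h) w"
        using deriv_chain[of "qexp h" w F] by (simp add: o_def)
      with elim show ?case by (simp add: deriv_qexp c_def)
    qed
  qed
qed

text \<open>The ring of polynomials in z over the q-expansions. Inductive generation makes closure
  immediate; the normal form follows in \<open>Pol_altdef\<close>.\<close>

inductive_set Pol :: "real \<Rightarrow> mero set" for h where
  Per: "a \<in> Per h \<Longrightarrow> a \<in> Pol h"
| mid: "mid \<in> Pol h"
| add: "a \<in> Pol h \<Longrightarrow> b \<in> Pol h \<Longrightarrow> a + b \<in> Pol h"
| mult: "a \<in> Pol h \<Longrightarrow> b \<in> Pol h \<Longrightarrow> a * b \<in> Pol h"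

lemma mconst_in_Pol: "mconst c \<in> Pol h"
  by (intro Pol.Per mconst_in_Per)

lemma subring_of_Pol: "subring_of (Pol h)"
proof -
  have "a - b \<in> Pol h" if "a \<in> Pol h" "b \<in> Pol h" for a b
  proof -
    have "a + mconst (- 1) * b \<in> Pol h" using that by (intro Pol.add Pol.mult mconst_in_Pol)
    then show ?thesis by (simp only: mconst_simps) simp
  qed
  then show ?thesis using mconst_in_Pol[of 1 h] by (auto simp: subring_of_def intro: Pol.mult)
qed

lemma Pol_mderiv:
  assumes "a \<in> Pol h" "h > 0"
  shows "mderiv a \<in> Pol h"
  using assms(1)
proof induction
  case mid
  then show ?case using subring_ofD(2)[OF subring_of_Pol] by simp
qed (auto intro: Pol.intros Per_mderiv assms(2))

lemma Pol_altdef: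
  assumes "a \<in> Pol h"
  shows "\<exists>p. (\<forall>i. coeff p i \<in> Per h) \<and> a = poly p mid"
  using assms
proof induction
  case (Per a)
  have "coeff [:a:] i \<in> Per h" for i
    using Per subring_ofD(1)[OF subring_of_Per] by (simp add: coeff_pCons split: nat.splits)
  then show ?case by (intro exI[of _ "[:a:]"]) simp
next
  case mid
  have "coeff [:0, 1:] i \<in> Per h" for i
    using subring_ofD(1,2)[OF subring_of_Per] by (simp add: coeff_pCons split: nat.splits)
  then show ?case by (intro exI[of _ "[:0, 1:]"]) simp
next
  case (add a b)
  then obtain p q where "\<forall>i. coeff p i \<in> Per h" "a = poly p mid" "\<forall>i. coeff q i \<in> Per h" "b = poly q mid"
    by blast
  then show ?case
    by (intro exI[of _ "p + q"]) (auto intro: subring_ofD[OF subring_of_Per])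
next
  case (mult a b)
  then obtain p q where "\<forall>i. coeff p i \<in> Per h" "a = poly p mid" "\<forall>i. coeff q i \<in> Per h" "b = poly q mid"
    by blast
  then show ?case
    by (intro exI[of _ "p * q"])
      (auto simp: coeff_mult intro!: subring_of_sum[OF subring_of_Per] Per_mult)
qed

text \<open>A polynomial in \<open>z\<close> with invariant coefficients that vanishes has the roots \<open>z + n h\<close>.\<close>

lemma mid_transcendental:
  assumes h: "h > 0" and inv: "\<And>i. mcomp (translation h) (coeff r i) = coeff r i"
    and r: "poly r mid = 0"
  shows "r = 0"
proof (rule ccontr)
  assume "r \<noteq> 0"
  have comp: "mcomp (translation h) (poly r x) = poly r (mcomp (translation h) x)" for x
    by (simp add: poly_altdef inv)
  have "poly r (mid + mconst (of_real (real n * h))) = 0" for n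
  proof (induction n)
    case (Suc n)
    have "mcomp (translation h) (mid + mconst (of_real (real n * h))) =
        mid + mconst (of_real (real (Suc n) * h))"
      by (simp add: mcomp_translation_mid algebra_simps del: mconst_simps of_nat_Suc flip: mconst_simps(3))
        (simp add: algebra_simps)
    then show ?case using comp[of "mid + mconst (of_real (real n * h))"] Suc by simp
  qed (use r in simp)
  then have "range (\<lambda>n. mid + mconst (of_real (real n * h))) \<subseteq> {x. poly r x = 0}" by auto
  moreover have "finite {x. poly r x = 0}" by (rule poly_roots_finite[OF \<open>r \<noteq> 0\<close>])
  ultimately have "finite (range (\<lambda>n. mid + mconst (of_real (real n * h))))"
    by (rule finite_subset)
  moreover have "inj (\<lambda>n. mid + mconst (of_real (real n * h)))"
    using h by (auto simp: inj_on_def simp del: of_real_mult)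
  ultimately show False using finite_imageD infinite_UNIV_nat by blast
qed

text \<open>Only periodicity of b is assumed, with no control at infinity. Since P - b Q vanishes
  and is a polynomial in z with periodic coefficients, the transcendence of z lets coefficients be
  compared. The leading one exhibits b as a quotient of two q-expansions.\<close>

lemma Per_quotient:
  assumes h: "h > 0" and b: "mcomp (translation h) b = b" "b = P / Q"
    and P: "P \<in> Pol h" and Q: "Q \<in> Pol h" "Q \<noteq> 0"
  shows "b \<in> Per h"
proof -
  obtain p where p: "\<And>i. coeff p i \<in> Per h" "P = poly p mid" using Pol_altdef[OF P] by blast
  obtain q where q: "\<And>i. coeff q i \<in> Per h" "Q = poly q mid" using Pol_altdef[OF Q(1)] by blast
  have "p - smult b q = 0"
  proof (rule mid_transcendental[OF h])
    show "mcomp (translation h) (coeff (p - smult b q) i) = coeff (p - smult b q) i" for i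
      using b(1) p(1) q(1) by (simp add: Per_invariant)
    show "poly (p - smult b q) mid = 0" using b(2) p(2) q(2) Q(2) by simp
  qed
  then have c: "coeff p i = b * coeff q i" for i
    by (metis coeff_smult right_minus_eq)
  have "q \<noteq> 0" using Q(2) q(2) by auto
  then have "b = coeff p (degree q) / coeff q (degree q)" using c[of "degree q"] by simp
  then show ?thesis using Per_divide[OF p(1) q(1)] by metis
qed

section \<open>Growth of periodic functions\<close>

lemma periodic_add_int_mult:
  fixes u :: "complex \<Rightarrow> 'b"
  assumes "\<And>z. Im z > M \<Longrightarrow> u (z + of_real h) = u z" "Im z > M"
  shows "u (z + of_int n * of_real h) = u z"
proof -
  have nat: "u (z + of_nat n * of_real h) = u z" if "Im z > M" for n z
  proof (induction n)
    case (Suc n)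
    have "u ((z + of_nat n * of_real h) + of_real h) = u (z + of_nat n * of_real h)"
      using that by (intro assms(1)) simp
    then show ?case using Suc by (simp add: algebra_simps)
  qed simp
  show ?thesis
  proof (cases "n \<ge> 0")
    case True
    then show ?thesis using nat[OF assms(2), of "nat n"] by simp
  next
    case False
    define w where "w = z + of_int n * of_real h"
    have "Im w > M" using assms(2) by (simp add: w_def)
    then have "u (w + of_nat (nat (- n)) * of_real h) = u w" by (rule nat)
    then show ?thesis using False by (simp add: w_def algebra_simps)
  qed
qed

lemma qexp_add: "qexp h (z + w) = qexp h z * qexp h w"
  by (simp add: qexp_def exp_add add_divide_distrib algebra_simps)

lemma qexp_log:
  assumes "h > 0" "q \<noteq> 0"
  shows "qexp h (of_real h / (2 * of_real pi * \<i>) * Ln q) = q"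
  using assms by (simp add: qexp_def)

lemma qexp_eq_iff:
  assumes "h > 0"
  shows "qexp h z = qexp h w \<longleftrightarrow> (\<exists>n::int. z = w + of_int n * of_real h)"
proof -
  have "qexp h z = qexp h w \<longleftrightarrow> (\<exists>n::int. 2 * of_real pi * \<i> * z / of_real h =
      2 * of_real pi * \<i> * w / of_real h + complex_of_real (2 * of_int n * pi) * \<i>)"
    by (simp add: qexp_def exp_eq mult.commute)
  also have "\<dots> \<longleftrightarrow> (\<exists>n::int. z = w + of_int n * of_real h)"
  proof (intro ex_cong1)
    fix n :: int
    define c where "c = 2 * of_real pi * \<i> / of_real h"
    have "c \<noteq> 0" using assms by (simp add: c_def)
    have "2 * of_real pi * \<i> * w / of_real h + complex_of_real (2 * of_int n * pi) * \<i> =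
        c * (w + of_int n * of_real h)"
      using assms by (simp add: c_def field_simps)
    moreover have "2 * of_real pi * \<i> * z / of_real h = c * z" by (simp add: c_def)
    ultimately show "2 * of_real pi * \<i> * z / of_real h =
        2 * of_real pi * \<i> * w / of_real h + complex_of_real (2 * of_int n * pi) * \<i> \<longleftrightarrow>
        z = w + of_int n * of_real h"
      using \<open>c \<noteq> 0\<close> by simp
  qed
  finally show ?thesis .
qed

text \<open>Exponential growth in Im z is polynomial growth in 1/|q|, so a power of q makes the
  function bounded near q = 0 and the singularity removable. Periodicity allows the bound to be
  checked on a strip only.\<close>

lemma periodic_growth_meromorphic:
  assumes h: "h > 0" and M: "M \<ge> 0" and hol: "u holomorphic_on {z. Im z > M}"
    and per: "\<And>z. Im z > M \<Longrightarrow> u (z + of_real h) = u z"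
    and bd: "\<And>z. Im z > M \<Longrightarrow> \<bar>Re z\<bar> \<le> h \<Longrightarrow> norm (u z) \<le> C * exp (B * Im z)"
  obtains F where "F meromorphic_on {0}" "\<And>z. Im z > M \<Longrightarrow> u z = F (qexp h z)"
proof -
  define l where "l q = of_real h / (2 * of_real pi * \<i>) * Ln q" for q
  define F where "F q = u (l q)" for q
  define r where "r = exp (- 2 * pi * M / h)"
  have ql: "qexp h (l q) = q" if "q \<noteq> 0" for q
    unfolding l_def using qexp_log[OF h that] .
  have Im_gt: "Im z > M \<longleftrightarrow> norm (qexp h z) < r" for z
    using h by (simp add: norm_qexp r_def field_simps)
  \<comment> \<open>The logarithm may return another preimage of q; it differs from z by an integer
    multiple of h, which u does not notice.\<close>
  have uF: "u z = F (qexp h z)" if "Im z > M" for z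
  proof -
    have "qexp h z = qexp h (l (qexp h z))" by (simp add: ql)
    then obtain n :: int where "l (qexp h z) = z + of_int n * of_real h"
      using qexp_eq_iff[OF h] by metis
    then show ?thesis using periodic_add_int_mult[of M u, OF per that] by (simp add: F_def)
  qed
  have an: "F analytic_on {q}" if q: "q \<noteq> 0" "norm q < r" for q
  proof -
    \<comment> \<open>A local logarithm that is analytic near q even on the branch cut, since
      \<open>x / q\<close> stays near 1. Periodicity shows that F is u composed with this branch as
      well.\<close>
    define v where "v x = l q + of_real h / (2 * of_real pi * \<i>) * Ln (x / q)" for x
    have v: "v analytic_on {q}"
      unfolding v_def using q by (auto intro!: analytic_intros simp: complex_nonpos_Reals_iff)
    have vq: "v q = l q" using q by (simp add: v_def)
    have qv: "qexp h (v x) = x" if "x \<noteq> 0" for x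
      unfolding v_def qexp_add ql[OF q(1)] using qexp_log[OF h, of "x / q"] q that by simp
    have "Im (v q) > M" unfolding Im_gt vq ql[OF q(1)] by (rule q(2))
    then have "u analytic_on {v q}"
      using hol open_halfspace_Im_gt[of M] analytic_at by blast
    then have "(\<lambda>x. u (v x)) analytic_on {q}"
      using analytic_on_compose_gen[OF v, of u "{v q}"] by (simp add: o_def)
    moreover have "\<forall>\<^sub>F x in nhds q. x \<in> ball 0 r - {0}"
      using q by (intro eventually_nhds_in_open) auto
    then have "\<forall>\<^sub>F x in nhds q. F x = u (v x)"
    proof eventually_elim
      case (elim x)
      then have "Im (v x) > M" unfolding Im_gt by (simp add: qv)
      then show ?case using uF[of "v x"] elim by (simp add: qv)
    qed
    ultimately show ?thesis using analytic_at_cong[of F "\<lambda>x. u (v x)" q q] by simp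
  qed
  \<comment> \<open>Since |q|^N = exp (-2 pi N Im z / h), this exponent outweighs the growth exp (B
    Im z).\<close>
  define N where "N = nat \<lceil>B * h / (2 * pi)\<rceil>"
  have N: "B \<le> real N * 2 * pi / h"
  proof -
    have "B * h / (2 * pi) \<le> real N" unfolding N_def by linarith
    then show ?thesis using h by (simp add: field_simps)
  qed
  have bdF: "norm (q ^ N * F q) \<le> \<bar>C\<bar>" if q: "q \<noteq> 0" "norm q < r" for q
  proof -
    have Im: "Im (l q) > M" unfolding Im_gt ql[OF q(1)] by (rule q(2))
    \<comment> \<open>The principal logarithm has imaginary part at most pi in absolute value, so
      \<open>l q\<close> has real part at most h/2 in absolute value and lies in the strip where the
      bound is assumed.\<close>
    have "Re (l q) = h * Im (Ln q) / (2 * pi)"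
    proof -
      have "of_real h / (2 * of_real pi * \<i>) = - \<i> * of_real (h / (2 * pi))"
        by (simp add: field_simps)
      then show ?thesis by (simp add: l_def)
    qed
    moreover have "\<bar>Im (Ln q)\<bar> \<le> pi" using q(1) mpi_less_Im_Ln Im_Ln_le_pi by (smt (verit))
    ultimately have "\<bar>Re (l q)\<bar> = h * \<bar>Im (Ln q)\<bar> / (2 * pi)" "h * \<bar>Im (Ln q)\<bar> \<le> h * pi"
      using h by (simp_all add: abs_mult mult_left_mono)
    then have "\<bar>Re (l q)\<bar> \<le> h * pi / (2 * pi)" by (simp only: divide_right_mono pi_ge_zero mult_nonneg_nonneg zero_le_numeral)
    also have "\<dots> \<le> h" using h by simp
    finally have "\<bar>Re (l q)\<bar> \<le> h" .
    then have "norm (F q) \<le> C * exp (B * Im (l q))" unfolding F_def using bd Im by blast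
    moreover define E where "E = real N * 2 * pi / h * Im (l q)"
    have "B * Im (l q) \<le> E"
      unfolding E_def using Im M by (intro mult_right_mono N) auto
    then have "C * exp (B * Im (l q)) \<le> \<bar>C\<bar> * exp E"
      by (intro mult_mono) (simp_all only: exp_le_cancel_iff abs_ge_self abs_ge_zero exp_ge_zero)
    ultimately have F: "norm (F q) \<le> \<bar>C\<bar> * exp E" by linarith
    have "norm (q ^ N) = norm (qexp h (l q)) ^ N" unfolding ql[OF q(1)] by (rule norm_power)
    also have "\<dots> = exp (- E)"
      unfolding norm_qexp E_def by (simp flip: exp_of_nat_mult)
    finally have "norm (q ^ N * F q) = exp (- E) * norm (F q)" by (simp add: norm_mult)
    also have "\<dots> \<le> exp (- E) * (\<bar>C\<bar> * exp E)" using F by (intro mult_left_mono) auto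
    also have "\<dots> = \<bar>C\<bar>" by (simp add: exp_minus)
    finally show ?thesis .
  qed
  have r0: "r > 0" by (simp add: r_def)
  have "F holomorphic_on ball 0 r - {0}"
    using an by (intro analytic_imp_holomorphic) (auto simp: analytic_on_analytic_at[of _ "ball 0 r - {0}"])
  then have "(\<lambda>q. q ^ N * F q) holomorphic_on ball 0 r - {0}" by (intro holomorphic_intros)
  moreover have "\<forall>\<^sub>F q in at 0. q \<in> ball 0 r - {0}"
    using r0 by (intro eventually_at_in_open) auto
  then have "\<forall>\<^sub>F q in at 0. norm (q ^ N * F q) \<le> \<bar>C\<bar>"
    by eventually_elim (use bdF in auto)
  ultimately have "\<exists>g. g holomorphic_on ball 0 r \<and> (\<forall>q\<in>ball 0 r - {0}. g q = q ^ N * F q)"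
    using holomorphic_on_extend_bounded[of "\<lambda>q. q ^ N * F q" "ball 0 r" 0] r0
    by (auto simp: interior_open)
  then obtain g where g: "g holomorphic_on ball 0 r" "\<And>q. q \<in> ball 0 r - {0} \<Longrightarrow> g q = q ^ N * F q"
    by blast
  have "g meromorphic_on {0}"
    using g(1) r0 by (intro analytic_on_imp_meromorphic_on) (auto simp: analytic_at intro!: exI[of _ "ball 0 r"])
  then have "(\<lambda>q. g q / q ^ N) meromorphic_on {0}" by (intro meromorphic_intros)
  moreover have "\<forall>\<^sub>F q in at 0. F q = g q / q ^ N"
  proof -
    have "\<forall>\<^sub>F q in at 0. q \<in> ball 0 r - {0}"
      using r0 by (intro eventually_at_in_open) auto
    then show ?thesis by eventually_elim (use g(2) in \<open>auto simp: field_simps\<close>)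
  qed
  ultimately have "F meromorphic_on {0}"
    by (subst meromorphic_on_cong[where g = "\<lambda>q. g q / q ^ N"]) auto
  then show thesis using that uF by blast
qed

text \<open>For functions whose expansion with respect to h is not given in advance: invariance and
  a bound on one strip produce it.\<close>

lemma PerI_growth:
  assumes h: "h > 0" and inv: "mcomp (translation h) a = a" and M: "M \<ge> 0"
    and hol: "mval a holomorphic_on {z. Im z > M}"
    and bd: "\<And>z. Im z > M \<Longrightarrow> \<bar>Re z\<bar> \<le> h \<Longrightarrow> norm (mval a z) \<le> C * exp (B * Im z)"
  shows "a \<in> Per h"
proof -
  have an: "mval a analytic_on {z}" if "Im z > M" for z
    using hol open_halfspace_Im_gt[of M] that analytic_at by blast
  have "mval a (z + of_real h) = mval a z" if z: "Im z > M" for z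
  proof -
    have zH: "z \<in> \<H>" using M z by (simp add: upper_half_plane_def)
    have "mval a analytic_on {z + of_real h}" using z by (intro an) simp
    then have "(\<lambda>w. mval a (w + of_real h)) analytic_on {z}"
      using analytic_on_compose_gen[of "\<lambda>w. w + of_real h" "{z}" "mval a" "{z + of_real h}"]
      by (simp add: o_def analytic_intros)
    moreover have "\<forall>\<^sub>F w in at z. mval a w = mval a (w + of_real h)"
      using eventually_mval_ops(6)[OF zH det_translation, of h a] inv by simp
    ultimately show ?thesis using mval_at_analytic(2)[OF zH] by metis
  qed
  from periodic_growth_meromorphic[OF h M hol this bd] obtain F
    where F: "F meromorphic_on {0}" "\<And>z. Im z > M \<Longrightarrow> mval a z = F (qexp h z)" by blast
  show ?thesis
  proof (rule PerI[OF inv F(1)])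
    fix z assume z: "z \<in> \<H>" "Im z > M"
    have "\<forall>\<^sub>F w in at z. w \<in> {z. Im z > M}"
      using z(2) open_halfspace_Im_gt by (intro eventually_at_in_open') auto
    then show "\<forall>\<^sub>F w in at z. mval a w = F (qexp h w)"
      by eventually_elim (use F(2) in auto)
  qed
qed

lemma mero_of_cong:
  assumes "u meromorphic_on \<H>" "\<And>z. z \<in> \<H> \<Longrightarrow> u z = v z"
  shows "mero_of u = mero_of v"
proof -
  have ev: "\<forall>\<^sub>F w in at z. u w = v w" if "z \<in> \<H>" for z
    using eventually_in_upper_half_plane[OF that] by eventually_elim (rule assms)
  then have "v meromorphic_on \<H>"
    using assms(1) meromorphic_on_cong[OF _ refl] by blast
  then show ?thesis using ev assms(1) by transfer auto
qed

lemma holomorphic_imp_mero: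
  assumes "u holomorphic_on \<H>"
  shows "u meromorphic_on \<H>" "u nicely_meromorphic_on \<H>"
  using assms open_upper_half_plane
  by (auto simp: analytic_on_open intro: analytic_on_imp_meromorphic_on analytic_on_imp_nicely_meromorphic_on)

lemma mero_of_in_PerI:
  assumes h: "h > 0" and u: "u holomorphic_on \<H>" and M: "M \<ge> 0"
    and per: "\<And>z. z \<in> \<H> \<Longrightarrow> u (z + of_real h) = u z"
    and bd: "\<And>z. Im z > M \<Longrightarrow> \<bar>Re z\<bar> \<le> h \<Longrightarrow> norm (u z) \<le> C * exp (B * Im z)"
  shows "mero_of u \<in> Per h"
proof (rule PerI_growth[OF h _ M])
  have v: "mval (mero_of u) z = u z" if "Im z > M" for z
    using that M holomorphic_imp_mero[OF u] by (intro mval_mero_of) (auto simp: upper_half_plane_def)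
  have "mcomp (translation h) (mero_of u) = mero_of (\<lambda>z. u (moebius_act (translation h) z))"
    using holomorphic_imp_mero[OF u] by (intro mero_of_ops) auto
  also have "\<dots> = mero_of u"
    using per holomorphic_imp_mero[OF u] by (intro mero_of_cong[symmetric]) auto
  finally show "mcomp (translation h) (mero_of u) = mero_of u" .
  have "u holomorphic_on {z. Im z > M}"
    using u M by (rule_tac holomorphic_on_subset) (auto simp: upper_half_plane_def)
  then show "mval (mero_of u) holomorphic_on {z. Im z > M}"
    by (rule holomorphic_transform) (simp add: v)
  show "norm (mval (mero_of u) z) \<le> C * exp (B * Im z)" if "Im z > M" "\<bar>Re z\<bar> \<le> h" for z
    using bd[OF that] v[OF that(1)] by simp
qed

text \<open>The difference of the squared distances is 4 Im w Im w0. Thus the Cayley quotient of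
  \<open>w - w0\<close> by \<open>w - cnj w0\<close> lies in the unit disc.\<close>

lemma norm_sub_cnj_gt:
  assumes "Im w > 0" "Im w0 > 0"
  shows "norm (w - w0) < norm (w - cnj w0)"
proof -
  have "(norm (w - cnj w0))\<^sup>2 - (norm (w - w0))\<^sup>2 = 4 * Im w * Im w0"
    unfolding cmod_power2 by (simp add: power2_eq_square algebra_simps)
  then have "(norm (w - w0))\<^sup>2 < (norm (w - cnj w0))\<^sup>2" using assms by (smt (verit) mult_pos_pos)
  then show ?thesis by (rule power2_less_imp_less) simp
qed

text \<open>The Schwarz lemma, transported to the half-plane by Cayley transforms.\<close>

lemma half_plane_self_map_bound:
  assumes hol: "w holomorphic_on \<H>"
    and maps: "\<And>z. z \<in> \<H> \<Longrightarrow> w z \<in> \<H>"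
    and z: "z \<in> \<H>"
  shows "norm (w z) \<le> norm (w \<i>) * (norm (z + \<i>))\<^sup>2 / Im z"
proof -
  have iH: "\<i> \<in> \<H>" by (simp add: upper_half_plane_def)
  define w0 where "w0 = w \<i>"
  have w0: "Im w0 > 0" using maps[OF iH] by (simp add: w0_def upper_half_plane_def)
  \<comment> \<open>The inverse Cayley transform from the disc to \<H> with 0 mapped to \<i>. On the
    target side f uses the Cayley transform centred at \<open>w0\<close>, so that f fixes 0 and the
    Schwarz lemma applies.\<close>
  define \<kappa> where "\<kappa> x = \<i> * (1 + x) / (1 - x)" for x :: complex
  define f where "f x = (w (\<kappa> x) - w0) / (w (\<kappa> x) - cnj w0)" for x
  have \<kappa>H: "\<kappa> x \<in> \<H>" if "norm x < 1" for x
  proof -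
    have ne: "1 - x \<noteq> 0" using that by auto
    have "Im (\<kappa> x) = (1 - (norm x)\<^sup>2) / (norm (1 - x))\<^sup>2"
      by (simp add: \<kappa>_def Im_divide cmod_power2) (simp add: power2_eq_square algebra_simps)
    moreover have "(norm x)\<^sup>2 < 1" using that by (simp add: power_less_one_iff)
    ultimately show ?thesis using ne by (simp add: upper_half_plane_def)
  qed
  have den: "norm (v - w0) < norm (v - cnj w0)" if "v \<in> \<H>" for v
    using norm_sub_cnj_gt[of v w0] that w0 by (simp add: upper_half_plane_def)
  have "f holomorphic_on ball 0 1"
  proof -
    have "\<kappa> holomorphic_on ball 0 1" unfolding \<kappa>_def by (auto intro!: holomorphic_intros)
    then have "(w \<circ> \<kappa>) holomorphic_on ball 0 1"
      by (rule holomorphic_on_compose_gen[OF _ hol]) (use \<kappa>H in auto)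
    moreover have "w (\<kappa> x) - cnj w0 \<noteq> 0" if "x \<in> ball 0 1" for x
      using den[OF maps[OF \<kappa>H[of x]]] that by auto
    ultimately show ?thesis unfolding f_def o_def by (intro holomorphic_intros) auto
  qed
  moreover have f1: "norm (f x) < 1" if "norm x < 1" for x
    using den[OF maps[OF \<kappa>H[OF that]]] by (simp add: f_def norm_divide divide_less_eq)
  moreover have "f 0 = 0" by (simp add: f_def \<kappa>_def w0_def)
  moreover define x where "x = (z - \<i>) / (z + \<i>)"
  have zi: "z + \<i> \<noteq> 0" using z by (auto simp: upper_half_plane_def complex_eq_iff)
  have x1: "norm x < 1"
    using norm_sub_cnj_gt[of z \<i>] z zi by (simp add: x_def norm_divide divide_less_eq upper_half_plane_def)
  ultimately have le: "norm (f x) \<le> norm x" using Schwarz_Lemma(1)[of f x] by blast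
  have "\<kappa> x = z"
  proof -
    have "1 + x = 2 * z / (z + \<i>)" "1 - x = 2 * \<i> / (z + \<i>)"
      using zi by (simp_all add: x_def field_simps)
    then show ?thesis using zi by (simp add: \<kappa>_def)
  qed
  then have fx: "f x = (w z - w0) / (w z - cnj w0)" by (simp add: f_def)
  have "norm (w z - w0) \<le> norm x * norm (w z - cnj w0)"
    using le den[OF maps[OF z]] unfolding fx by (simp add: norm_divide divide_le_eq split: if_splits)
  moreover have "norm (w z) - norm w0 \<le> norm (w z - w0)" by (rule norm_triangle_ineq2)
  moreover have "norm (w z - cnj w0) \<le> norm (w z) + norm w0"
    using norm_triangle_ineq4[of "w z" "cnj w0"] by simp
  ultimately have "norm (w z) - norm w0 \<le> norm x * (norm (w z) + norm w0)"
    by (smt (verit) mult_left_mono norm_ge_zero)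
  then have A: "norm (w z) * (1 - norm x) \<le> norm w0 * (1 + norm x)" by (simp add: algebra_simps)
  have B: "1 - (norm x)\<^sup>2 = 4 * Im z / (norm (z + \<i>))\<^sup>2"
  proof -
    have "(norm (z + \<i>))\<^sup>2 - (norm (z - \<i>))\<^sup>2 = 4 * Im z"
      unfolding cmod_power2 by (simp add: power2_eq_square algebra_simps)
    moreover have "1 - b / a = c / a" if "a - b = c" "a \<noteq> 0" for a b c :: real
      using that by (simp add: field_simps)
    ultimately show ?thesis using zi unfolding x_def norm_divide power_divide by simp
  qed
  \<comment> \<open>Multiplying \<open>A\<close> by 1 + |x| \<le> 2 bounds this by 4 |w0|; the 4
    cancels against the one in \<open>B\<close>.\<close>
  have "norm (w z) * (1 - (norm x)\<^sup>2) = norm (w z) * (1 - norm x) * (1 + norm x)"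
    by (simp add: power2_eq_square algebra_simps)
  also have "\<dots> \<le> norm w0 * (1 + norm x) * (1 + norm x)"
    using A by (intro mult_right_mono) auto
  also have "\<dots> \<le> norm w0 * (2 * 2)"
    unfolding mult.assoc using x1 by (intro mult_left_mono mult_mono) auto
  finally show ?thesis
    using z zi unfolding B w0_def by (simp add: field_simps upper_half_plane_def)
qed

lemma self_map_in_Pol:
  assumes h: "h > 0" and hol: "w holomorphic_on \<H>"
    and maps: "\<And>z. z \<in> \<H> \<Longrightarrow> w z \<in> \<H>"
    and w: "\<And>z. z \<in> \<H> \<Longrightarrow> w (z + of_real h) = w z + of_real h'"
  shows "mero_of w \<in> Pol h"
proof -
  \<comment> \<open>The slope for which the increments of w and of the linear function over one
    period coincide, leaving v periodic.\<close>
  define \<alpha> where "\<alpha> = complex_of_real (h' / h)"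
  define v where "v z = w z - \<alpha> * z" for z
  have v: "v holomorphic_on \<H>"
    unfolding v_def by (intro holomorphic_intros hol)
  have "mero_of v \<in> Per h"
  proof (rule mero_of_in_PerI[OF h v, of 1])
    fix z assume "z \<in> \<H>"
    then show "v (z + of_real h) = v z" using w h by (simp add: v_def \<alpha>_def field_simps)
  next
    fix z assume z: "Im z > 1" "\<bar>Re z\<bar> \<le> h"
    define y where "y = Im z"
    have "y \<le> exp y" using exp_ge_add_one_self[of y] by linarith
    then have y: "y > 1" "y \<le> exp (1 * y)" using z by (auto simp: y_def)
    \<comment> \<open>On the strip, with y > 1, |z| is at most linear in y. The quadratic bound
      divided by Im z then becomes linear, which is dominated by exp y.\<close>
    have nz: "norm z \<le> (h + 1) * y"
    proof -
      have "h \<le> h * y" using y h by simp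
      then show ?thesis using cmod_le[of z] z y by (simp add: y_def algebra_simps)
    qed
    have "norm (z + \<i>) \<le> (h + 2) * y"
      using norm_triangle_ineq[of z \<i>] nz y by (simp add: algebra_simps)
    then have "(norm (z + \<i>))\<^sup>2 \<le> ((h + 2) * y)\<^sup>2" by (intro power_mono) auto
    then have "norm (w \<i>) * (norm (z + \<i>))\<^sup>2 / Im z \<le> norm (w \<i>) * ((h + 2) * y)\<^sup>2 / y"
      using y by (simp add: y_def divide_right_mono mult_left_mono)
    also have "\<dots> = norm (w \<i>) * (h + 2)\<^sup>2 * y" using y by (simp add: power2_eq_square)
    finally have "norm (w z) \<le> norm (w \<i>) * (h + 2)\<^sup>2 * y"
      using half_plane_self_map_bound[OF hol maps, of z] z by (auto simp: upper_half_plane_def)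
    moreover have "norm (\<alpha> * z) \<le> norm \<alpha> * ((h + 1) * y)"
      unfolding norm_mult using nz by (intro mult_left_mono) auto
    ultimately have "norm (v z) \<le> (norm (w \<i>) * (h + 2)\<^sup>2 + norm \<alpha> * (h + 1)) * y"
      using norm_triangle_ineq4[of "w z" "\<alpha> * z"] by (simp add: v_def algebra_simps)
    also have "\<dots> \<le> (norm (w \<i>) * (h + 2)\<^sup>2 + norm \<alpha> * (h + 1)) * exp (1 * y)"
      using y h by (intro mult_left_mono) auto
    finally show "norm (v z) \<le> (norm (w \<i>) * (h + 2)\<^sup>2 + norm \<alpha> * (h + 1)) * exp (1 * Im z)"
      by (simp add: y_def)
  qed simp
  moreover have "mero_of w = mero_of v + mconst \<alpha> * mid"
  proof -
    have "mconst \<alpha> * mid = mero_of (\<lambda>z. \<alpha> * z)"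
      unfolding mconst_eq_mero_of mid_eq_mero_of by (intro mero_of_ops) auto
    moreover have "mero_of v + mero_of (\<lambda>z. \<alpha> * z) = mero_of (\<lambda>z. v z + \<alpha> * z)"
      using holomorphic_imp_mero[OF v] by (intro mero_of_ops) (auto intro!: meromorphic_intros)
    ultimately show ?thesis by (simp add: v_def)
  qed
  ultimately show ?thesis by (auto intro: Pol.intros mconst_in_Pol)
qed

section \<open>Cusps\<close>

lemma matrix_2_eq_iff:
  "A = B \<longleftrightarrow> A $ 1 $ 1 = B $ 1 $ 1 \<and> A $ 1 $ 2 = B $ 1 $ 2 \<and> A $ 2 $ 1 = B $ 2 $ 1 \<and> A $ 2 $ 2 = B $ 2 $ 2"
  for A B :: "'a^2^2"
  by (auto simp: vec_eq_iff forall_2)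

lemma matrix_mult_2_nth [simp]:
  fixes A B :: "real^2^2"
  shows "(A ** B) $ i $ j = A $ i $ 1 * B $ 1 $ j + A $ i $ 2 * B $ 2 $ j"
  by (simp add: matrix_matrix_mult_def sum_2)

lemma mat_1_2_nth [simp]:
  "(mat 1 :: real^2^2) $ 1 $ 1 = 1" "(mat 1 :: real^2^2) $ 1 $ 2 = 0"
  "(mat 1 :: real^2^2) $ 2 $ 1 = 0" "(mat 1 :: real^2^2) $ 2 $ 2 = 1"
  by (simp_all add: mat_def)

definition matrix_of_rows :: "real \<Rightarrow> real \<Rightarrow> real \<Rightarrow> real \<Rightarrow> real^2^2" where
  "matrix_of_rows a b c d = vector [vector [a, b], vector [c, d]]"

lemma matrix_of_rows_nth [simp]:
  "matrix_of_rows a b c d $ 1 $ 1 = a" "matrix_of_rows a b c d $ 1 $ 2 = b"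
  "matrix_of_rows a b c d $ 2 $ 1 = c" "matrix_of_rows a b c d $ 2 $ 2 = d"
  by (simp_all add: matrix_of_rows_def)

lemma matrix_inv_unique_2:
  fixes g :: "real^2^2"
  assumes "det g = 1" "x ** g = mat 1 \<or> g ** x = mat 1"
  shows "matrix_inv g = x"
  using assms(2) matrix_inv_det1[OF assms(1)]
  by (metis matrix_mul_assoc matrix_mul_lid matrix_mul_rid)

lemma matrix_inv_2:
  assumes "det (g :: real^2^2) = 1"
  shows "matrix_inv g = matrix_of_rows (g $ 2 $ 2) (- g $ 1 $ 2) (- g $ 2 $ 1) (g $ 1 $ 1)"
  using assms by (intro matrix_inv_unique_2) (auto simp: matrix_2_eq_iff det_2 algebra_simps)

lemma SL2_carrier: "A \<in> carrier (SL2 R) \<longleftrightarrow> det A = 1 \<and>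
    A $ 1 $ 1 \<in> R \<and> A $ 1 $ 2 \<in> R \<and> A $ 2 $ 1 \<in> R \<and> A $ 2 $ 2 \<in> R"
  by (auto simp: SL2_def forall_2)

section \<open>Conjugation by \<sigma>, the group \<Gamma> and its cusps\<close>

locale quadratic_field =
  fixes K :: "real set" and \<sigma> :: "real \<Rightarrow> real"
  assumes K: "real_quadratic_field K" and \<sigma>: "nontrivial_automorphism K \<sigma>"
begin

lemma K_closed [simp, intro]:
  "1 \<in> K" "0 \<in> K" "x \<in> K \<Longrightarrow> y \<in> K \<Longrightarrow> x - y \<in> K" "x \<in> K \<Longrightarrow> y \<in> K \<Longrightarrow> x * y \<in> K"
  "x \<in> K \<Longrightarrow> - x \<in> K" "x \<in> K \<Longrightarrow> y \<in> K \<Longrightarrow> x + y \<in> K" "x \<in> K \<Longrightarrow> y \<in> K \<Longrightarrow> x / y \<in> K"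
  "numeral n \<in> K"
proof -
  show 1: "1 \<in> K" and d: "x \<in> K \<Longrightarrow> y \<in> K \<Longrightarrow> x - y \<in> K"
    and m: "x \<in> K \<Longrightarrow> y \<in> K \<Longrightarrow> x * y \<in> K" for x y
    using K by (auto simp: real_quadratic_field_def)
  show 0: "0 \<in> K" using d[OF 1 1] by simp
  show u: "x \<in> K \<Longrightarrow> - x \<in> K" for x using d[OF 0, of x] by simp
  show a: "x \<in> K \<Longrightarrow> y \<in> K \<Longrightarrow> x + y \<in> K" for x y using d[OF _ u, of x y] by simp
  have "y \<in> K \<Longrightarrow> inverse y \<in> K" using K by (auto simp: real_quadratic_field_def)
  then show "x \<in> K \<Longrightarrow> y \<in> K \<Longrightarrow> x / y \<in> K" using m by (simp add: divide_inverse)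
  have "of_nat i \<in> K" for i by (induction i) (auto intro: 0 1 a)
  from this[of "numeral n"] show "numeral n \<in> K" by simp
qed

lemma \<sigma>_add: "x \<in> K \<Longrightarrow> y \<in> K \<Longrightarrow> \<sigma> (x + y) = \<sigma> x + \<sigma> y"
  and \<sigma>_mult: "x \<in> K \<Longrightarrow> y \<in> K \<Longrightarrow> \<sigma> (x * y) = \<sigma> x * \<sigma> y"
  using \<sigma> by (auto simp: nontrivial_automorphism_def)

lemma \<sigma>_0 [simp]: "\<sigma> 0 = 0"
  using \<sigma>_add[of 0 0] by simp

lemma \<sigma>_1 [simp]: "\<sigma> 1 = 1"
proof -
  have "\<sigma> 1 \<noteq> \<sigma> 0"
    using \<sigma> inj_onD[of \<sigma> K 1 0] by (auto simp: nontrivial_automorphism_def bij_betw_def)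
  then show ?thesis using \<sigma>_mult[of 1 1] by simp
qed

lemma \<sigma>_minus: "x \<in> K \<Longrightarrow> \<sigma> (- x) = - \<sigma> x"
  using \<sigma>_add[of x "- x"] by simp

lemma \<sigma>_diff: "x \<in> K \<Longrightarrow> y \<in> K \<Longrightarrow> \<sigma> (x - y) = \<sigma> x - \<sigma> y"
  using \<sigma>_add[of x "- y"] \<sigma>_minus by simp

lemma conj_matrix_nth [simp]: "conj_matrix \<sigma> A $ i $ j = \<sigma> (A $ i $ j)"
  by (simp add: conj_matrix_def)

lemma det_SL2: "A \<in> carrier (SL2 K) \<Longrightarrow> det A = 1"
  by (simp add: SL2_carrier)

lemma SL2_mult: "A \<in> carrier (SL2 K) \<Longrightarrow> B \<in> carrier (SL2 K) \<Longrightarrow> A ** B \<in> carrier (SL2 K)"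
  by (auto simp: SL2_carrier det_mul)

lemma SL2_inv: "A \<in> carrier (SL2 K) \<Longrightarrow> matrix_inv A \<in> carrier (SL2 K)"
  using matrix_inv_det1(1)[of A] by (auto simp: SL2_carrier matrix_inv_2)

lemma SL2_one: "mat 1 \<in> carrier (SL2 K)"
  by (auto simp: SL2_carrier)

lemma det_conj_matrix:
  assumes "A \<in> carrier (SL2 K)"
  shows "det (conj_matrix \<sigma> A) = 1"
proof -
  have "det (conj_matrix \<sigma> A) = \<sigma> (det A)"
    unfolding det_2 using assms by (simp add: SL2_carrier \<sigma>_mult \<sigma>_diff)
  then show ?thesis using assms by (simp add: SL2_carrier)
qed

lemma conj_matrix_mult:
  assumes "A \<in> carrier (SL2 K)" "B \<in> carrier (SL2 K)"
  shows "conj_matrix \<sigma> (A ** B) = conj_matrix \<sigma> A ** conj_matrix \<sigma> B"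
  using assms by (simp add: matrix_2_eq_iff SL2_carrier \<sigma>_mult \<sigma>_add)

lemma conj_matrix_translation: "conj_matrix \<sigma> (translation h) = translation (\<sigma> h)"
  by (simp add: matrix_2_eq_iff)

lemma translation_in_SL2: "h \<in> K \<Longrightarrow> translation h \<in> carrier (SL2 K)"
  by (simp add: SL2_carrier)

end

locale quadratic_group = quadratic_field +
  fixes \<Gamma> :: "(real^2^2) set"
  assumes \<Gamma>: "subgroup \<Gamma> (SL2 K)"
begin

lemma \<Gamma>_SL2: "\<gamma> \<in> \<Gamma> \<Longrightarrow> \<gamma> \<in> carrier (SL2 K)"
  using subgroup.subset[OF \<Gamma>] by blast

lemma det_\<Gamma>: "\<gamma> \<in> \<Gamma> \<Longrightarrow> det \<gamma> = 1"
  using \<Gamma>_SL2 det_SL2 by blast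

lemma \<Gamma>_one: "mat 1 \<in> \<Gamma>"
  using subgroup.one_closed[OF \<Gamma>] by (simp add: SL2_def)

lemma \<Gamma>_mult: "\<gamma> \<in> \<Gamma> \<Longrightarrow> \<delta> \<in> \<Gamma> \<Longrightarrow> \<gamma> ** \<delta> \<in> \<Gamma>"
  using subgroup.m_closed[OF \<Gamma>, of \<gamma> \<delta>] by (simp add: SL2_def)

lemma \<Gamma>_inv:
  assumes "\<gamma> \<in> \<Gamma>"
  shows "matrix_inv \<gamma> \<in> \<Gamma>"
proof -
  have d: "det \<gamma> = 1" and c: "\<gamma> \<in> carrier (SL2 K)"
    using assms det_\<Gamma> \<Gamma>_SL2 by auto
  have "inv\<^bsub>SL2 K\<^esub> \<gamma> = matrix_inv \<gamma>"
    unfolding m_inv_def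
  proof (rule the_equality)
    show "matrix_inv \<gamma> \<in> carrier (SL2 K) \<and> \<gamma> \<otimes>\<^bsub>SL2 K\<^esub> matrix_inv \<gamma> = \<one>\<^bsub>SL2 K\<^esub> \<and>
      matrix_inv \<gamma> \<otimes>\<^bsub>SL2 K\<^esub> \<gamma> = \<one>\<^bsub>SL2 K\<^esub>"
      using SL2_inv[OF c] matrix_inv_det1[OF d] by (simp add: SL2_def)
    show "y = matrix_inv \<gamma>" if "y \<in> carrier (SL2 K) \<and> \<gamma> \<otimes>\<^bsub>SL2 K\<^esub> y = \<one>\<^bsub>SL2 K\<^esub> \<and>
      y \<otimes>\<^bsub>SL2 K\<^esub> \<gamma> = \<one>\<^bsub>SL2 K\<^esub>" for y
      using that matrix_inv_unique_2[OF d, of y] by (simp add: SL2_def)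
  qed
  then show ?thesis using subgroup.m_inv_closed[OF \<Gamma> assms] by simp
qed

text \<open>A representative \<open>g\<close> of the cusp \<open>g\<infinity>\<close>, with a translation in \<open>g\<^sup>-\<^sup>1 \<Gamma> g\<close>.\<close>

definition cusp_pair :: "real^2^2 \<Rightarrow> real \<Rightarrow> bool" where
  "cusp_pair g h \<longleftrightarrow> g \<in> carrier (SL2 K) \<and> h > 0 \<and> h \<in> K \<and> (\<exists>\<gamma>\<in>\<Gamma>. \<gamma> ** g = g ** translation h)"

lemma cusp_pairD:
  assumes "cusp_pair g h"
  shows "g \<in> carrier (SL2 K)" "det g = 1" "h > 0" "h \<in> K"
  using assms det_SL2 by (auto simp: cusp_pair_def)

text \<open>The stabiliser of \<gamma>g\<infinity> is the stabiliser of g\<infinity> conjugated by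
  \<gamma>, so the same width h serves for the whole orbit.\<close>

lemma cusp_pair_mult:
  assumes "cusp_pair g h" "\<gamma> \<in> \<Gamma>"
  shows "cusp_pair (\<gamma> ** g) h"
proof -
  obtain \<delta> where \<delta>: "\<delta> \<in> \<Gamma>" "\<delta> ** g = g ** translation h" using assms by (auto simp: cusp_pair_def)
  have "(\<gamma> ** \<delta> ** matrix_inv \<gamma>) ** (\<gamma> ** g) = \<gamma> ** \<delta> ** (matrix_inv \<gamma> ** \<gamma>) ** g"
    by (simp only: matrix_mul_assoc)
  also have "\<dots> = \<gamma> ** g ** translation h"
    using \<delta> matrix_inv_det1[OF det_\<Gamma>[OF assms(2)]]
    by (metis matrix_mul_assoc matrix_mul_rid)
  finally show ?thesis
    using assms \<delta> unfolding cusp_pair_def by (blast intro: \<Gamma>_mult \<Gamma>_inv \<Gamma>_SL2 SL2_mult)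
qed

text \<open>Writing \<gamma> as g conjugating the translation by h gives an explicit matrix of trace
  2. Its fixed point is a/c, or infinity for c = 0, with a and c the first column of g.\<close>

lemma cusp_pair_cusp:
  assumes "cusp_pair g h"
  shows "moebius_sphere g None \<in> cusps \<Gamma>"
proof -
  note gh = cusp_pairD[OF assms]
  obtain \<gamma> where \<gamma>: "\<gamma> \<in> \<Gamma>" "\<gamma> ** g = g ** translation h" using assms by (auto simp: cusp_pair_def)
  define a c where "a = g $ 1 $ 1" and "c = g $ 2 $ 1"
  have "\<gamma> = \<gamma> ** (g ** matrix_inv g)" using matrix_inv_det1[OF gh(2)] by simp
  also have "\<dots> = g ** translation h ** matrix_inv g" using \<gamma>(2) by (simp add: matrix_mul_assoc)
  also have "\<dots> = matrix_of_rows (1 - a * c * h) (a\<^sup>2 * h) (- c\<^sup>2 * h) (1 + a * c * h)"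
    using gh(2) unfolding matrix_inv_2[OF gh(2)]
    by (simp add: matrix_2_eq_iff a_def c_def det_2 algebra_simps power2_eq_square)
  finally have \<gamma>_eq: "\<gamma> = matrix_of_rows (1 - a * c * h) (a\<^sup>2 * h) (- c\<^sup>2 * h) (1 + a * c * h)" .
  have ac: "a \<noteq> 0 \<or> c \<noteq> 0" using gh(2) by (auto simp: det_2 a_def c_def)
  have "parabolic \<gamma>"
    using det_\<Gamma>[OF \<gamma>(1)] ac gh(3) unfolding parabolic_def \<gamma>_eq
    by (auto simp: trace_def sum_2 matrix_2_eq_iff)
  moreover have "moebius_sphere \<gamma> (moebius_sphere g None) = moebius_sphere g None"
  proof (cases "c = 0")
    case True
    then show ?thesis unfolding \<gamma>_eq by (simp add: moebius_sphere_def c_def)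
  next
    case False
    have au: "autfac \<gamma> (of_real (a / c)) = 1"
      using False unfolding \<gamma>_eq by (simp add: autfac_def field_simps power2_eq_square)
    moreover have "moebius_act \<gamma> (of_real (a / c)) = of_real (a / c)"
      unfolding moebius_act_def au using False unfolding \<gamma>_eq by (simp add: field_simps power2_eq_square)
    ultimately show ?thesis
      using False by (simp add: moebius_sphere_def a_def c_def)
  qed
  ultimately show ?thesis unfolding cusps_def using \<gamma>(1) by blast
qed

text \<open>Squaring \<gamma> removes the sign e = \<plusminus>1 and leaves the translation by 2 e
  u. If this is negative, the inverse of the square is taken.\<close>

lemma cusp_pairI:
  assumes g: "g \<in> carrier (SL2 K)" and \<gamma>: "\<gamma> \<in> \<Gamma>" "\<gamma> ** g = g ** matrix_of_rows e u 0 e"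
    and e: "e * e = 1" and u: "u \<noteq> 0" "e \<in> K" "u \<in> K"
  shows "cusp_pair g (\<bar>2 * e * u\<bar>)"
proof -
  have 1: "matrix_of_rows e u 0 e ** matrix_of_rows e u 0 e = translation (2 * e * u)"
    using e by (simp add: matrix_2_eq_iff)
  have 2: "(\<gamma> ** \<gamma>) ** g = g ** translation (2 * e * u)"
    using \<gamma>(2) 1 by (metis matrix_mul_assoc)
  have d: "det (\<gamma> ** \<gamma>) = 1" using det_\<Gamma>[OF \<gamma>(1)] by (simp add: det_mul)
  have "translation (2 * e * u) ** translation (- (2 * e * u)) = mat 1"
    by (simp add: matrix_2_eq_iff)
  then have 3: "matrix_inv (\<gamma> ** \<gamma>) ** g = g ** translation (- (2 * e * u))"
    using 2 matrix_inv_det1[OF d] by (metis matrix_mul_assoc matrix_mul_lid matrix_mul_rid)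
  have "e \<noteq> 0" using e by auto
  then have "\<bar>2 * e * u\<bar> > 0" using u by simp
  moreover have "\<bar>2 * e * u\<bar> \<in> K" using u by (auto simp: abs_if)
  moreover have "\<exists>\<gamma>\<in>\<Gamma>. \<gamma> ** g = g ** translation \<bar>2 * e * u\<bar>"
    using 2 3 \<Gamma>_mult[OF \<gamma>(1) \<gamma>(1)] \<Gamma>_inv[OF \<Gamma>_mult[OF \<gamma>(1) \<gamma>(1)]] by (auto simp: abs_if)
  ultimately show ?thesis using g by (simp add: cusp_pair_def)
qed

text \<open>A parabolic fixed point is the double root of a quadratic equation over K, so it lies in
  K or is infinity. Hence it is represented by a matrix over K, to which \<sigma> can be
  applied.\<close>

lemma cusp_pair_exists:
  assumes "p \<in> cusps \<Gamma>"
  obtains g h where "cusp_pair g h" "moebius_sphere g None = p"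
proof -
  obtain \<gamma> where \<gamma>: "\<gamma> \<in> \<Gamma>" "parabolic \<gamma>" "moebius_sphere \<gamma> p = p"
    using assms by (auto simp: cusps_def)
  define a b c d where "a = \<gamma> $ 1 $ 1" and "b = \<gamma> $ 1 $ 2" and "c = \<gamma> $ 2 $ 1" and "d = \<gamma> $ 2 $ 2"
  note abcd = a_def[symmetric] b_def[symmetric] c_def[symmetric] d_def[symmetric]
  have inK: "a \<in> K" "b \<in> K" "c \<in> K" "d \<in> K"
    using \<Gamma>_SL2[OF \<gamma>(1)] by (auto simp: SL2_carrier abcd)
  have det: "a * d - b * c = 1" using det_\<Gamma>[OF \<gamma>(1)] by (simp add: det_2 abcd)
  have "\<bar>a + d\<bar> = 2" using \<gamma>(2) by (simp add: parabolic_def trace_def sum_2 abcd)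
  then have tr: "(a + d)\<^sup>2 = 4" using power2_abs[of "a + d"] by simp
  show thesis
  proof (cases "c = 0")
    case False
    then obtain z where z: "p = Some z" "autfac \<gamma> z \<noteq> 0" "moebius_act \<gamma> z = z"
      using \<gamma>(3) by (cases p) (auto simp: moebius_sphere_def abcd split: if_splits)
    define x where "x = (a - d) / (2 * c)"
    have "of_real a * z + of_real b = z * (of_real c * z + of_real d)"
      using z(2,3) by (simp add: moebius_act_def autfac_def abcd field_simps)
    then have "of_real c * z\<^sup>2 - of_real (a - d) * z = of_real b"
      by (simp add: power2_eq_square algebra_simps)
    \<comment> \<open>Completing the square in the fixed point equation. The resulting discriminant
      is the squared trace minus 4, which is zero.\<close>
    moreover have "(2 * of_real c * z - of_real (a - d))\<^sup>2 =
        4 * of_real c * (of_real c * z\<^sup>2 - of_real (a - d) * z) + of_real ((a - d)\<^sup>2)"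
      by (simp add: power2_eq_square algebra_simps)
    ultimately have "(2 * of_real c * z - of_real (a - d))\<^sup>2 = of_real ((a - d)\<^sup>2 + 4 * b * c)"
      by simp
    also have "(a - d)\<^sup>2 + 4 * b * c = (a + d)\<^sup>2 - 4 * (a * d - b * c)"
      by (simp add: power2_eq_square algebra_simps)
    finally have "z = of_real x" using det tr False by (simp add: x_def field_simps)
    \<comment> \<open>The matrix g sends infinity to the fixed point x, and e is the double
      eigenvalue of \<gamma>; conjugation by g makes \<gamma> upper triangular with diagonal
      e.\<close>
    define g where "g = matrix_of_rows x (-1) 1 0"
    define e where "e = (a + d) / 2"
    have xK: "x \<in> K" unfolding x_def using inK by auto
    have gK: "g \<in> carrier (SL2 K)" using xK by (auto simp: g_def SL2_carrier det_2)
    have cx: "c * x = (a - d) / 2" using False by (simp add: x_def)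
    have axb: "a * x + b = x * e"
    proof -
      have "a * a + 2 * (a * d) + d * d = 4" using tr by (simp add: power2_eq_square algebra_simps)
      then have "a * ((a - d) / 2) + b * c = (a - d) / 2 * e"
        using det unfolding e_def by (simp add: field_simps)
      then have "a * (c * x) + b * c = (c * x) * e" unfolding cx .
      then have "c * (a * x + b) = c * (x * e)" by (simp add: algebra_simps)
      then show ?thesis using False by simp
    qed
    have "cusp_pair g \<bar>2 * e * (- c)\<bar>"
    proof (rule cusp_pairI[OF gK \<gamma>(1)])
      show "\<gamma> ** g = g ** matrix_of_rows e (- c) 0 e"
        using axb cx by (simp add: matrix_2_eq_iff g_def abcd e_def field_simps)
      show "e * e = 1" using tr by (simp add: e_def power2_eq_square)
    qed (use False inK in \<open>auto simp: e_def\<close>)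
    moreover have "moebius_sphere g None = p"
      using z \<open>z = of_real x\<close> by (simp add: moebius_sphere_def g_def)
    ultimately show thesis using that by blast
  next
    case True
    have "(a - d)\<^sup>2 = (a + d)\<^sup>2 - 4 * (a * d)" by (simp add: power2_eq_square algebra_simps)
    then have ad: "d = a" "a * a = 1" using det tr True by auto
    have b: "b \<noteq> 0"
    proof
      assume "b = 0"
      moreover have "a = 1 \<or> a = - 1" using ad(2) by (simp add: square_eq_1_iff)
      ultimately have "\<gamma> = mat 1 \<or> \<gamma> = - mat 1"
        using ad True by (auto simp: matrix_2_eq_iff abcd)
      then show False using \<gamma>(2) by (auto simp: parabolic_def)
    qed
    have "p = None"
    proof (cases p)
      case (Some z)
      have "autfac \<gamma> z = of_real a" using True ad by (simp add: autfac_def abcd)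
      moreover have "a \<noteq> 0" using ad by auto
      ultimately have "moebius_act \<gamma> z = z" using \<gamma>(3) Some by (simp add: moebius_sphere_def)
      then have "of_real a * z + of_real b = of_real a * z"
        using \<open>a \<noteq> 0\<close> \<open>autfac \<gamma> z = of_real a\<close> by (simp add: moebius_act_def abcd field_simps)
      then show ?thesis using b by simp
    qed
    have "cusp_pair (mat 1) \<bar>2 * a * b\<bar>"
    proof (rule cusp_pairI[OF SL2_one \<gamma>(1)])
      show "\<gamma> ** mat 1 = mat 1 ** matrix_of_rows a b 0 a"
        using True ad by (simp add: matrix_2_eq_iff abcd)
    qed (use ad b inK in auto)
    moreover have "moebius_sphere (mat 1) None = p"
      using \<open>p = None\<close> by (simp add: moebius_sphere_def)
    ultimately show thesis using that by blast
  qed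
qed

end

section \<open>The linear differential equation\<close>

text \<open>Holomorphy is carried along with membership in \<open>Pol h\<close>, so that products
  and powers can be formed pointwise and \<open>mero_of\<close> commutes with them.\<close>

definition polynomial_growth :: "real \<Rightarrow> (complex \<Rightarrow> complex) \<Rightarrow> bool" where
  "polynomial_growth h u \<longleftrightarrow> u holomorphic_on \<H> \<and> mero_of u \<in> Pol h"

lemma mero_of_mult_holomorphic:
  assumes "u holomorphic_on \<H>" "v holomorphic_on \<H>"
  shows "mero_of (\<lambda>z. u z * v z) = mero_of u * mero_of v"
    and "mero_of (\<lambda>z. u z + v z) = mero_of u + mero_of v"
  using mero_of_ops(1,3)[OF holomorphic_imp_mero(1)[OF assms(1)] holomorphic_imp_mero(1)[OF assms(2)]] by auto

lemma polynomial_growth_mult: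
  "polynomial_growth h u \<Longrightarrow> polynomial_growth h v \<Longrightarrow> polynomial_growth h (\<lambda>z. u z * v z)"
  by (auto simp: polynomial_growth_def mero_of_mult_holomorphic intro!: holomorphic_intros Pol.mult)

lemma polynomial_growth_affine:
  assumes "polynomial_growth h u"
  shows "polynomial_growth h (\<lambda>z. a * u z + b)"
proof -
  have u: "u holomorphic_on \<H>" using assms by (simp add: polynomial_growth_def)
  have "mero_of (\<lambda>z. a * u z + b) = mconst a * mero_of u + mconst b"
    unfolding mconst_eq_mero_of using u
    by (simp add: mero_of_mult_holomorphic(2)[of "\<lambda>z. a * u z" "\<lambda>_. b"]
        mero_of_mult_holomorphic(1)[of "\<lambda>_. a" u] holomorphic_intros)
  then show ?thesis using assms by (auto simp: polynomial_growth_def intro!: holomorphic_intros Pol.add Pol.mult mconst_in_Pol)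
qed

lemma polynomial_growth_power:
  assumes "polynomial_growth h u"
  shows "polynomial_growth h (\<lambda>z. u z ^ n)"
proof (induction n)
  case 0
  then show ?case using mconst_in_Pol[of 1 h] by (simp add: polynomial_growth_def mconst_eq_mero_of[symmetric] flip: mconst_eq_mero_of)
next
  case (Suc n)
  then show ?case using polynomial_growth_mult[OF assms] by simp
qed

lemma polynomial_growth_id: "polynomial_growth h (\<lambda>z. z)"
  by (auto simp: polynomial_growth_def intro: Pol.mid simp flip: mid_eq_mero_of)

lemma mcomp_mero_of:
  assumes "det g = 1" "u holomorphic_on \<H>"
  shows "mcomp g (mero_of u) = mero_of (\<lambda>z. u (moebius_act g z))"
  using mero_of_ops(6)[OF holomorphic_imp_mero(1)[OF assms(2)] holomorphic_imp_mero(1)[OF assms(2)] assms(1)] .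

lemma holomorphic_compose_moebius:
  assumes "det g = 1" "u holomorphic_on \<H>"
  shows "(\<lambda>z. u (moebius_act g z)) holomorphic_on \<H>"
proof -
  have "moebius_act g holomorphic_on \<H>"
    using moebius_act_analytic[OF assms(1)] by (rule analytic_imp_holomorphic)
  then have "(u \<circ> moebius_act g) holomorphic_on \<H>"
    by (rule holomorphic_on_compose_gen[OF _ assms(2)]) (use moebius_act_in_upper_half_plane[OF assms(1)] in auto)
  then show ?thesis by (simp add: o_def)
qed

lemma autfac_holomorphic: "autfac g holomorphic_on A"
  unfolding autfac_def[abs_def] by (intro holomorphic_intros)

lemma mero_of_in_Per_bounded:
  assumes "h > 0" "u holomorphic_on \<H>"
    and "\<And>z. z \<in> \<H> \<Longrightarrow> u (z + of_real h) = u z"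
    and "M > 0" "bounded (u ` {z. Im z > M})"
  shows "mero_of u \<in> Per h"
proof -
  obtain C where "\<And>z. Im z > M \<Longrightarrow> norm (u z) \<le> C" using assms(5) by (auto simp: bounded_iff)
  then show ?thesis using assms by (intro mero_of_in_PerI[of h u M C 0]) auto
qed

lemma poly_eq_sum_atMost:
  fixes p :: "'a::comm_semiring_1 poly"
  assumes "degree p \<le> n"
  shows "poly p x = (\<Sum>i\<le>n. coeff p i * x ^ i)"
  unfolding poly_altdef using assms by (intro sum.mono_neutral_left) (auto simp: coeff_eq_0)

lemma degree_linear_powers_le:
  fixes a b c d :: "'a::comm_ring_1"
  assumes "i \<le> k"
  shows "degree ([:b, a:] ^ i * [:d, c:] ^ (k - i)) \<le> k"
proof -
  have "degree ([:b, a:] ^ i) \<le> i" "degree ([:d, c:] ^ (k - i)) \<le> k - i"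
    using degree_power_le[of "[:b, a:]" i] degree_power_le[of "[:d, c:]" "k - i"]
      degree_pCons_le[of b "[:a:]"] degree_pCons_le[of d "[:c:]"]
    by (auto intro: order_trans simp: le_trans[OF _ mult_le_mono1])
  then show ?thesis using degree_mult_le[of "[:b, a:] ^ i" "[:d, c:] ^ (k - i)"] assms by linarith
qed

text \<open>An automorphy factor of weight k clears the denominator of the i-th power of a Moebius
  map for i \<le> k. The index ranges of the functions \<open>F (i, j)\<close> come from
  this.\<close>

lemma power_split_divide:
  fixes x y :: complex
  assumes "i \<le> k" "y \<noteq> 0"
  shows "y ^ k * (x / y) ^ i = x ^ i * y ^ (k - i)"
  using assms by (simp add: power_divide power_diff)

section \<open>Twisted forms and the equivariant map near the cusps\<close>

locale twisted_form = quadratic_group +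
  fixes \<phi> f t :: "complex \<Rightarrow> complex" and k l :: nat
  assumes \<phi>: "equivariant_map \<sigma> \<Gamma> \<phi>"
    and f: "twisted_modular_form K \<sigma> \<Gamma> \<phi> k l f"
    and t: "modular_function \<Gamma> t"
begin

lemma \<phi>_holomorphic: "\<phi> holomorphic_on \<H>"
  and \<phi>_maps: "z \<in> \<H> \<Longrightarrow> \<phi> z \<in> \<H>"
  and \<phi>_equivariant: "\<gamma> \<in> \<Gamma> \<Longrightarrow> z \<in> \<H> \<Longrightarrow>
    \<phi> (moebius_act \<gamma> z) = moebius_act (conj_matrix \<sigma> \<gamma>) (\<phi> z)"
  using \<phi> by (auto simp: equivariant_map_def)

lemma f_holomorphic: "f holomorphic_on \<H>"
  and f_equivariant: "\<gamma> \<in> \<Gamma> \<Longrightarrow> z \<in> \<H> \<Longrightarrow>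
    f (moebius_act \<gamma> z) = autfac \<gamma> z ^ k * autfac (conj_matrix \<sigma> \<gamma>) (\<phi> z) ^ l * f z"
  using f by (auto simp: twisted_modular_form_def)

abbreviation slash where "slash \<equiv> twisted_slash \<sigma> \<phi> k l f"

text \<open>The map \<phi> seen from the cusp g\<infinity>: source and target are moved by g and its
  conjugate, so that w is again a self-map of \<H>, now studied at infinity.\<close>

definition w :: "real^2^2 \<Rightarrow> complex \<Rightarrow> complex" where
  "w g z = moebius_act (matrix_inv (conj_matrix \<sigma> g)) (\<phi> (moebius_act g z))"

context
  fixes g :: "real^2^2"
  assumes g: "g \<in> carrier (SL2 K)"
begin

lemma w_maps: "z \<in> \<H> \<Longrightarrow> w g z \<in> \<H>"
  unfolding w_def using matrix_inv_det1(1)[OF det_conj_matrix[OF g]] det_SL2[OF g]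
  by (intro moebius_act_in_upper_half_plane \<phi>_maps) auto

lemma moebius_act_w: "z \<in> \<H> \<Longrightarrow> moebius_act (conj_matrix \<sigma> g) (w g z) = \<phi> (moebius_act g z)"
  unfolding w_def using det_conj_matrix[OF g] det_SL2[OF g]
  by (intro moebius_act_inv \<phi>_maps moebius_act_in_upper_half_plane) auto

lemma w_holomorphic: "w g holomorphic_on \<H>"
proof -
  let ?m = "matrix_inv (conj_matrix \<sigma> g)"
  have d: "det ?m = 1" using matrix_inv_det1(1)[OF det_conj_matrix[OF g]] .
  have "moebius_act ?m holomorphic_on \<H>"
    using moebius_act_analytic[OF d] by (rule analytic_imp_holomorphic)
  moreover have "(\<lambda>z. \<phi> (moebius_act g z)) holomorphic_on \<H>"
    by (rule holomorphic_compose_moebius[OF det_SL2[OF g] \<phi>_holomorphic])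
  ultimately have "(moebius_act ?m \<circ> (\<lambda>z. \<phi> (moebius_act g z))) holomorphic_on \<H>"
    using det_SL2[OF g]
    by (intro holomorphic_on_compose_gen) (auto intro: \<phi>_maps moebius_act_in_upper_half_plane)
  then show ?thesis by (simp add: o_def w_def[abs_def])
qed

lemma slash_eq: "slash g z = f (moebius_act g z) / (autfac g z ^ k * autfac (conj_matrix \<sigma> g) (w g z) ^ l)"
  by (simp add: twisted_slash_def w_def)

lemma autfac_w_nonzero: "z \<in> \<H> \<Longrightarrow> autfac (conj_matrix \<sigma> g) (w g z) \<noteq> 0"
  using autfac_nonzero[OF det_conj_matrix[OF g] w_maps] .

lemma f_moebius_act: "z \<in> \<H> \<Longrightarrow>
    f (moebius_act g z) = slash g z * autfac g z ^ k * autfac (conj_matrix \<sigma> g) (w g z) ^ l"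
  unfolding slash_eq using autfac_w_nonzero autfac_nonzero[OF det_SL2[OF g]] by simp

lemma slash_holomorphic: "slash g holomorphic_on \<H>"
proof -
  have "(\<lambda>z. autfac (conj_matrix \<sigma> g) (w g z)) holomorphic_on \<H>"
    unfolding autfac_def by (intro holomorphic_intros w_holomorphic)
  then have "(\<lambda>z. f (moebius_act g z) / (autfac g z ^ k * autfac (conj_matrix \<sigma> g) (w g z) ^ l))
      holomorphic_on \<H>"
    using autfac_w_nonzero autfac_nonzero[OF det_SL2[OF g]]
      holomorphic_compose_moebius[OF det_SL2[OF g] f_holomorphic] autfac_holomorphic
    by (intro holomorphic_intros) auto
  then show ?thesis by (simp add: slash_eq[abs_def])
qed

end

context
  fixes g :: "real^2^2" and h :: real
  assumes gh: "cusp_pair g h"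
begin

lemma cusp_equivariance:
  obtains \<gamma> where "\<gamma> \<in> \<Gamma>" "\<gamma> ** g = g ** translation h"
    "conj_matrix \<sigma> \<gamma> ** conj_matrix \<sigma> g = conj_matrix \<sigma> g ** translation (\<sigma> h)"
    "\<And>z. z \<in> \<H> \<Longrightarrow> moebius_act g (z + of_real h) = moebius_act \<gamma> (moebius_act g z)"
proof -
  note c = cusp_pairD[OF gh]
  obtain \<gamma> where \<gamma>: "\<gamma> \<in> \<Gamma>" "\<gamma> ** g = g ** translation h" using gh by (auto simp: cusp_pair_def)
  have "conj_matrix \<sigma> \<gamma> ** conj_matrix \<sigma> g = conj_matrix \<sigma> g ** translation (\<sigma> h)"
    using conj_matrix_mult[OF \<Gamma>_SL2[OF \<gamma>(1)] c(1)] conj_matrix_mult[OF c(1) translation_in_SL2[OF c(4)]]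
    by (simp add: \<gamma>(2) conj_matrix_translation)
  moreover have "moebius_act g (z + of_real h) = moebius_act \<gamma> (moebius_act g z)"
    if "z \<in> \<H>" for z
    using moebius_act_mult[OF c(2) det_translation that, of h]
      moebius_act_mult[OF det_\<Gamma>[OF \<gamma>(1)] c(2) that] by (simp add: \<gamma>(2))
  ultimately show thesis using that \<gamma> by blast
qed

text \<open>Applying \<sigma> to \<gamma> g = g T, with T the translation by h, turns T into the
  translation by \<open>\<sigma> h\<close>. Equivariance of \<phi> then gives the increment of
  w.\<close>

lemma w_translation:
  assumes z: "z \<in> \<H>"
  shows "w g (z + of_real h) = w g z + of_real (\<sigma> h)"
proof -
  note c = cusp_pairD[OF gh]
  obtain \<gamma> where \<gamma>: "\<gamma> \<in> \<Gamma>" "conj_matrix \<sigma> \<gamma> ** conj_matrix \<sigma> g = conj_matrix \<sigma> g ** translation (\<sigma> h)"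
    "moebius_act g (z + of_real h) = moebius_act \<gamma> (moebius_act g z)"
    using cusp_equivariance z by metis
  let ?s = "conj_matrix \<sigma> g"
  note d = det_conj_matrix[OF c(1)] det_conj_matrix[OF \<Gamma>_SL2[OF \<gamma>(1)]]
  have wz: "w g z \<in> \<H>" using w_maps[OF c(1) z] .
  have gz: "moebius_act g z \<in> \<H>" by (rule moebius_act_in_upper_half_plane[OF c(2) z])
  have "\<phi> (moebius_act g (z + of_real h)) = moebius_act (conj_matrix \<sigma> \<gamma>) (\<phi> (moebius_act g z))"
    unfolding \<gamma>(3) by (rule \<phi>_equivariant[OF \<gamma>(1) gz])
  also have "\<dots> = moebius_act (conj_matrix \<sigma> \<gamma>) (moebius_act ?s (w g z))"
    by (simp only: moebius_act_w[OF c(1) z])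
  also have "\<dots> = moebius_act ?s (moebius_act (translation (\<sigma> h)) (w g z))"
    using moebius_act_mult[OF d(2,1) wz] moebius_act_mult[OF d(1) det_translation wz, of "\<sigma> h"]
    by (simp add: \<gamma>(2))
  finally have "w g (z + of_real h) =
      moebius_act (matrix_inv ?s) (moebius_act ?s (moebius_act (translation (\<sigma> h)) (w g z)))"
    by (simp only: w_def)
  also have "\<dots> = moebius_act (translation (\<sigma> h)) (w g z)"
    by (rule moebius_act_inv(2)[OF d(1)]) (rule moebius_act_in_upper_half_plane[OF det_translation wz])
  finally show ?thesis by simp
qed

text \<open>By the cocycle rule, and since translations have automorphy factor 1, the denominator
  acquires exactly the factors by which f changes under \<gamma>.\<close>

lemma slash_translation:
  assumes z: "z \<in> \<H>"
  shows "slash g (z + of_real h) = slash g z"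
proof -
  note c = cusp_pairD[OF gh]
  obtain \<gamma> where \<gamma>: "\<gamma> \<in> \<Gamma>" "\<gamma> ** g = g ** translation h"
    "conj_matrix \<sigma> \<gamma> ** conj_matrix \<sigma> g = conj_matrix \<sigma> g ** translation (\<sigma> h)"
    "moebius_act g (z + of_real h) = moebius_act \<gamma> (moebius_act g z)"
    using cusp_equivariance z by metis
  let ?s = "conj_matrix \<sigma> g"
  have wz: "w g z \<in> \<H>" using w_maps[OF c(1) z] .
  have gz: "moebius_act g z \<in> \<H>" by (rule moebius_act_in_upper_half_plane[OF c(2) z])
  have aT: "autfac (translation x) v = 1" for x v by (simp add: autfac_def)
  have 1: "autfac g (z + of_real h) = autfac \<gamma> (moebius_act g z) * autfac g z"
    using autfac_mult[OF c(2) z, of \<gamma>] autfac_mult[OF det_translation z, of g h] by (simp add: \<gamma>(2) aT)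
  have 2: "autfac ?s (w g (z + of_real h)) = autfac (conj_matrix \<sigma> \<gamma>) (\<phi> (moebius_act g z)) * autfac ?s (w g z)"
    using autfac_mult[OF det_conj_matrix[OF c(1)] wz, of "conj_matrix \<sigma> \<gamma>"]
      autfac_mult[OF det_translation wz, of ?s "\<sigma> h"]
    by (simp add: \<gamma>(3) aT w_translation[OF z] moebius_act_w[OF c(1) z])
  have n: "autfac \<gamma> (moebius_act g z) \<noteq> 0" "autfac (conj_matrix \<sigma> \<gamma>) (\<phi> (moebius_act g z)) \<noteq> 0"
    using autfac_nonzero[OF det_\<Gamma>[OF \<gamma>(1)] gz]
      autfac_nonzero[OF det_conj_matrix[OF \<Gamma>_SL2[OF \<gamma>(1)]] \<phi>_maps[OF gz]] by auto
  show ?thesis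
    unfolding slash_eq[OF c(1)] 1 2 \<gamma>(4) f_equivariant[OF \<gamma>(1) gz] power_mult_distrib using n by simp
qed

lemma slash_in_Per: "mero_of (slash g) \<in> Per h"
proof -
  note c = cusp_pairD[OF gh]
  obtain M where "M > 0" "bounded (slash g ` {z. Im z > M})"
    using f c(1) cusp_pair_cusp[OF gh] unfolding twisted_modular_form_def by blast
  then show ?thesis
    using c(3) slash_holomorphic[OF c(1)] slash_translation by (intro mero_of_in_Per_bounded)
qed

lemma w_polynomial_growth: "polynomial_growth h (w g)"
  unfolding polynomial_growth_def
  using self_map_in_Pol[OF cusp_pairD(3)[OF gh] w_holomorphic w_maps w_translation] cusp_pairD(1)[OF gh]
    w_holomorphic by blast

lemma slash_polynomial_growth: "polynomial_growth h (slash g)"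
  unfolding polynomial_growth_def
  using slash_in_Per slash_holomorphic[OF cusp_pairD(1)[OF gh]] by (blast intro: Pol.Per)

end

definition F :: "nat \<times> nat \<Rightarrow> complex \<Rightarrow> complex" where
  "F = (\<lambda>(i, j) z. f z * z ^ i * \<phi> z ^ j)"

lemma F_holomorphic: "F s holomorphic_on \<H>"
  by (cases s) (auto simp: F_def intro!: holomorphic_intros f_holomorphic \<phi>_holomorphic)

text \<open>The substitution of g produces the powers k and l of the automorphy factors. They turn
  the powers of the two Moebius maps into products of linear forms in z and in \<open>w g\<close>,
  both of which are polynomial in z over the q-expansions.\<close>

lemma F_cusp_polynomial_growth:
  assumes gh: "cusp_pair g h" and s: "s \<in> {..k} \<times> {..l}"
  shows "mcomp g (mero_of (F s)) \<in> Pol h"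
proof -
  note c = cusp_pairD[OF gh]
  obtain i j where ij: "s = (i, j)" "i \<le> k" "j \<le> l" using s by auto
  let ?s = "conj_matrix \<sigma> g"
  define G where "G z = slash g z *
    ((of_real (g $ 1 $ 1) * z + of_real (g $ 1 $ 2)) ^ i * (of_real (g $ 2 $ 1) * z + of_real (g $ 2 $ 2)) ^ (k - i) *
    ((of_real (?s $ 1 $ 1) * w g z + of_real (?s $ 1 $ 2)) ^ j * (of_real (?s $ 2 $ 1) * w g z + of_real (?s $ 2 $ 2)) ^ (l - j)))" for z
  have "polynomial_growth h G"
    unfolding G_def
    by (intro polynomial_growth_mult polynomial_growth_power polynomial_growth_affine
        polynomial_growth_id w_polynomial_growth slash_polynomial_growth gh)
  moreover have "F s (moebius_act g z) = G z" if z: "z \<in> \<H>" for z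
  proof -
    have "F s (moebius_act g z) = slash g z * (autfac g z ^ k * moebius_act g z ^ i) *
        (autfac ?s (w g z) ^ l * moebius_act ?s (w g z) ^ j)"
      using f_moebius_act[OF c(1) z] by (simp add: F_def ij(1) moebius_act_w[OF c(1) z])
    also have "\<dots> = G z"
      unfolding moebius_act_def G_def
      using autfac_nonzero[OF c(2) z] autfac_w_nonzero[OF c(1) z] ij(2,3)
      by (simp add: power_split_divide) (simp add: autfac_def)
    finally show ?thesis .
  qed
  then have "mero_of (\<lambda>z. F s (moebius_act g z)) = mero_of G"
    using holomorphic_compose_moebius[OF c(2) F_holomorphic]
    by (intro mero_of_cong holomorphic_imp_mero) auto
  ultimately show ?thesis
    using mcomp_mero_of[OF c(2) F_holomorphic] by (simp add: polynomial_growth_def)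
qed

text \<open>The action is the tensor product of symmetric powers of \<gamma> and its conjugate. Its
  matrix entries are products of coefficients of (a x + b)^i (c x + d)^(k-i), which has degree at
  most k, and of the conjugate polynomial of degree at most l.\<close>

lemma F_equivariance:
  assumes \<gamma>: "\<gamma> \<in> \<Gamma>" and s: "s \<in> {..k} \<times> {..l}"
  shows "\<exists>c. mcomp \<gamma> (mero_of (F s)) = (\<Sum>s'\<in>{..k} \<times> {..l}. mconst (c s') * mero_of (F s'))"
proof -
  obtain i j where ij: "s = (i, j)" "i \<le> k" "j \<le> l" using s by auto
  let ?s = "conj_matrix \<sigma> \<gamma>"
  define P where "P = [:complex_of_real (\<gamma> $ 1 $ 2), of_real (\<gamma> $ 1 $ 1):] ^ i * [:of_real (\<gamma> $ 2 $ 2), of_real (\<gamma> $ 2 $ 1):] ^ (k - i)"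
  define Q where "Q = [:complex_of_real (?s $ 1 $ 2), of_real (?s $ 1 $ 1):] ^ j * [:of_real (?s $ 2 $ 2), of_real (?s $ 2 $ 1):] ^ (l - j)"
  have dPQ: "degree P \<le> k" "degree Q \<le> l"
    unfolding P_def Q_def using ij by (intro degree_linear_powers_le; simp)+
  have d: "det \<gamma> = 1" "det ?s = 1" using det_\<Gamma>[OF \<gamma>] det_conj_matrix[OF \<Gamma>_SL2[OF \<gamma>]] by auto
  define c where "c = (\<lambda>(i, j). coeff P i * coeff Q j)"
  have eq: "F s (moebius_act \<gamma> z) = (\<Sum>s'\<in>{..k} \<times> {..l}. c s' * F s' z)" if z: "z \<in> \<H>" for z
  proof -
    have "F s (moebius_act \<gamma> z) = f z * (autfac \<gamma> z ^ k * moebius_act \<gamma> z ^ i) *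
        (autfac ?s (\<phi> z) ^ l * moebius_act ?s (\<phi> z) ^ j)"
      using f_equivariant[OF \<gamma> z] \<phi>_equivariant[OF \<gamma> z] by (simp add: F_def ij(1))
    also have "\<dots> = f z * poly P z * poly Q (\<phi> z)"
      unfolding moebius_act_def P_def Q_def
      using autfac_nonzero[OF d(1) z] autfac_nonzero[OF d(2) \<phi>_maps[OF z]] ij(2,3)
      by (simp add: power_split_divide) (simp add: autfac_def algebra_simps)
    also have "\<dots> = (\<Sum>s'\<in>{..k} \<times> {..l}. c s' * F s' z)"
      unfolding poly_eq_sum_atMost[OF dPQ(1)] poly_eq_sum_atMost[OF dPQ(2)] mult.assoc sum_product
      by (simp add: sum.cartesian_product c_def F_def sum_distrib_left split_def mult_ac)
    finally show ?thesis .
  qed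
  have sum: "mero_of (\<lambda>z. \<Sum>s'\<in>A. c s' * F s' z) = (\<Sum>s'\<in>A. mconst (c s') * mero_of (F s'))" if "finite A" for A
    using that
  proof (induction A rule: finite_induct)
    case empty
    then show ?case by (simp flip: mconst_eq_mero_of)
  next
    case (insert x A)
    have "(\<lambda>z. \<Sum>s'\<in>A. c s' * F s' z) holomorphic_on \<H>"
      by (intro holomorphic_intros F_holomorphic)
    with insert show ?case
      by (simp add: mero_of_mult_holomorphic(2) mero_of_mult_holomorphic(1)[OF holomorphic_on_const F_holomorphic]
          holomorphic_intros F_holomorphic mconst_eq_mero_of)
  qed
  have "mero_of (\<lambda>z. F s (moebius_act \<gamma> z)) = mero_of (\<lambda>z. \<Sum>s'\<in>{..k} \<times> {..l}. c s' * F s' z)"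
    using eq holomorphic_compose_moebius[OF d(1) F_holomorphic]
    by (intro mero_of_cong holomorphic_imp_mero) auto
  then show ?thesis
    unfolding mcomp_mero_of[OF d(1) F_holomorphic] using sum[of "{..k} \<times> {..l}"] by auto
qed

end

lemma meromorphic_at_0_bound:
  assumes "F meromorphic_on {0}"
  obtains C N where "\<forall>\<^sub>F q in at 0. norm (F q) \<le> C / norm q ^ N"
proof -
  obtain Fl where Fl: "F has_laurent_expansion Fl"
    using assms by (auto simp: meromorphic_on_def)
  define N where "N = nat (- fls_subdegree Fl)"
  have "(\<lambda>q. q ^ N * F q) has_laurent_expansion fls_X ^ N * Fl"
    by (intro laurent_expansion_intros Fl)
  moreover have "fls_subdegree (fls_X ^ N * Fl) \<ge> 0"
    by (cases "Fl = 0") (auto simp: N_def fls_subdegree_pow)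
  ultimately have "((\<lambda>q. q ^ N * F q) \<longlongrightarrow> fls_nth (fls_X ^ N * Fl) 0) (at 0)"
    by (rule has_laurent_expansion_imp_tendsto_0)
  then have "\<forall>\<^sub>F q in at 0. norm (q ^ N * F q) < norm (fls_nth (fls_X ^ N * Fl) 0) + 1"
    using order_tendstoD(2)[OF tendsto_norm] by (metis less_add_one)
  moreover have "\<forall>\<^sub>F q in at (0 :: complex). q \<noteq> 0" by (simp add: eventually_at_filter)
  ultimately have "\<forall>\<^sub>F q in at 0. norm (F q) \<le> (norm (fls_nth (fls_X ^ N * Fl) 0) + 1) / norm q ^ N"
    by eventually_elim (simp add: norm_mult norm_power pos_le_divide_eq mult.commute)
  then show thesis using that by blast
qed

section \<open>Differentiation with respect to t and the invariant relation\<close>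

context twisted_form
begin

definition T :: mero where "T = mero_of t"

lemma t_nicely_meromorphic: "t nicely_meromorphic_on \<H>"
  and t_invariant: "\<gamma> \<in> \<Gamma> \<Longrightarrow> z \<in> \<H> \<Longrightarrow> t (moebius_act \<gamma> z) = t z"
  using t by (auto simp: modular_function_def)

lemma t_meromorphic: "t meromorphic_on \<H>"
  using t_nicely_meromorphic by (simp add: nicely_meromorphic_on_def)

lemma mval_T: "z \<in> \<H> \<Longrightarrow> mval T z = t z"
  unfolding T_def by (rule mval_mero_of[OF t_nicely_meromorphic])

lemma T_invariant:
  assumes "\<gamma> \<in> \<Gamma>"
  shows "mcomp \<gamma> T = T"
proof -
  have "mcomp \<gamma> T = mero_of (\<lambda>z. t (moebius_act \<gamma> z))"
    unfolding T_def by (rule mero_of_ops(6)[OF t_meromorphic t_meromorphic det_\<Gamma>[OF assms]])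
  also have "\<dots> = T"
    unfolding T_def using t_invariant[OF assms] by (intro mero_of_cong[symmetric] t_meromorphic) auto
  finally show ?thesis .
qed

lemma mcomp_cusp_invariant:
  assumes gh: "cusp_pair g h" and a: "\<And>\<gamma>. \<gamma> \<in> \<Gamma> \<Longrightarrow> mcomp \<gamma> a = a"
  shows "mcomp (translation h) (mcomp g a) = mcomp g a"
proof -
  note c = cusp_pairD[OF gh]
  obtain \<gamma> where \<gamma>: "\<gamma> \<in> \<Gamma>" "\<gamma> ** g = g ** translation h" using gh by (auto simp: cusp_pair_def)
  have "mcomp (translation h) (mcomp g a) = mcomp (\<gamma> ** g) a"
    using c by (simp add: mcomp_mcomp \<gamma>(2))
  also have "\<dots> = mcomp g (mcomp \<gamma> a)" using c det_\<Gamma>[OF \<gamma>(1)] by (simp add: mcomp_mcomp)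
  finally show ?thesis using a[OF \<gamma>(1)] by simp
qed

text \<open>The period h' supplied with the expansion of t need not be the h of the cusp pair. Only
  the growth bound is taken from that expansion; the period h comes from invariance under \<Gamma>,
  and the growth criterion joins the two.\<close>

lemma T_in_Per:
  assumes gh: "cusp_pair g h"
  shows "mcomp g T \<in> Per h"
proof -
  note c = cusp_pairD[OF gh]
  have "g \<in> carrier (SL2 UNIV)" using c(1) by (simp add: SL2_carrier)
  then obtain h' F M where h': "h' > 0" and F: "F meromorphic_on {0}"
    and tF: "\<And>z. Im z > M \<Longrightarrow> t (moebius_act g z) = F (qexp h' z)"
    using t cusp_pair_cusp[OF gh] unfolding modular_function_def qexp_def by blast
  obtain C N where CN: "\<forall>\<^sub>F q in at 0. norm (F q) \<le> C / norm q ^ N"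
    using meromorphic_at_0_bound[OF F] by blast
  have "\<forall>\<^sub>F q in at 0. F analytic_on {q}"
    using F by (rule meromorphic_on_eventually_analytic) simp
  with CN have ev: "\<forall>\<^sub>F q in at 0. norm (F q) \<le> C / norm q ^ N \<and> F analytic_on {q}"
    by eventually_elim simp
  obtain M' where "M' \<ge> 0" "\<And>z. Im z > M' \<Longrightarrow>
      norm (F (qexp h' z)) \<le> C / norm (qexp h' z) ^ N \<and> F analytic_on {qexp h' z}"
    by (rule eventually_qexp[OF h' ev]) (rule that, assumption)
  then have M': "M' \<ge> 0" "\<And>z. Im z > M' \<Longrightarrow> norm (F (qexp h' z)) \<le> C / norm (qexp h' z) ^ N"
    "\<And>z. Im z > M' \<Longrightarrow> F analytic_on {qexp h' z}"
    by auto
  define M0 where "M0 = max M M'"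
  have an: "mval (mcomp g T) analytic_on {z}" and v: "mval (mcomp g T) z = F (qexp h' z)"
    if z: "Im z > M0" for z
  proof -
    have zH: "z \<in> \<H>" using z M' by (simp add: upper_half_plane_def M0_def)
    have a: "(\<lambda>w. F (qexp h' w)) analytic_on {z}"
      using analytic_on_compose_gen[OF qexp_analytic[of h' "{z}"], of F "{qexp h' z}"] M'(3)[of z] z
      by (simp add: o_def M0_def)
    have "\<forall>\<^sub>F w in at z. w \<in> {z. Im z > M0}"
      using z open_halfspace_Im_gt by (intro eventually_at_in_open') auto
    then have "\<forall>\<^sub>F w in at z. mval (mcomp g T) w = F (qexp h' w)"
      using eventually_mval_ops(6)[OF zH c(2), of T] eventually_in_upper_half_plane[OF zH]
    proof eventually_elim
      case (elim w)
      have "mval T (moebius_act g w) = t (moebius_act g w)"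
        by (rule mval_T[OF moebius_act_in_upper_half_plane[OF c(2) elim(3)]])
      then show ?case using elim(1,2) tF[of w] by (simp add: M0_def)
    qed
    then show "mval (mcomp g T) analytic_on {z}" "mval (mcomp g T) z = F (qexp h' z)"
      using mval_at_analytic[OF zH a] by auto
  qed
  show ?thesis
  proof (rule PerI_growth[OF c(3) mcomp_cusp_invariant[OF gh T_invariant]])
    show "M0 \<ge> 0" using M'(1) by (simp add: M0_def)
    show "mval (mcomp g T) holomorphic_on {z. M0 < Im z}"
      using an by (intro analytic_imp_holomorphic) (auto simp: analytic_on_analytic_at[of _ "{z. M0 < Im z}"])
    fix z assume z: "Im z > M0"
    have "norm (mval (mcomp g T) z) \<le> C / norm (qexp h' z) ^ N" unfolding v[OF z]
      using z by (intro M'(2)) (simp add: M0_def)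
    also have "\<dots> = C * exp (real N * (2 * pi / h') * Im z)"
    proof -
      have "norm (qexp h' z) ^ N = exp (- (real N * (2 * pi / h') * Im z))"
        unfolding norm_qexp by (simp flip: exp_of_nat_mult)
      then show ?thesis by (simp add: exp_minus divide_inverse)
    qed
    finally show "norm (mval (mcomp g T) z) \<le> C * exp (real N * (2 * pi / h') * Im z)" .
  qed
qed

definition D :: "mero \<Rightarrow> mero" where "D a = mderiv a / mderiv T"

lemma derivation_D: "derivation D"
  by (simp add: derivation_def D_def add_divide_distrib)

lemma D_mconst: "D (mconst c) = 0"
  by (simp add: D_def)

text \<open>Numerator and denominator both acquire the derivative of g, which cancels:
  differentiation by t does not depend on the coordinate. So D commutes with \<Gamma>, which fixes
  T.\<close>

lemma mcomp_D:
  assumes "det g = 1"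
  shows "mcomp g (D a) = mderiv (mcomp g a) / mderiv (mcomp g T)"
  unfolding D_def mderiv_mcomp[OF assms, of a] mderiv_mcomp[OF assms, of T]
  using mderiv_mcomp_mid_nonzero[OF assms] by simp

lemma mcomp_D_\<Gamma>: "\<gamma> \<in> \<Gamma> \<Longrightarrow> mcomp \<gamma> (D a) = D (mcomp \<gamma> a)"
  using mcomp_D[OF det_\<Gamma>, of \<gamma> a] T_invariant[of \<gamma>] by (simp add: D_def)

text \<open>The ring in which the elimination takes place: it contains the functions
  \<open>F s\<close> and is stable under D and \<Gamma>. Closure under division is not asserted,
  hence the fraction-free elimination.\<close>

definition polynomial_at_cusps :: "mero set" where
  "polynomial_at_cusps = {a. \<forall>g h. cusp_pair g h \<longrightarrow> mcomp g a \<in> Pol h}"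

definition modular_field :: "mero set" where
  "modular_field = {a. (\<forall>\<gamma>\<in>\<Gamma>. mcomp \<gamma> a = a) \<and> (\<forall>g h. cusp_pair g h \<longrightarrow> mcomp g a \<in> Per h)}"

lemma subring_of_polynomial_at_cusps: "subring_of polynomial_at_cusps"
  unfolding subring_of_def polynomial_at_cusps_def
  by (auto intro: subring_ofD[OF subring_of_Pol])

lemma subring_of_modular_field: "subring_of modular_field"
  unfolding subring_of_def modular_field_def
  by (auto intro: subring_ofD[OF subring_of_Per])

lemma T_in_modular_field: "T \<in> modular_field"
  by (auto simp: modular_field_def T_invariant T_in_Per)

text \<open>Dividing by the derivative of T does not leave the ring, because at a cusp that
  derivative is a q-expansion and q-expansions are closed under division.\<close>

lemma D_polynomial_at_cusps:
  assumes "a \<in> polynomial_at_cusps"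
  shows "D a \<in> polynomial_at_cusps"
  unfolding polynomial_at_cusps_def
proof safe
  fix g h assume gh: "cusp_pair g h"
  note c = cusp_pairD[OF gh]
  have "mcomp g (D a) = mderiv (mcomp g a) * (1 / mderiv (mcomp g T))"
    by (simp add: mcomp_D[OF c(2)])
  moreover have "1 / mderiv (mcomp g T) \<in> Per h"
    using mconst_in_Per[of 1 h] Per_mderiv[OF T_in_Per[OF gh] c(3)] Per_divide by fastforce
  moreover have "mderiv (mcomp g a) \<in> Pol h"
    using assms gh c(3) by (auto simp: polynomial_at_cusps_def intro: Pol_mderiv)
  ultimately show "mcomp g (D a) \<in> Pol h" by (simp only: Pol.mult Pol.Per)
qed

lemma D_modular_field:
  assumes "a \<in> modular_field"
  shows "D a \<in> modular_field"
  unfolding modular_field_def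
proof safe
  fix \<gamma> assume "\<gamma> \<in> \<Gamma>"
  then show "mcomp \<gamma> (D a) = D a" using assms by (simp add: mcomp_D_\<Gamma> modular_field_def)
next
  fix g h assume gh: "cusp_pair g h"
  note c = cusp_pairD[OF gh]
  show "mcomp g (D a) \<in> Per h"
    unfolding mcomp_D[OF c(2)] using assms gh
    by (intro Per_divide Per_mderiv c(3) T_in_Per[OF gh]) (auto simp: modular_field_def)
qed

lemma mcomp_polynomial_at_cusps:
  assumes "a \<in> polynomial_at_cusps" "\<gamma> \<in> \<Gamma>"
  shows "mcomp \<gamma> a \<in> polynomial_at_cusps"
  unfolding polynomial_at_cusps_def
proof safe
  fix g h assume gh: "cusp_pair g h"
  have "mcomp g (mcomp \<gamma> a) = mcomp (\<gamma> ** g) a"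
    using cusp_pairD(2)[OF gh] det_\<Gamma>[OF assms(2)] by (simp add: mcomp_mcomp)
  then show "mcomp g (mcomp \<gamma> a) \<in> Pol h"
    using cusp_pair_mult[OF gh assms(2)] assms(1) by (simp add: polynomial_at_cusps_def)
qed

text \<open>Invariance makes b periodic at each cusp, and its presentation as a quotient of
  functions polynomial in z then makes it a q-expansion there.\<close>

lemma quotient_in_modular_field:
  assumes "p \<in> polynomial_at_cusps" "q \<in> polynomial_at_cusps" "q \<noteq> 0" "b = p / q"
    and inv: "\<And>\<gamma>. \<gamma> \<in> \<Gamma> \<Longrightarrow> mcomp \<gamma> b = b"
  shows "b \<in> modular_field"
  unfolding modular_field_def
proof safe
  fix g h assume gh: "cusp_pair g h"
  note c = cusp_pairD[OF gh]
  have "mcomp g q \<noteq> 0" using assms(3) mcomp_inj[OF c(2), of q 0] by auto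
  then show "mcomp g b \<in> Per h"
    using assms gh by (intro Per_quotient[OF c(3) mcomp_cusp_invariant[OF gh inv], of "mcomp g p" "mcomp g q"])
      (auto simp: polynomial_at_cusps_def)
qed (rule inv)

lemma modular_relation:
  obtains b where "b ((k + 1) * (l + 1)) = 1" "\<And>r. r \<le> (k + 1) * (l + 1) \<Longrightarrow> b r \<in> modular_field"
    "(\<Sum>r\<le>(k + 1) * (l + 1). b r * (D ^^ r) (mero_of f)) = 0"
proof -
  let ?I = "{..k} \<times> {..l}"
  have span: "\<exists>C. (\<forall>j\<in>?I. D (C j) = 0) \<and> mero_of (F s) = (\<Sum>j\<in>?I. C j * \<psi> (mero_of (F j)))"
    if \<psi>: "\<psi> \<in> mcomp ` \<Gamma>" and s: "s \<in> ?I" for \<psi> s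
  proof -
    obtain \<gamma> where \<gamma>: "\<gamma> \<in> \<Gamma>" "\<psi> = mcomp \<gamma>" using \<psi> by blast
    \<comment> \<open>The equivariance is used for the inverse matrix and moved back by \<gamma>,
      since \<open>F s\<close> is to be expressed through the images
      \<open>\<psi> (F j)\<close>.\<close>
    obtain c where c: "mcomp (matrix_inv \<gamma>) (mero_of (F s)) = (\<Sum>j\<in>?I. mconst (c j) * mero_of (F j))"
      using F_equivariance[OF \<Gamma>_inv[OF \<gamma>(1)] s] by blast
    have "mcomp \<gamma> (mcomp (matrix_inv \<gamma>) (mero_of (F s))) = mero_of (F s)"
      using det_\<Gamma>[OF \<gamma>(1)] by (simp add: mcomp_mcomp matrix_inv_det1)
    then have "mero_of (F s) = (\<Sum>j\<in>?I. mconst (c j) * mcomp \<gamma> (mero_of (F j)))"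
      unfolding c by simp
    then show ?thesis
      unfolding \<gamma>(2) by (intro exI[of _ "\<lambda>j. mconst (c j)"] conjI ballI D_mconst)
  qed
  have FS: "mero_of (F s) \<in> polynomial_at_cusps" if "s \<in> ?I" for s
    using F_cusp_polynomial_growth that by (simp add: polynomial_at_cusps_def)
  have inj: "x = 0" if "\<psi> \<in> mcomp ` \<Gamma>" "\<psi> x = 0" for \<psi> x
    using that mcomp_inj[OF det_\<Gamma>, of _ x 0] by auto
  show thesis
  proof (rule invariant_linear_relation[where G = "mcomp ` \<Gamma>" and I = ?I and D = D
        and F = "\<lambda>s. mero_of (F s)" and S = polynomial_at_cusps])
    show "derivation D" "subring_of polynomial_at_cusps" "finite ?I"
      by (simp_all add: derivation_D subring_of_polynomial_at_cusps)
    show "D x \<in> polynomial_at_cusps" if "x \<in> polynomial_at_cusps" for x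
      using D_polynomial_at_cusps[OF that] .
    show "mero_of (F s) \<in> polynomial_at_cusps" if "s \<in> ?I" for s using FS[OF that] .
    show "\<psi> x \<in> polynomial_at_cusps" if "\<psi> \<in> mcomp ` \<Gamma>" "x \<in> polynomial_at_cusps" for \<psi> x
      using that mcomp_polynomial_at_cusps by blast
    show "\<psi> (x + y) = \<psi> x + \<psi> y" "\<psi> (x * y) = \<psi> x * \<psi> y" "\<psi> (D x) = D (\<psi> x)"
      if "\<psi> \<in> mcomp ` \<Gamma>" for \<psi> x y
      using that mcomp_D_\<Gamma> by auto
    show "x = 0" if "\<psi> \<in> mcomp ` \<Gamma>" "\<psi> x = 0" for \<psi> x using inj[OF that] .
    show "\<exists>C. (\<forall>j\<in>?I. D (C j) = 0) \<and> mero_of (F s) = (\<Sum>j\<in>?I. C j * \<psi> (mero_of (F j)))"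
      if "\<psi> \<in> mcomp ` \<Gamma>" "s \<in> ?I" for \<psi> s
      using span[OF that] .
  next
    fix m b
    assume b: "m \<le> card ?I" "b m = 1"
      "\<And>s. s \<in> ?I \<Longrightarrow> (\<Sum>r\<le>m. b r * (D ^^ r) (mero_of (F s))) = 0"
      "\<And>r. r \<le> m \<Longrightarrow> \<exists>p\<in>polynomial_at_cusps. \<exists>q\<in>polynomial_at_cusps. q \<noteq> 0 \<and> b r = p / q"
      "\<And>\<psi> r. \<psi> \<in> mcomp ` \<Gamma> \<Longrightarrow> r \<le> m \<Longrightarrow> \<psi> (b r) = b r"
  have "b r \<in> modular_field" if r: "r \<le> m" for r
  proof -
    obtain p q where "p \<in> polynomial_at_cusps" "q \<in> polynomial_at_cusps" "q \<noteq> 0" "b r = p / q"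
      using b(4)[OF r] by blast
    then show ?thesis using b(5)[OF _ r] by (rule quotient_in_modular_field) simp
  qed
  then have "\<forall>r\<le>m. b r \<in> modular_field" by blast
  moreover have "F (0, 0) = f" by (simp add: F_def fun_eq_iff)
  then have "(\<Sum>r\<le>m. b r * (D ^^ r) (mero_of f)) = 0" using b(3)[of "(0, 0)"] by simp
  moreover have "m \<le> (k + 1) * (l + 1)" using b(1) by (simp add: card_cartesian_product)
  ultimately obtain b' where "b' ((k + 1) * (l + 1)) = 1" "\<forall>r\<le>(k + 1) * (l + 1). b' r \<in> modular_field"
    "(\<Sum>r\<le>(k + 1) * (l + 1). b' r * (D ^^ r) (mero_of f)) = 0"
    using linear_relation_raise_order[where b = b and m = m and D = D and S = modular_field
        and x = "mero_of f" and n = "(k + 1) * (l + 1)", OF derivation_D subring_of_modular_field D_modular_field b(2)]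
    by blast
  then show thesis using that by blast
  qed
qed

end

section \<open>Finite covers of the compactified quotient\<close>

text \<open>
  A chart is centred at a point of the half-plane (\<^term>\<open>Inl\<close>) or at the cusp \<open>g\<infinity>\<close>
  (\<^term>\<open>Inr\<close>); in the latter case its coordinate is \<open>q\<close> and its centre lies outside the half-plane.
\<close>

definition region :: "complex + ((real^2^2) \<times> real) \<Rightarrow> real \<Rightarrow> complex set" where
  "region i \<rho> = (case i of Inl p \<Rightarrow> ball p \<rho> \<inter> \<H>
     | Inr (g, h) \<Rightarrow> moebius_act g ` {u \<in> \<H>. norm (qexp h u) < \<rho>})"

definition coord :: "complex + ((real^2^2) \<times> real) \<Rightarrow> complex \<Rightarrow> complex" where
  "coord i z = (case i of Inl p \<Rightarrow> z - p | Inr (g, h) \<Rightarrow> qexp h (moebius_act (matrix_inv g) z))"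

lemma norm_qexp_less_iff:
  assumes "h > 0" "\<rho> > 0"
  shows "norm (qexp h z) < \<rho> \<longleftrightarrow> Im z > - h * ln \<rho> / (2 * pi)"
proof -
  have "norm (qexp h z) < \<rho> \<longleftrightarrow> - 2 * pi * Im z / h < ln \<rho>"
    unfolding norm_qexp using assms by (metis exp_less_cancel_iff exp_ln)
  also have "\<dots> \<longleftrightarrow> Im z > - h * ln \<rho> / (2 * pi)" using assms by (auto simp: field_simps)
  finally show ?thesis .
qed

lemma open_moebius_image:
  assumes g: "det g = 1" and S: "open S" "S \<subseteq> \<H>"
  shows "open (moebius_act g ` S)"
proof -
  have d: "det (matrix_inv g) = 1" using matrix_inv_det1(1)[OF g] .
  have "moebius_act g ` S = \<H> \<inter> moebius_act (matrix_inv g) -` S"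
  proof (intro equalityI subsetI)
    fix z assume "z \<in> moebius_act g ` S"
    then obtain u where u: "u \<in> S" "z = moebius_act g u" by blast
    then have "u \<in> \<H>" using S(2) by blast
    then show "z \<in> \<H> \<inter> moebius_act (matrix_inv g) -` S"
      using u moebius_act_in_upper_half_plane[OF g] moebius_act_inv(2)[OF g] by simp
  next
    fix z assume z: "z \<in> \<H> \<inter> moebius_act (matrix_inv g) -` S"
    then have "z = moebius_act g (moebius_act (matrix_inv g) z)" using moebius_act_inv(1)[OF g] by simp
    then show "z \<in> moebius_act g ` S" using z by blast
  qed
  moreover have "continuous_on \<H> (moebius_act (matrix_inv g))"
    using moebius_act_analytic[OF d] analytic_imp_holomorphic holomorphic_on_imp_continuous_on by blast
  ultimately show ?thesis using continuous_open_preimage[OF _ open_upper_half_plane S(1)] by simp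
qed

lemma open_region:
  assumes "\<And>g h. i = Inr (g, h) \<Longrightarrow> det g = 1"
  shows "open (region i \<rho>)"
proof (cases i)
  case (Inl p)
  then show ?thesis using open_upper_half_plane by (auto simp: region_def)
next
  case (Inr gh)
  obtain g h where gh: "gh = (g, h)" by (cases gh)
  have "continuous_on UNIV (\<lambda>u. norm (qexp h u))"
    using analytic_imp_holomorphic[OF qexp_analytic[of h UNIV]] holomorphic_on_imp_continuous_on
    by (intro continuous_on_norm) blast
  then have "open {u. norm (qexp h u) < \<rho>}"
    by (intro open_Collect_less) auto
  then have "open {u \<in> \<H>. norm (qexp h u) < \<rho>}"
    using open_upper_half_plane open_Int[of \<H>] by (simp add: Collect_conj_eq)
  then have "open (moebius_act g ` {u \<in> \<H>. norm (qexp h u) < \<rho>})"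
    using assms Inr gh by (intro open_moebius_image) auto
  then show ?thesis by (simp add: region_def Inr gh)
qed

lemma region_subset:
  assumes "\<And>g h. i = Inr (g, h) \<Longrightarrow> det g = 1"
  shows "region i \<rho> \<subseteq> \<H>"
  using assms moebius_act_in_upper_half_plane by (auto simp: region_def split: sum.splits)

lemma moebius_sphere_Some:
  assumes "det g = 1" "z \<in> \<H>"
  shows "moebius_sphere g (Some z) = Some (moebius_act g z)"
  using autfac_nonzero[OF assms] by (simp add: moebius_sphere_def)

lemma moebius_sphere_None_not_upper:
  assumes "z \<in> \<H>"
  shows "moebius_sphere g None \<noteq> Some z"
  using assms by (auto simp: moebius_sphere_def upper_half_plane_def split: if_splits)

lemma moebius_sphere_mult_None:
  assumes "det A = 1" "det B = 1"
  shows "moebius_sphere (A ** B) None = moebius_sphere A (moebius_sphere B None)"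
proof (cases "B $ 2 $ 1 = 0")
  case True
  then have "B $ 1 $ 1 \<noteq> 0" using assms(2) by (auto simp: det_2)
  then show ?thesis using True by (simp add: moebius_sphere_def)
next
  case False
  define x where "x = B $ 1 $ 1 / B $ 2 $ 1"
  have x: "B $ 1 $ 1 = x * B $ 2 $ 1" using False by (simp add: x_def)
  have au: "autfac A (of_real x) = of_real (A $ 2 $ 1 * x + A $ 2 $ 2)" by (simp add: autfac_def)
  have "(A ** B) $ 2 $ 1 = (A $ 2 $ 1 * x + A $ 2 $ 2) * B $ 2 $ 1"
    "(A ** B) $ 1 $ 1 = (A $ 1 $ 1 * x + A $ 1 $ 2) * B $ 2 $ 1" by (simp_all add: x algebra_simps)
  then have "moebius_sphere (A ** B) None = (if A $ 2 $ 1 * x + A $ 2 $ 2 = 0 then None else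
      Some (of_real ((A $ 1 $ 1 * x + A $ 1 $ 2) / (A $ 2 $ 1 * x + A $ 2 $ 2))))"
    using False by (simp add: moebius_sphere_def)
  also have "\<dots> = moebius_sphere A (Some (of_real x))"
    unfolding moebius_sphere_def moebius_act_def au option.case of_real_eq_0_iff
    by (simp only: of_real_divide of_real_add of_real_mult)
  also have "Some (of_real x) = moebius_sphere B None"
    using False by (simp add: moebius_sphere_def x_def)
  finally show ?thesis .
qed

text \<open>Two representatives of a cusp differ by a stabiliser of \<open>\<infinity>\<close>, which scales imaginary parts.\<close>

lemma same_cusp_scaling:
  assumes g: "det g = 1" and g': "det g' = 1" and eq: "moebius_sphere g' None = moebius_sphere g None"
  obtains c where "c > 0" "\<And>z. z \<in> \<H> \<Longrightarrow>
    \<exists>u\<in>\<H>. Im u = c * Im z \<and> moebius_act g' z = moebius_act g u"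
proof -
  define A where "A = matrix_inv g ** g'"
  have dA: "det A = 1" using matrix_inv_det1(1)[OF g] g' by (simp add: A_def det_mul)
  have gA: "g' = g ** A"
    using matrix_inv_det1(3)[OF g] by (simp add: A_def matrix_mul_assoc)
  have "g $ 1 $ 1 * g' $ 2 $ 1 = g $ 2 $ 1 * g' $ 1 $ 1"
    using eq by (auto simp: moebius_sphere_def field_simps split: if_splits
        simp flip: of_real_mult of_real_divide)
  then have A21: "A $ 2 $ 1 = 0" by (simp add: A_def matrix_inv_2[OF g])
  then have A22: "A $ 2 $ 2 \<noteq> 0" using dA by (auto simp: det_2)
  show thesis
  proof (rule that[of "1 / (A $ 2 $ 2)\<^sup>2"])
    show "1 / (A $ 2 $ 2)\<^sup>2 > 0" using A22 by simp
    fix z assume z: "z \<in> \<H>"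
    have "Im (moebius_act A z) = 1 / (A $ 2 $ 2)\<^sup>2 * Im z"
      unfolding Im_moebius_act[OF dA] using A21 by (simp add: autfac_def)
    moreover have "moebius_act g' z = moebius_act g (moebius_act A z)"
      unfolding gA by (rule moebius_act_mult[OF g dA z])
    ultimately show "\<exists>u\<in>\<H>. Im u = 1 / (A $ 2 $ 2)\<^sup>2 * Im z \<and> moebius_act g' z = moebius_act g u"
      using moebius_act_in_upper_half_plane[OF dA z] by blast
  qed
qed

section \<open>Saturated charts on the extended half-plane\<close>

context quadratic_group
begin

definition charts :: "(complex + ((real^2^2) \<times> real)) set" where
  "charts = Inl ` \<H> \<union> Inr ` {(g, h). cusp_pair g h}"

lemma charts_det: "i \<in> charts \<Longrightarrow> i = Inr (g, h) \<Longrightarrow> det g = 1"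
  by (auto simp: charts_def dest: cusp_pairD(2))

text \<open>The \<Gamma>-saturation of a chart in the extended half-plane. Regions lie in \<H>, so
  the orbit of a cusp at the centre has to be added separately.\<close>

definition translates :: "complex + ((real^2^2) \<times> real) \<Rightarrow> real \<Rightarrow> complex option set" where
  "translates i \<rho> = {Some (moebius_act \<gamma> z) | \<gamma> z. \<gamma> \<in> \<Gamma> \<and> z \<in> region i \<rho>} \<union>
     (case i of Inl p \<Rightarrow> {} | Inr (g, h) \<Rightarrow> {moebius_sphere (\<gamma> ** g) None | \<gamma>. \<gamma> \<in> \<Gamma>})"

lemma translates_upper:
  assumes i: "i \<in> charts"
  shows "{z \<in> \<H>. Some z \<in> translates i \<rho>} = (\<Union>\<gamma>\<in>\<Gamma>. moebius_act \<gamma> ` region i \<rho>)"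
proof (intro equalityI subsetI)
  fix z assume z: "z \<in> {z \<in> \<H>. Some z \<in> translates i \<rho>}"
  then have "Some z \<notin> (case i of Inl p \<Rightarrow> {} | Inr (g, h) \<Rightarrow> {moebius_sphere (\<gamma> ** g) None | \<gamma>. \<gamma> \<in> \<Gamma>})"
    using moebius_sphere_None_not_upper[of z] by (auto split: sum.splits dest!: sym[of "Some z"])
  then show "z \<in> (\<Union>\<gamma>\<in>\<Gamma>. moebius_act \<gamma> ` region i \<rho>)" using z by (auto simp: translates_def)
next
  fix z assume "z \<in> (\<Union>\<gamma>\<in>\<Gamma>. moebius_act \<gamma> ` region i \<rho>)"
  then obtain \<gamma> x where x: "\<gamma> \<in> \<Gamma>" "x \<in> region i \<rho>" "z = moebius_act \<gamma> x" by blast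
  then have "z \<in> \<H>"
    using region_subset[of i \<rho>] charts_det[OF i] moebius_act_in_upper_half_plane[OF det_\<Gamma>] by blast
  then show "z \<in> {z \<in> \<H>. Some z \<in> translates i \<rho>}"
    using x by (auto simp: translates_def)
qed

lemma translates_subset:
  assumes i: "i \<in> charts"
  shows "translates i \<rho> \<subseteq> Some ` \<H> \<union> cusps \<Gamma>"
proof
  fix p assume "p \<in> translates i \<rho>"
  then consider \<gamma> z where "p = Some (moebius_act \<gamma> z)" "\<gamma> \<in> \<Gamma>" "z \<in> region i \<rho>"
    | g h \<gamma> where "i = Inr (g, h)" "p = moebius_sphere (\<gamma> ** g) None" "\<gamma> \<in> \<Gamma>"
    by (auto simp: translates_def split: sum.splits)
  then show "p \<in> Some ` \<H> \<union> cusps \<Gamma>"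
  proof cases
    case 1
    then have "moebius_act \<gamma> z \<in> \<H>"
      using region_subset[of i \<rho>] charts_det[OF i] moebius_act_in_upper_half_plane[OF det_\<Gamma>] by blast
    then show ?thesis using 1 by blast
  next
    case 2
    then have "cusp_pair (\<gamma> ** g) h" using i cusp_pair_mult by (auto simp: charts_def)
    then show ?thesis using cusp_pair_cusp 2 by blast
  qed
qed

text \<open>The horoball condition concerns every real matrix g' that represents the cusp, whereas
  the chart uses one g over K. The two differ by a scaling of imaginary parts, which only changes
  the height of the horoball.\<close>

lemma ext_open_translates:
  assumes i: "i \<in> charts" and \<rho>: "\<rho> > 0"
  shows "ext_half_plane_open \<Gamma> (translates i \<rho>)"
  unfolding ext_half_plane_open_def
proof (intro conjI ballI impI)
  show "translates i \<rho> \<subseteq> Some ` \<H> \<union> cusps \<Gamma>" by (rule translates_subset[OF i])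
  show "open {z \<in> \<H>. Some z \<in> translates i \<rho>}"
    unfolding translates_upper[OF i]
  proof (intro open_UN ballI)
    fix \<gamma> assume "\<gamma> \<in> \<Gamma>"
    then show "open (moebius_act \<gamma> ` region i \<rho>)"
      using open_moebius_image[OF det_\<Gamma> open_region region_subset] charts_det[OF i] by metis
  qed
next
  fix g' assume g': "g' \<in> carrier (SL2 UNIV)" "moebius_sphere g' None \<in> translates i \<rho> \<inter> cusps \<Gamma>"
  have "moebius_sphere g' None \<notin> Some ` \<H>"
    using moebius_sphere_None_not_upper by fastforce
  then have "moebius_sphere g' None \<notin> {Some (moebius_act \<gamma> z) | \<gamma> z. \<gamma> \<in> \<Gamma> \<and> z \<in> region i \<rho>}"
    using region_subset[of i \<rho>] charts_det[OF i] moebius_act_in_upper_half_plane[OF det_\<Gamma>] by blast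
  then obtain g h \<gamma> where i_eq: "i = Inr (g, h)" and eq: "moebius_sphere g' None = moebius_sphere (\<gamma> ** g) None"
    and \<gamma>: "\<gamma> \<in> \<Gamma>"
    using g'(2) by (auto simp: translates_def split: sum.splits)
  have gh: "cusp_pair g h" using i i_eq by (auto simp: charts_def)
  note c = cusp_pairD[OF gh]
  have d: "det (\<gamma> ** g) = 1" using c(2) det_\<Gamma>[OF \<gamma>] by (simp add: det_mul)
  have d': "det g' = 1" using g'(1) by (simp add: SL2_carrier)
  obtain s where s: "s > 0" "\<And>z. z \<in> \<H> \<Longrightarrow>
    \<exists>u\<in>\<H>. Im u = s * Im z \<and> moebius_act g' z = moebius_act (\<gamma> ** g) u"
    using same_cusp_scaling[OF d d' eq] by blast
  \<comment> \<open>The height at which |q| falls below \<rho>, divided by the scaling factor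
    s.\<close>
  define M where "M = max 1 (- h * ln \<rho> / (2 * pi) / s)"
  show "\<exists>M>0. \<forall>z. Im z > M \<longrightarrow> Some (moebius_act g' z) \<in> translates i \<rho>"
  proof (intro exI[of _ M] conjI allI impI)
    show "M > 0" by (simp add: M_def)
    fix z assume z: "Im z > M"
    then have "z \<in> \<H>" by (simp add: M_def upper_half_plane_def)
    then obtain u where u: "u \<in> \<H>" "Im u = s * Im z" "moebius_act g' z = moebius_act (\<gamma> ** g) u"
      using s(2) by blast
    have "Im u > - h * ln \<rho> / (2 * pi)" using z s(1) u(2) by (simp add: M_def field_simps)
    then have "norm (qexp h u) < \<rho>" unfolding norm_qexp_less_iff[OF c(3) \<rho>] .
    then have "moebius_act g u \<in> region i \<rho>" using u(1) by (auto simp: region_def i_eq)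
    moreover have "moebius_act g' z = moebius_act \<gamma> (moebius_act g u)"
      unfolding u(3) by (rule moebius_act_mult[OF det_\<Gamma>[OF \<gamma>] c(2) u(1)])
    ultimately show "Some (moebius_act g' z) \<in> translates i \<rho>" using \<gamma> by (auto simp: translates_def)
  qed
qed

lemma translates_invariant:
  assumes i: "i \<in> charts" and p: "p \<in> translates i \<rho>" and \<gamma>: "\<gamma> \<in> \<Gamma>"
  shows "moebius_sphere \<gamma> p \<in> translates i \<rho>"
proof -
  consider \<delta> z where "p = Some (moebius_act \<delta> z)" "\<delta> \<in> \<Gamma>" "z \<in> region i \<rho>"
    | g h \<delta> where "i = Inr (g, h)" "p = moebius_sphere (\<delta> ** g) None" "\<delta> \<in> \<Gamma>"
    using p by (auto simp: translates_def split: sum.splits)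
  then show ?thesis
  proof cases
    case 1
    then have z: "z \<in> \<H>" using region_subset[of i \<rho>] charts_det[OF i] by blast
    have "moebius_sphere \<gamma> p = Some (moebius_act (\<gamma> ** \<delta>) z)"
      unfolding 1(1) moebius_sphere_Some[OF det_\<Gamma>[OF \<gamma>] moebius_act_in_upper_half_plane[OF det_\<Gamma>[OF 1(2)] z]]
      by (simp add: moebius_act_mult[OF det_\<Gamma>[OF \<gamma>] det_\<Gamma>[OF 1(2)] z])
    then show ?thesis using 1 \<Gamma>_mult[OF \<gamma> 1(2)] by (auto simp: translates_def)
  next
    case 2
    have "det (\<delta> ** g) = 1" using charts_det[OF i 2(1)] det_\<Gamma>[OF 2(3)] by (simp add: det_mul)
    then have "moebius_sphere \<gamma> p = moebius_sphere ((\<gamma> ** \<delta>) ** g) None"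
      using moebius_sphere_mult_None[OF det_\<Gamma>[OF \<gamma>], of "\<delta> ** g"] by (simp add: 2(2) matrix_mul_assoc)
    then show ?thesis using 2 \<Gamma>_mult[OF \<gamma> 2(3)] by (auto simp: translates_def)
  qed
qed

lemma topspace_ext_half_plane: "topspace (ext_half_plane \<Gamma>) = Some ` \<H> \<union> cusps \<Gamma>"
proof -
  have "ext_half_plane_open \<Gamma> (Some ` \<H> \<union> cusps \<Gamma>)"
    unfolding ext_half_plane_open_def
  proof (intro conjI ballI impI)
    have "{z \<in> \<H>. Some z \<in> Some ` \<H> \<union> cusps \<Gamma>} = \<H>" by auto
    then show "open {z \<in> \<H>. Some z \<in> Some ` \<H> \<union> cusps \<Gamma>}"
      using open_upper_half_plane by simp
    fix g assume "g \<in> carrier (SL2 UNIV)"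
    then have "det g = 1" by (simp add: SL2_carrier)
    then have "\<forall>z. Im z > 1 \<longrightarrow> Some (moebius_act g z) \<in> Some ` \<H> \<union> cusps \<Gamma>"
      using moebius_act_in_upper_half_plane by (auto simp: upper_half_plane_def)
    then show "\<exists>M>0. \<forall>z. Im z > M \<longrightarrow> Some (moebius_act g z) \<in> Some ` \<H> \<union> cusps \<Gamma>"
      by (intro exI[of _ 1]) simp
  qed simp
  moreover have "S \<subseteq> Some ` \<H> \<union> cusps \<Gamma>" if "ext_half_plane_open \<Gamma> S" for S
    using that unfolding ext_half_plane_open_def by (rule conjunct1)
  ultimately show ?thesis
    unfolding topspace_def openin_ext_half_plane
    by (intro equalityI Union_least Union_upper) (simp_all only: mem_Collect_eq)
qed

lemma moebius_sphere_one: "moebius_sphere (mat 1) p = p"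
  by (cases p) (auto simp: moebius_sphere_def autfac_def)

text \<open>The charts are saturated and open, so their images are open in the compact quotient. A
  finite subcover there means that every z can be moved by \<Gamma> into one of finitely many
  regions.\<close>

lemma finite_chart_cover:
  assumes fuchs: "fuchsian_first_kind \<Gamma>" and \<rho>: "\<And>i. i \<in> charts \<Longrightarrow> \<rho> i > 0"
  obtains J where "finite J" "J \<subseteq> charts"
    "\<And>z. z \<in> \<H> \<Longrightarrow> \<exists>i\<in>J. \<exists>\<gamma>\<in>\<Gamma>. moebius_act \<gamma> z \<in> region i (\<rho> i)"
proof -
  define q where "q p = (\<lambda>\<gamma>. moebius_sphere \<gamma> p) ` \<Gamma>" for p
  obtain X where X: "quotient_map (ext_half_plane \<Gamma>) X q" "compact_space X"
    using fuchs unfolding fuchsian_first_kind_def q_def by blast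
  have qX: "q ` topspace (ext_half_plane \<Gamma>) = topspace X"
    using X(1) unfolding quotient_map_def by (rule conjunct1)
  define W where "W i = q ` translates i (\<rho> i)" for i
  have q_self: "p \<in> q p" for p using \<Gamma>_one moebius_sphere_one[of p] by (force simp: q_def)
  \<comment> \<open>A point of the quotient is an orbit and contains its own representatives. If two
    orbits coincide, p is a translate of a point of the saturated set and so belongs to it.\<close>
  have sat: "p \<in> translates i (\<rho> i)" if i: "i \<in> charts" and qp: "q p \<in> W i" for p i
  proof -
    obtain p' where p': "p' \<in> translates i (\<rho> i)" "q p = q p'" using qp by (auto simp: W_def)
    then have "p \<in> q p'" using q_self[of p] by simp
    then show ?thesis using translates_invariant[OF i p'(1)] by (auto simp: q_def)
  qed
  have op: "openin X (W i)" if i: "i \<in> charts" for i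
  proof -
    have sub: "translates i (\<rho> i) \<subseteq> topspace (ext_half_plane \<Gamma>)"
      using translates_subset[OF i] by (simp add: topspace_ext_half_plane)
    have "{x \<in> topspace (ext_half_plane \<Gamma>). q x \<in> W i} = translates i (\<rho> i)"
    proof (intro equalityI subsetI)
      fix x assume "x \<in> {x \<in> topspace (ext_half_plane \<Gamma>). q x \<in> W i}"
      then show "x \<in> translates i (\<rho> i)" using sat[OF i, of x] by blast
    next
      fix x assume "x \<in> translates i (\<rho> i)"
      then show "x \<in> {x \<in> topspace (ext_half_plane \<Gamma>). q x \<in> W i}"
        using subsetD[OF sub, of x] by (simp only: W_def mem_Collect_eq imageI simp_thms)
    qed
    then have "openin (ext_half_plane \<Gamma>) {x \<in> topspace (ext_half_plane \<Gamma>). q x \<in> W i}"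
      using ext_open_translates[OF i \<rho>[OF i]] by (simp add: openin_ext_half_plane)
    moreover have "W i \<subseteq> topspace X"
      unfolding W_def qX[symmetric] using sub by (rule image_mono)
    ultimately show ?thesis using X(1) unfolding quotient_map_def by blast
  qed
  have cover: "topspace X \<subseteq> \<Union> (W ` charts)"
  proof
    fix y assume "y \<in> topspace X"
    then obtain p where p: "p \<in> Some ` \<H> \<union> cusps \<Gamma>" "y = q p"
      unfolding qX[symmetric] topspace_ext_half_plane by (rule imageE)
    have "\<exists>i\<in>charts. p \<in> translates i (\<rho> i)"
    proof (cases "p \<in> cusps \<Gamma>")
      case True
      then obtain g h where gh: "cusp_pair g h" "moebius_sphere g None = p" by (rule cusp_pair_exists)
      have "p = moebius_sphere (mat 1 ** g) None" using gh by simp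
      then have "p \<in> translates (Inr (g, h)) (\<rho> (Inr (g, h)))"
        using \<Gamma>_one by (auto simp: translates_def)
      moreover have "Inr (g, h) \<in> charts" using gh by (auto simp: charts_def)
      ultimately show ?thesis by blast
    next
      case False
      then obtain z where z: "z \<in> \<H>" "p = Some z" using p by blast
      have i: "Inl z \<in> charts" using z by (auto simp: charts_def)
      have "z \<in> region (Inl z) (\<rho> (Inl z))" using z \<rho>[OF i] by (simp add: region_def)
      moreover have "p = Some (moebius_act (mat 1) z)" using z by simp
      ultimately have "p \<in> translates (Inl z) (\<rho> (Inl z))"
        using \<Gamma>_one unfolding translates_def by blast
      then show ?thesis using i by blast
    qed
    then obtain i where "i \<in> charts" "p \<in> translates i (\<rho> i)" by (rule bexE)
    then show "y \<in> \<Union> (W ` charts)" unfolding p(2) W_def by (intro UN_I imageI)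
  qed
  have "compactin X (topspace X)" using X(2) by (simp add: compact_space_def)
  then obtain \<F> where \<F>: "finite \<F>" "\<F> \<subseteq> W ` charts" "topspace X \<subseteq> \<Union> \<F>"
  proof -
    have "\<forall>U\<in>W ` charts. openin X U" using op by fast
    then show thesis using \<open>compactin X (topspace X)\<close> cover that unfolding compactin_def by meson
  qed
  obtain J where J: "J \<subseteq> charts" "finite J" "\<F> = W ` J"
    using finite_subset_image[OF \<F>(1,2)] by blast
  show thesis
  proof (rule that[OF J(2,1)])
    fix z assume z: "z \<in> \<H>"
    then have "q (Some z) \<in> topspace X"
      unfolding qX[symmetric] topspace_ext_half_plane by (intro imageI UnI1)
    then obtain i where i: "i \<in> J" "q (Some z) \<in> W i" using \<F>(3) J(3) by blast
    have ic: "i \<in> charts" using i J by blast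
    have "z \<in> {z \<in> \<H>. Some z \<in> translates i (\<rho> i)}" using sat[OF ic i(2)] z by simp
    then obtain \<gamma> x where x: "\<gamma> \<in> \<Gamma>" "x \<in> region i (\<rho> i)" "z = moebius_act \<gamma> x"
      unfolding translates_upper[OF ic] by blast
    have "x \<in> \<H>" using x(2) region_subset[of i "\<rho> i"] charts_det[OF ic] by blast
    then have "moebius_act (matrix_inv \<gamma>) z = x"
      unfolding x(3) by (rule moebius_act_inv(2)[OF det_\<Gamma>[OF x(1)]])
    then show "\<exists>i\<in>J. \<exists>\<gamma>\<in>\<Gamma>. moebius_act \<gamma> z \<in> region i (\<rho> i)"
      using i(1) x(2) \<Gamma>_inv[OF x(1)] by metis
  qed
qed

end

section \<open>Algebraic dependence of modular functions\<close>

lemma mval_mcomp_analytic: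
  assumes "det g = 1" "z \<in> \<H>" "mval a analytic_on {moebius_act g z}"
  shows "mval (mcomp g a) analytic_on {z}" "mval (mcomp g a) z = mval a (moebius_act g z)"
proof -
  have "moebius_act g analytic_on {z}"
    using moebius_act_analytic[OF assms(1)] assms(2) by (auto intro: analytic_on_subset)
  then have "(\<lambda>w. mval a (moebius_act g w)) analytic_on {z}"
    using analytic_on_compose_gen[of "moebius_act g" "{z}" "mval a" "{moebius_act g z}"] assms(3)
    by (simp add: o_def)
  then show "mval (mcomp g a) analytic_on {z}" "mval (mcomp g a) z = mval a (moebius_act g z)"
    using mval_at_analytic[OF assms(2) _ eventually_mval_ops(6)[OF assms(2,1)]] by auto
qed

lemma mval_const_analytic:
  assumes "z \<in> \<H>"
  shows "mval (mconst c) analytic_on {z}"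
proof (rule mval_at_analytic(1)[OF assms])
  show "\<forall>\<^sub>F w in at z. mval (mconst c) w = c"
    using eventually_in_upper_half_plane[OF assms] by eventually_elim (rule mval_mconst)
qed simp

lemma mval_add_analytic:
  assumes "z \<in> \<H>" "mval a analytic_on {z}" "mval b analytic_on {z}"
  shows "mval (a + b) analytic_on {z}" "mval (a + b) z = mval a z + mval b z"
proof -
  have "(\<lambda>w. mval a w + mval b w) analytic_on {z}" by (intro analytic_intros assms)
  then show "mval (a + b) analytic_on {z}" "mval (a + b) z = mval a z + mval b z"
    using mval_at_analytic[OF assms(1) _ eventually_mval_ops(1)[OF assms(1), of a b]] by auto
qed

lemma mval_mult_analytic:
  assumes "z \<in> \<H>" "mval a analytic_on {z}" "mval b analytic_on {z}"
  shows "mval (a * b) analytic_on {z}" "mval (a * b) z = mval a z * mval b z"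
proof -
  have "(\<lambda>w. mval a w * mval b w) analytic_on {z}" by (intro analytic_intros assms)
  then show "mval (a * b) analytic_on {z}" "mval (a * b) z = mval a z * mval b z"
    using mval_at_analytic[OF assms(1) _ eventually_mval_ops(3)[OF assms(1), of a b]] by auto
qed

lemma mval_power_analytic:
  assumes "z \<in> \<H>" "mval a analytic_on {z}"
  shows "mval (a ^ n) analytic_on {z} \<and> mval (a ^ n) z = mval a z ^ n"
proof (induction n)
  case 0
  then show ?case using mval_const_analytic[OF assms(1), of 1] mval_mconst[OF assms(1), of 1] by simp
qed (use mval_mult_analytic[OF assms] in auto)

lemma mval_sum_analytic:
  assumes "z \<in> \<H>" "\<And>i. i \<in> A \<Longrightarrow> mval (f i) analytic_on {z}"
  shows "mval (sum f A) analytic_on {z} \<and> mval (sum f A) z = (\<Sum>i\<in>A. mval (f i) z)"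
  using assms(2)
proof (induction A rule: infinite_finite_induct)
  case (insert x A)
  then show ?case using mval_add_analytic[OF assms(1), of "f x" "sum f A"] by auto
qed (use mval_const_analytic[OF assms(1), of 0] mval_mconst[OF assms(1), of 0] in auto)

lemma mval_bivariate_analytic:
  assumes "z \<in> \<H>" "mval a analytic_on {z}" "mval b analytic_on {z}"
  shows "mval (\<Sum>x\<in>A. mconst (c x) * (a ^ fst x * b ^ snd x)) analytic_on {z} \<and>
    mval (\<Sum>x\<in>A. mconst (c x) * (a ^ fst x * b ^ snd x)) z =
      (\<Sum>x\<in>A. c x * (mval a z ^ fst x * mval b z ^ snd x))"
proof -
  have *: "mval (mconst (c x) * (a ^ fst x * b ^ snd x)) analytic_on {z} \<and>
      mval (mconst (c x) * (a ^ fst x * b ^ snd x)) z = c x * (mval a z ^ fst x * mval b z ^ snd x)" for x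
    using mval_power_analytic[OF assms(1,2), of "fst x"] mval_power_analytic[OF assms(1,3), of "snd x"]
      mval_const_analytic[OF assms(1), of "c x"] mval_mconst[OF assms(1), of "c x"]
      mval_mult_analytic[OF assms(1), of "a ^ fst x" "b ^ snd x"]
      mval_mult_analytic[OF assms(1), of "mconst (c x)" "a ^ fst x * b ^ snd x"]
    by simp
  then show ?thesis
    using mval_sum_analytic[OF assms(1), of A "\<lambda>x. mconst (c x) * (a ^ fst x * b ^ snd x)"] by simp
qed

text \<open>
  The values of \<open>G\<close> together with \<open>0\<close> form a compact set, so \<open>|G|\<close> has a maximum.
\<close>

lemma vanishing_by_maximum_principle:
  fixes E :: "'i \<Rightarrow> complex \<Rightarrow> complex"
  assumes J: "finite J" and r: "\<And>i. i \<in> J \<Longrightarrow> r i > 0"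
    and G: "G holomorphic_on \<H>"
    and E: "\<And>i. i \<in> J \<Longrightarrow> continuous_on (cball 0 (r i)) (E i)" "\<And>i. E i 0 = 0"
    and GE: "\<And>z. z \<in> \<H> \<Longrightarrow> \<exists>i\<in>J. G z \<in> E i ` cball 0 (r i)"
    and EG: "\<And>i x. i \<in> J \<Longrightarrow> x \<in> cball 0 (r i) \<Longrightarrow> x \<noteq> 0 \<Longrightarrow> E i x \<in> G ` \<H>"
    and z: "z \<in> \<H>"
  shows "G z = 0"
proof -
  define C where "C = (\<Union>i\<in>J. E i ` cball 0 (r i))"
  have "compact C" unfolding C_def using J E(1) by (intro compact_UN compact_continuous_image) auto
  moreover have GC: "G x \<in> C" if "x \<in> \<H>" for x
    using GE[OF that] unfolding C_def by blast
  then have "C \<noteq> {}" using z by blast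
  ultimately obtain m where m: "m \<in> C" "\<And>x. x \<in> C \<Longrightarrow> norm x \<le> norm m"
    using continuous_attains_sup[of C norm] continuous_on_norm_id by blast
  have "m = 0"
  proof (rule ccontr)
    assume m0: "m \<noteq> 0"
    obtain i x where ix: "i \<in> J" "x \<in> cball 0 (r i)" "m = E i x" using m(1) by (auto simp: C_def)
    then have "x \<noteq> 0" using m0 E(2) by auto
    \<comment> \<open>A nonzero maximum is not taken at a chart centre, where E is 0; it is
      therefore taken by G inside \<H>, and the maximum principle applies.\<close>
    then obtain y where y: "y \<in> \<H>" "m = G y" using EG[OF ix(1,2)] ix(3) by auto
    have "G constant_on \<H>"
      using maximum_modulus_principle[OF G open_upper_half_plane connected_upper_half_plane
          open_upper_half_plane subset_refl y(1)] m(2) GC y(2) by blast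
    then have const: "G x = m" if "x \<in> \<H>" for x
      using y that unfolding constant_on_def by metis
    have Em: "E i x = m" if "x \<in> cball 0 (r i)" "x \<noteq> 0" for x
      using EG[OF ix(1) that] const by auto
    have r': "r i > 0" using r ix(1) by blast
    obtain d where d: "d > 0" "\<And>x. x \<in> cball 0 (r i) \<Longrightarrow> dist x 0 < d \<Longrightarrow> dist (E i x) (E i 0) < norm m"
      using E(1)[OF ix(1)] m0 r' unfolding continuous_on_iff
      by (metis centre_in_cball less_imp_le zero_less_norm_iff)
    \<comment> \<open>A point of the same chart that is not its centre but so close to it that
      \<open>E i x0\<close> is smaller than m. As G is constant, the value there would have to be
      m.\<close>
    define x0 where "x0 = complex_of_real (min (r i) (d / 2))"
    have "x0 \<noteq> 0" "x0 \<in> cball 0 (r i)" "dist x0 0 < d"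
      using d(1) r' by (auto simp: x0_def min_def)
    then show False using d(2)[of x0] Em[of x0] E(2) by simp
  qed
  then show ?thesis using m(2)[OF GC[OF z]] by simp
qed

text \<open>One description for both kinds of chart. Each point of the punctured disc is required to
  be the coordinate of a point of \<H>, so that the values of an expansion off the centre are values
  on \<H>, as the maximum principle demands.\<close>

definition expands :: "complex + ((real^2^2) \<times> real) \<Rightarrow> mero \<Rightarrow> (complex \<Rightarrow> complex) \<Rightarrow> real \<Rightarrow> bool" where
  "expands i a F \<rho> \<longleftrightarrow> \<rho> > 0 \<and> F meromorphic_on {0} \<and>
     (\<forall>x. x \<noteq> 0 \<and> norm x < \<rho> \<longrightarrow> F analytic_on {x} \<and> (\<exists>z\<in>\<H>. coord i z = x)) \<and>
     (\<forall>z\<in>\<H>. coord i z \<noteq> 0 \<and> norm (coord i z) < \<rho> \<longrightarrow>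
        mval a analytic_on {z} \<and> mval a z = F (coord i z))"

lemma expands_mono: "expands i a F \<rho> \<Longrightarrow> 0 < \<rho>' \<Longrightarrow> \<rho>' \<le> \<rho> \<Longrightarrow> expands i a F \<rho>'"
  unfolding expands_def by auto

lemma expands_point:
  assumes p: "p \<in> \<H>"
  obtains F \<rho> where "expands (Inl p) a F \<rho>"
proof -
  define F where "F w = mval a (p + w)" for w
  have "(\<lambda>w. p + w) analytic_on {0}" by (intro analytic_intros)
  then have F: "F meromorphic_on {0}"
    unfolding F_def using meromorphic_on_compose[OF mval_meromorphic] p by auto
  obtain A where A: "open A" "p \<in> A" "\<And>z. z \<in> A \<Longrightarrow> z \<noteq> p \<Longrightarrow> mval a analytic_on {z}"
    using meromorphic_on_eventually_analytic[OF mval_meromorphic p, of a]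
    unfolding eventually_at_topological by blast
  have "open (A \<inter> \<H>)" "p \<in> A \<inter> \<H>"
    using A(1,2) open_upper_half_plane p by auto
  then obtain \<rho> where \<rho>: "\<rho> > 0" "ball p \<rho> \<subseteq> A \<inter> \<H>"
    by (meson openE)
  have in_ball: "p + x \<in> ball p \<rho>" if "norm x < \<rho>" for x using that by (simp add: dist_norm)
  have "F analytic_on {x}" if "x \<noteq> 0" "norm x < \<rho>" for x
  proof -
    have "mval a analytic_on {p + x}" using A(3)[of "p + x"] in_ball[OF that(2)] \<rho>(2) that(1) by auto
    then show ?thesis
      using analytic_on_compose_gen[of "\<lambda>w. p + w" "{x}" "mval a" "{p + x}"]
      by (simp add: o_def F_def[abs_def] analytic_intros)
  qed
  moreover have "\<exists>z\<in>\<H>. coord (Inl p) z = x" if "norm x < \<rho>" for x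
    using in_ball[OF that] \<rho>(2) by (intro bexI[of _ "p + x"]) (auto simp: coord_def)
  moreover have "mval a analytic_on {z}" if "z - p \<noteq> 0" "norm (z - p) < \<rho>" for z
    using A(3)[of z] in_ball[OF that(2)] \<rho>(2) that(1) by auto
  ultimately have "expands (Inl p) a F \<rho>"
    using \<rho>(1) F unfolding expands_def by (auto simp: coord_def F_def)
  then show thesis using that by blast
qed

lemma region_iff:
  assumes "\<And>g h. i = Inr (g, h) \<Longrightarrow> det g = 1"
  shows "z \<in> region i \<rho> \<longleftrightarrow> z \<in> \<H> \<and> norm (coord i z) < \<rho>"
proof (cases i)
  case (Inl p)
  then show ?thesis by (auto simp: region_def coord_def dist_norm norm_minus_commute)
next
  case (Inr gh)
  obtain g h where gh: "i = Inr (g, h)" using Inr by (cases gh) auto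
  note g = assms[OF gh]
  show ?thesis
  proof
    assume "z \<in> region i \<rho>"
    then obtain u where u: "u \<in> \<H>" "norm (qexp h u) < \<rho>" "z = moebius_act g u"
      by (auto simp: region_def gh)
    then show "z \<in> \<H> \<and> norm (coord i z) < \<rho>"
      using moebius_act_in_upper_half_plane[OF g u(1)] moebius_act_inv(2)[OF g u(1)]
      by (simp add: coord_def gh)
  next
    assume z: "z \<in> \<H> \<and> norm (coord i z) < \<rho>"
    define u where "u = moebius_act (matrix_inv g) z"
    have u: "u \<in> \<H>" "z = moebius_act g u"
      unfolding u_def using z matrix_inv_det1(1)[OF g]
      by (auto intro: moebius_act_in_upper_half_plane simp: moebius_act_inv(1)[OF g])
    have "norm (qexp h u) < \<rho>" using z by (simp add: coord_def gh u_def)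
    then have "z \<in> moebius_act g ` {u \<in> \<H>. norm (qexp h u) < \<rho>}"
      using u by (intro image_eqI[of _ _ u]) auto
    then show "z \<in> region i \<rho>" by (simp add: region_def gh)
  qed
qed

section \<open>Local expansions of modular functions and the count of conditions\<close>

context twisted_form
begin

lemma expands_cusp:
  assumes gh: "cusp_pair g h" and a: "a \<in> modular_field"
  obtains F \<rho> where "expands (Inr (g, h)) a F \<rho>"
proof -
  note c = cusp_pairD[OF gh]
  have d: "det (matrix_inv g) = 1" by (rule matrix_inv_det1(1)[OF c(2)])
  have per: "mcomp g a \<in> Per h" using a gh by (simp add: modular_field_def)
  obtain F M where F: "F meromorphic_on {0}" "M \<ge> 0"
    "\<And>z. Im z > M \<Longrightarrow> F analytic_on {qexp h z}"
    "\<And>z. Im z > M \<Longrightarrow> mval (mcomp g a) analytic_on {z}"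
    "\<And>z. Im z > M \<Longrightarrow> mval (mcomp g a) z = F (qexp h z)"
    by (rule PerE[OF per c(3)]) (rule that, assumption+)
  define \<rho> where "\<rho> = exp (- 2 * pi * M / h)"
  have \<rho>: "\<rho> > 0" by (simp add: \<rho>_def)
  have Im: "Im z > M" if "norm (qexp h z) < \<rho>" for z
    using that c(3) unfolding norm_qexp_less_iff[OF c(3) \<rho>] by (simp add: \<rho>_def field_simps)
  have surj: "F analytic_on {x} \<and> (\<exists>z\<in>\<H>. coord (Inr (g, h)) z = x)"
    if x: "x \<noteq> 0" "norm x < \<rho>" for x
  proof -
    define u where "u = of_real h / (2 * of_real pi * \<i>) * Ln x"
    have u: "qexp h u = x" unfolding u_def by (rule qexp_log[OF c(3) x(1)])
    then have Mu: "Im u > M" using Im x(2) by simp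
    then have uH: "u \<in> \<H>" using F(2) by (simp add: upper_half_plane_def)
    have "coord (Inr (g, h)) (moebius_act g u) = x"
      using moebius_act_inv(2)[OF c(2) uH] u by (simp add: coord_def)
    then show ?thesis
      using F(3)[OF Mu] u moebius_act_in_upper_half_plane[OF c(2) uH] by auto
  qed
  have val: "mval a analytic_on {z} \<and> mval a z = F (coord (Inr (g, h)) z)"
    if z: "z \<in> \<H>" "norm (coord (Inr (g, h)) z) < \<rho>" for z
  proof -
    let ?u = "moebius_act (matrix_inv g) z"
    have "Im ?u > M" using Im z(2) by (simp add: coord_def)
    then have "mval (mcomp g a) analytic_on {?u}" "mval (mcomp g a) ?u = F (qexp h ?u)"
      using F(4,5) by auto
    then have "mval (mcomp (matrix_inv g) (mcomp g a)) analytic_on {z}"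
      "mval (mcomp (matrix_inv g) (mcomp g a)) z = F (qexp h ?u)"
      using mval_mcomp_analytic[OF d z(1)] by auto
    moreover have "mcomp (matrix_inv g) (mcomp g a) = a"
      using c(2) d by (simp add: mcomp_mcomp matrix_inv_det1)
    ultimately show ?thesis by (simp add: coord_def)
  qed
  have "expands (Inr (g, h)) a F \<rho>"
    unfolding expands_def using \<rho> F(1) surj val by blast
  then show thesis using that by blast
qed

lemma expands_exists:
  assumes "i \<in> charts" "a \<in> modular_field"
  shows "\<exists>F \<rho>. expands i a F \<rho>"
proof -
  consider p where "i = Inl p" "p \<in> \<H>" | g h where "i = Inr (g, h)" "cusp_pair g h"
    using assms(1) by (auto simp: charts_def)
  then show ?thesis
  proof cases
    case 1
    obtain F \<rho> where "expands (Inl p) a F \<rho>" using expands_point[OF 1(2)] .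
    then show ?thesis unfolding 1(1) by (intro exI)
  next
    case 2
    obtain F \<rho> where "expands (Inr (g, h)) a F \<rho>" using expands_cusp[OF 2(2) assms(2)] .
    then show ?thesis unfolding 2(1) by (intro exI)
  qed
qed

text \<open>A combination of monomials with no polar part and no constant term in any of the
  finitely many charts is holomorphic on the compact quotient and zero at the centres, hence zero.
  The pole orders of the monomials grow linearly with N and the number of monomials quadratically,
  so such a combination exists.\<close>

lemma algebraic_dependence:
  assumes fuchs: "fuchsian_first_kind \<Gamma>" and a: "a \<in> modular_field"
  obtains N c where "\<exists>x\<in>{..N} \<times> {..N}. c x \<noteq> (0 :: complex)"
    "(\<Sum>x\<in>{..N} \<times> {..N}. mconst (c x) * (T ^ fst x * a ^ snd x)) = 0"
proof -
  have "\<exists>\<rho> F F'. expands i T F \<rho> \<and> expands i a F' \<rho>" if i: "i \<in> charts" for i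
  proof -
    obtain F \<rho> where 1: "expands i T F \<rho>" using expands_exists[OF i T_in_modular_field] by blast
    obtain F' \<rho>' where 2: "expands i a F' \<rho>'" using expands_exists[OF i a] by blast
    have "min \<rho> \<rho>' > 0" using 1 2 by (simp add: expands_def)
    then have "expands i T F (min \<rho> \<rho>')" "expands i a F' (min \<rho> \<rho>')"
      using 1 2 by (auto intro: expands_mono)
    then show ?thesis by blast
  qed
  then obtain \<rho> FT Fa where ex: "\<And>i. i \<in> charts \<Longrightarrow> expands i T (FT i) (\<rho> i)"
    "\<And>i. i \<in> charts \<Longrightarrow> expands i a (Fa i) (\<rho> i)"
    by metis
  have \<rho>: "\<rho> i > 0" if "i \<in> charts" for i using ex(1)[OF that] by (simp add: expands_def)
  \<comment> \<open>The cover uses half the radii, so that closed discs of these radii are still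
    inside the domains of the expansions.\<close>
  obtain J where J: "finite J" "J \<subseteq> charts"
    "\<And>z. z \<in> \<H> \<Longrightarrow> \<exists>i\<in>J. \<exists>\<gamma>\<in>\<Gamma>. moebius_act \<gamma> z \<in> region i (\<rho> i / 2)"
    using finite_chart_cover[OF fuchs, of "\<lambda>i. \<rho> i / 2"] \<rho> by auto
  define A where "A i = laurent_expansion (FT i) 0" for i
  define B where "B i = laurent_expansion (Fa i) 0" for i
  have A: "FT i has_laurent_expansion A i" and B: "Fa i has_laurent_expansion B i" if "i \<in> J" for i
    using ex[of i] that J(2) meromorphic_on_imp_has_laurent_expansion[of _ "{0}" 0]
    by (auto simp: expands_def A_def B_def)
  \<comment> \<open>A common bound for the pole orders of T and a at all chart centres; a monomial
    with exponents up to N has a pole of order at most 2 N L.\<close>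
  define L where "L = (\<Sum>i\<in>J. nat (- fls_subdegree (A i)) + nat (- fls_subdegree (B i)))"
  have L: "- int L \<le> fls_subdegree (A i)" "- int L \<le> fls_subdegree (B i)" if "i \<in> J" for i
  proof -
    have "nat (- fls_subdegree (A i)) + nat (- fls_subdegree (B i)) \<le> L"
      unfolding L_def using that J(1) by (intro member_le_sum) auto
    then show "- int L \<le> fls_subdegree (A i)" "- int L \<le> fls_subdegree (B i)" by linarith+
  qed
  \<comment> \<open>Chosen so that the number of conditions,
    \<open>card J * (2 * N * L + 1)\<close>, is at most N^2 and thus less than the number (N+1)^2 of
    monomials.\<close>
  define N where "N = card J * (2 * L + 1)"
  define X where "X = {..N} \<times> {..N}"
  define P where "P i x = A i ^ fst x * B i ^ snd x" for i and x :: "nat \<times> nat"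
  have P0: "fls_nth (P i x) m = 0" if i: "i \<in> J" and x: "x \<in> X" and m: "m < - int (2 * N * L)" for i x m
  proof (cases "P i x = 0")
    case False
    then have ne: "A i ^ fst x \<noteq> 0" "B i ^ snd x \<noteq> 0" by (auto simp: P_def)
    have le: "- int (N * L) \<le> int n * s" if "n \<le> N" "- int L \<le> s" for n s
    proof -
      have "int n * (- int L) \<le> int n * s" using that by (intro mult_left_mono) auto
      moreover have "int n * int L \<le> int N * int L" using that by (intro mult_right_mono) auto
      ultimately show ?thesis by simp
    qed
    have "fls_subdegree (P i x) = int (fst x) * fls_subdegree (A i) + int (snd x) * fls_subdegree (B i)"
      unfolding P_def using ne by (simp add: fls_subdegree_pow)
    moreover have "- int (N * L) \<le> int (fst x) * fls_subdegree (A i)"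
      "- int (N * L) \<le> int (snd x) * fls_subdegree (B i)"
      using x by (intro le L[OF i]; auto simp: X_def)+
    ultimately have "m < fls_subdegree (P i x)" using m by simp
    then show ?thesis by (rule fls_eq0_below_subdegree)
  qed simp
  \<comment> \<open>The Laurent coefficients to be killed. The index 0 is included, so that the
    combination vanishes at the centre instead of being merely finite there.\<close>
  define I where "I = J \<times> {- int (2 * N * L)..0}"
  have "card I < card X"
  proof -
    have "card {- int k..0} = k + 1" for k by simp
    then have "card I = card J * (2 * N * L + 1)"
      unfolding I_def card_cartesian_product by (simp only:)
    also have "\<dots> \<le> N * N"
    proof (cases "card J = 0")
      case False
      then have "1 \<le> N" by (simp add: N_def)
      then have "2 * N * L + 1 \<le> (2 * L + 1) * N" by (simp add: algebra_simps)
      then have "card J * (2 * N * L + 1) \<le> card J * ((2 * L + 1) * N)" by (rule mult_le_mono2)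
      also have "\<dots> = N * N" by (simp only: N_def mult.assoc)
      finally show ?thesis .
    qed simp
    also have "\<dots> < card X" by (simp add: X_def card_cartesian_product)
    finally show ?thesis .
  qed
  moreover have "finite I" "finite X" using J(1) by (auto simp: I_def X_def)
  moreover have "subring_of (UNIV :: complex set)" by (simp add: subring_of_def)
  ultimately obtain c :: "nat \<times> nat \<Rightarrow> complex" where c: "\<exists>x\<in>X. c x \<noteq> 0"
    "\<forall>im\<in>I. (\<Sum>x\<in>X. fls_nth (P (fst im) x) (snd im) * c x) = 0"
    using homogeneous_system_solvable[of UNIV I X "\<lambda>im x. fls_nth (P (fst im) x) (snd im)"] by auto
  define G where "G = (\<Sum>x\<in>X. mconst (c x) * (T ^ fst x * a ^ snd x))"
  define FG where "FG i w = (\<Sum>x\<in>X. c x * (FT i w ^ fst x * Fa i w ^ snd x))" for i w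
  define Q where "Q i = (\<Sum>x\<in>X. fls_const (c x) * P i x)" for i
  have FG0: "(FG i \<longlongrightarrow> 0) (at 0)" if i: "i \<in> J" for i
  proof -
    have e: "FG i has_laurent_expansion Q i"
      unfolding FG_def Q_def P_def using A[OF i] B[OF i] by (intro laurent_expansion_intros) auto
    have Q0: "fls_nth (Q i) m = 0" if m: "m \<le> 0" for m
    proof (cases "m < - int (2 * N * L)")
      case True
      then show ?thesis using P0[OF i _ True] by (simp add: Q_def fls_nth_sum)
    next
      case False
      then have "(i, m) \<in> I" using i m by (auto simp: I_def)
      then have "(\<Sum>x\<in>X. fls_nth (P i x) m * c x) = 0" using c(2) by fastforce
      then show ?thesis by (simp add: Q_def fls_nth_sum mult.commute)
    qed
    have "fls_subdegree (Q i) \<ge> 0"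
    proof (cases "Q i = 0")
      case False
      then show ?thesis using Q0 by (intro fls_subdegree_geI) auto
    qed simp
    from has_laurent_expansion_imp_tendsto_0[OF e this] show ?thesis using Q0[of 0] by simp
  qed
  have val: "mval G analytic_on {z} \<and> mval G z = FG i (coord i z)"
    if "i \<in> J" "z \<in> \<H>" "coord i z \<noteq> 0" "norm (coord i z) < \<rho> i" for i z
    using ex[of i] J(2) that mval_bivariate_analytic[OF that(2), of T a c X]
    by (auto simp: expands_def G_def FG_def)
  \<comment> \<open>A coordinate is zero only at the centre of a chart in \<H>, because
    \<open>qexp\<close> has no zeros. T or a may have a pole there, so the value is found as a limit
    rather than by substitution.\<close>
  have center: "mval G analytic_on {z} \<and> mval G z = 0"
    if i: "i \<in> J" and z: "z \<in> \<H>" and 0: "coord i z = 0" for i z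
  proof -
    have i_eq: "i = Inl z" using 0 by (cases i) (auto simp: coord_def split: prod.splits)
    have "filterlim (\<lambda>x. x - z) (at 0) (at z)"
      by (auto simp: filterlim_at eventually_at_filter intro!: tendsto_eq_intros)
    then have lim: "((\<lambda>x. FG i (x - z)) \<longlongrightarrow> 0) (at z)"
      by (rule filterlim_compose[OF FG0[OF i]])
    have "\<forall>\<^sub>F x in at z. x \<in> ball z (\<rho> i) - {z}"
      using \<rho> i J(2) by (intro eventually_at_in_open) auto
    then have "\<forall>\<^sub>F x in at z. FG i (x - z) = mval G x"
      using eventually_in_upper_half_plane[OF z]
    proof eventually_elim
      case (elim x)
      then show ?case using val[OF i elim(2)]
        by (simp add: i_eq coord_def dist_norm norm_minus_commute)
    qed
    then have lim: "(mval G \<longlongrightarrow> 0) (at z)" using lim by (rule Lim_transform_eventually[rotated])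
    then have "\<not> is_pole (mval G) z"
      unfolding is_pole_def using not_tendsto_and_filterlim_at_infinity[OF at_neq_bot] by blast
    then have an: "mval G analytic_on {z}"
      using nicely_meromorphic_on_imp_analytic_at[OF mval_nicely_meromorphic z] by blast
    then have "(mval G \<longlongrightarrow> mval G z) (at z)" using analytic_at_imp_isCont isContD by blast
    then show ?thesis using an tendsto_unique[OF at_neq_bot lim] by auto
  qed
  have G_inv: "mcomp \<gamma> G = G" if "\<gamma> \<in> \<Gamma>" for \<gamma>
    using that a T_invariant by (simp add: G_def modular_field_def)
  \<comment> \<open>The expansion with its limit 0 filled in at the centre; the value of
    \<open>FG\<close> itself there is arbitrary.\<close>
  define E where "E i w = (if w = 0 then 0 else FG i w)" for i w
  have GE: "mval G analytic_on {z} \<and> (\<exists>i\<in>J. mval G z \<in> E i ` cball 0 (\<rho> i / 2))"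
    if z: "z \<in> \<H>" for z
  proof -
    obtain i \<gamma> where i: "i \<in> J" "\<gamma> \<in> \<Gamma>" "moebius_act \<gamma> z \<in> region i (\<rho> i / 2)" using J(3)[OF z] by blast
    let ?z = "moebius_act \<gamma> z"
    have d: "\<And>g h. i = Inr (g, h) \<Longrightarrow> det g = 1" using charts_det i(1) J(2) by blast
    have "?z \<in> \<H> \<and> norm (coord i ?z) < \<rho> i / 2"
    proof (rule iffD1[OF region_iff[of i]])
      show "det g = 1" if "i = Inr (g, h)" for g h using that by (rule d)
    qed (rule i(3))
    then have z': "?z \<in> \<H>" "norm (coord i ?z) < \<rho> i / 2" "norm (coord i ?z) < \<rho> i"
      using norm_ge_zero[of "coord i ?z"] by linarith+
    have *: "mval G analytic_on {?z} \<and> mval G ?z = E i (coord i ?z)"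
      using val[OF i(1) z'(1) _ z'(3)] center[OF i(1) z'(1)] by (auto simp: E_def)
    then have "mval G analytic_on {z}" "mval G z = mval G ?z"
      using mval_mcomp_analytic[OF det_\<Gamma>[OF i(2)] z, of G] G_inv[OF i(2)] by auto
    moreover have "coord i ?z \<in> cball 0 (\<rho> i / 2)" using z'(2) by simp
    ultimately have "mval G z \<in> E i ` cball 0 (\<rho> i / 2)" using * by (metis imageI)
    then show ?thesis using i(1) \<open>mval G analytic_on {z}\<close> by blast
  qed
  have "mval G z = 0" if z: "z \<in> \<H>" for z
  proof (rule vanishing_by_maximum_principle[OF J(1), where r = "\<lambda>i. \<rho> i / 2" and E = E and G = "mval G"])
    show "\<rho> i / 2 > 0" if "i \<in> J" for i using \<rho> J(2) that by auto
    show "mval G holomorphic_on \<H>"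
      using GE by (intro analytic_imp_holomorphic) (auto simp: analytic_on_analytic_at[of _ \<H>])
    show "E i 0 = 0" for i by (simp add: E_def)
    show "\<exists>i\<in>J. mval G z \<in> E i ` cball 0 (\<rho> i / 2)" if "z \<in> \<H>" for z
      using GE[OF that] by blast
    show "E i x \<in> mval G ` \<H>" if i: "i \<in> J" and x: "x \<in> cball 0 (\<rho> i / 2)" "x \<noteq> 0" for i x
    proof -
      have x': "norm x < \<rho> i" using x(1) \<rho>[of i] i J(2) by auto
      then obtain y where y: "y \<in> \<H>" "coord i y = x"
        using ex(1)[of i] i J(2) x(2) unfolding expands_def by blast
      then have "E i x = mval G y" using val[OF i, of y] x(2) x' by (auto simp: E_def)
      then show ?thesis using y(1) by (simp only: imageI)
    qed
    show "continuous_on (cball 0 (\<rho> i / 2)) (E i)" if i: "i \<in> J" for i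
    proof (rule continuous_at_imp_continuous_on, rule ballI)
      fix x :: complex assume x: "x \<in> cball 0 (\<rho> i / 2)"
      show "isCont (E i) x"
      proof (cases "x = 0")
        case True
        have "\<forall>\<^sub>F w in at 0. FG i w = E i w" by (simp add: E_def eventually_at_filter)
        then have "(E i \<longlongrightarrow> 0) (at 0)" using FG0[OF i] by (rule Lim_transform_eventually[rotated])
        then show ?thesis using True by (simp add: isCont_def E_def)
      next
        case False
        have "norm x < \<rho> i" using x \<rho>[of i] i J(2) by auto
        then have "FT i analytic_on {x}" "Fa i analytic_on {x}"
          using ex[of i] i J(2) False unfolding expands_def by blast+
        then have "FG i analytic_on {x}" unfolding FG_def by (intro analytic_intros)
        then have "isCont (FG i) x" by (rule analytic_at_imp_isCont)
        moreover have "\<forall>\<^sub>F w in nhds x. w \<in> - {0}"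
          using False by (intro eventually_nhds_in_open) auto
        then have "\<forall>\<^sub>F w in nhds x. FG i w = E i w" by eventually_elim (simp add: E_def)
        ultimately show ?thesis using isCont_cong by blast
      qed
    qed
  qed (use z in auto)
  then have "mval G z = mval 0 z" if "z \<in> \<H>" for z
    using that mval_mconst[OF that, of 0] by simp
  then have "G = 0"
    unfolding mero_eq_iff using eventually_in_upper_half_plane by (blast intro: eventually_mono)
  then show thesis using that[of N c] c(1) unfolding G_def X_def by blast
qed

end

section \<open>Branches\<close>

context twisted_form
begin

lemma algebraic_over_modular:
  assumes fuchs: "fuchsian_first_kind \<Gamma>" and a: "a \<in> modular_field"
  shows "algebraic_over t (mval a)"
proof -
  obtain N c where c: "\<exists>x\<in>{..N} \<times> {..N}. c x \<noteq> (0 :: complex)"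
    "(\<Sum>x\<in>{..N} \<times> {..N}. mconst (c x) * (T ^ fst x * a ^ snd x)) = 0"
    using algebraic_dependence[OF fuchs a] .
  \<comment> \<open>The powers of t go into the inner polynomial and those of a into the outer one,
    as in \<open>algebraic_over\<close>.\<close>
  define P where "P s = (\<Sum>r\<le>N. monom (c (r, s)) r)" for s
  define p where "p = (\<Sum>s\<le>N. monom (P s) s)"
  have coeff_P: "coeff (P s) r = (if r \<le> N then c (r, s) else 0)" for r s
    by (simp add: P_def coeff_sum)
  have coeff_p: "coeff p s = (if s \<le> N then P s else 0)" for s
    by (simp add: p_def coeff_sum)
  have "p \<noteq> 0"
  proof
    assume "p = 0"
    obtain r s where rs: "r \<le> N" "s \<le> N" "c (r, s) \<noteq> 0" using c(1) by auto
    have "coeff (coeff p s) r = c (r, s)" using rs by (simp add: coeff_p coeff_P)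
    then show False using \<open>p = 0\<close> rs(3) by simp
  qed
  moreover have "poly (poly p [:mval a z:]) (t z) = 0"
    if z: "z \<in> \<H>" and an: "t analytic_on {z}" "mval a analytic_on {z}" for z
  proof -
    have "\<forall>\<^sub>F w in at z. mval T w = t w"
      using eventually_in_upper_half_plane[OF z] by eventually_elim (rule mval_T)
    then have T: "mval T analytic_on {z}" using mval_at_analytic(1)[OF z an(1)] by blast
    have "(\<Sum>x\<in>{..N} \<times> {..N}. c x * (t z ^ fst x * mval a z ^ snd x)) = mval 0 z"
      using mval_bivariate_analytic[OF z T an(2), of c "{..N} \<times> {..N}"] mval_T[OF z] c(2) by simp
    also have "mval 0 z = 0" using mval_mconst[OF z, of 0] by simp
    also have "(\<Sum>x\<in>{..N} \<times> {..N}. c x * (t z ^ fst x * mval a z ^ snd x)) =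
        (\<Sum>r\<le>N. \<Sum>s\<le>N. c (r, s) * (t z ^ r * mval a z ^ s))"
      by (simp add: sum.cartesian_product split_def)
    also have "\<dots> = (\<Sum>s\<le>N. \<Sum>r\<le>N. c (r, s) * (t z ^ r * mval a z ^ s))"
      by (rule sum.swap)
    also have "\<dots> = poly (poly p [:mval a z:]) (t z)"
      by (simp add: p_def P_def poly_sum poly_monom sum_distrib_left sum_distrib_right mult_ac)
    finally show ?thesis .
  qed
  ultimately show ?thesis
    unfolding algebraic_over_def using mval_nicely_meromorphic by blast
qed

text \<open>On U the function t is a coordinate, and the chain rule identifies D with
  differentiation of the branch. The induction also carries analyticity, because quotients in
  \<open>mero\<close> are known only near a point and the value at the point is recovered by
  continuity.\<close>

lemma local_branch_deriv:
  assumes br: "local_branch f t U y"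
  shows "(\<forall>z\<in>U. mval ((D ^^ i) (mero_of f)) z = (deriv ^^ i) y (t z) \<and>
      mval ((D ^^ i) (mero_of f)) analytic_on {z}) \<and> (deriv ^^ i) y holomorphic_on t ` U"
proof -
  have U: "open U" "U \<subseteq> \<H>" and tU: "t holomorphic_on U" "inj_on t U"
    and y: "\<And>z. z \<in> U \<Longrightarrow> f z = y (t z)"
    using br by (auto simp: local_branch_def)
  have otU: "open (t ` U)" by (rule open_mapping_thm3[OF tU(1) U(1) tU(2)])
  \<comment> \<open>The local inverse of t serves twice: it shows that y = f \<circ> s is
    holomorphic, and its derivative shows that t' has no zero on U.\<close>
  obtain s where s: "s holomorphic_on t ` U" "\<And>z. z \<in> U \<Longrightarrow> deriv t z * deriv s (t z) = 1"
    "\<And>z. z \<in> U \<Longrightarrow> s (t z) = z"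
    using holomorphic_has_inverse[OF tU(1) U(1) tU(2)] by metis
  have t_an: "t analytic_on {z}" if "z \<in> U" for z using tU(1) U(1) that analytic_at by blast
  have T_ev: "\<forall>\<^sub>F w in at z. mval T w = t w" if "z \<in> \<H>" for z
    using eventually_in_upper_half_plane[OF that] by eventually_elim (rule mval_T)
  show ?thesis
  proof (induction i)
    case 0
    have "mval (mero_of f) z = f z" if "z \<in> \<H>" for z
      using mval_mero_of[OF holomorphic_imp_mero(2)[OF f_holomorphic] that] .
    moreover have "mval (mero_of f) analytic_on {z}" if z: "z \<in> \<H>" for z
      using f_holomorphic z analytic_at open_upper_half_plane
      by (intro mval_at_analytic(1)[OF z _ eventually_mval_mero_of[OF holomorphic_imp_mero(1)[OF f_holomorphic] z]]) blast
    moreover have "y holomorphic_on t ` U"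
    proof -
      have "(f \<circ> s) holomorphic_on t ` U"
        using s(3) U(2) by (intro holomorphic_on_compose_gen[OF s(1) f_holomorphic]) auto
      then show ?thesis by (rule holomorphic_transform) (use s(3) y in auto)
    qed
    ultimately show ?case using U(2) y by auto
  next
    case (Suc i)
    define u where "u = (D ^^ i) (mero_of f)"
    define v where "v = (deriv ^^ i) y"
    have v: "v holomorphic_on t ` U" "\<And>z. z \<in> U \<Longrightarrow> mval u z = v (t z)"
      using Suc by (auto simp: u_def v_def)
    have v': "deriv v holomorphic_on t ` U" by (rule holomorphic_deriv[OF v(1) otU])
    have "mval (D u) z = deriv v (t z) \<and> mval (D u) analytic_on {z}" if z: "z \<in> U" for z
    proof -
      have zH: "z \<in> \<H>" using z U(2) by blast
      have an: "(\<lambda>w. deriv v (t w)) analytic_on {z}"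
        using analytic_on_compose_gen[OF t_an[OF z], of "deriv v" "{t z}"] v' otU z analytic_at
        by (auto simp: o_def)
      have "\<forall>\<^sub>F w in at z. w \<in> U" using U(1) z by (intro eventually_at_in_open') auto
      moreover have "\<forall>\<^sub>F w in at z. mval (D u) w = mval (mderiv u) w / mval (mderiv T) w"
        unfolding D_def by (rule eventually_mval_ops(4)[OF zH])
      ultimately have "\<forall>\<^sub>F w in at z. mval (D u) w = deriv v (t w)"
        using eventually_mval_ops(5)[OF zH, of u] eventually_mval_ops(5)[OF zH, of T]
          eventually_deriv_eq[OF T_ev[OF zH]]
      proof eventually_elim
        case (elim w)
        have "deriv (mval u) w = deriv (\<lambda>w. v (t w)) w"
        proof (rule deriv_cong_ev)
          have "\<forall>\<^sub>F x in nhds w. x \<in> U" using U(1) elim(1) by (intro eventually_nhds_in_open)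
          then show "\<forall>\<^sub>F x in nhds w. mval u x = v (t x)" by eventually_elim (rule v(2))
        qed simp
        also have "\<dots> = deriv v (t w) * deriv t w"
        proof -
          have "t field_differentiable at w"
            using t_an[OF elim(1)] by (rule analytic_on_imp_differentiable_at) simp
          moreover have "v field_differentiable at (t w)"
            using v(1) otU elim(1) by (intro holomorphic_on_imp_differentiable_at[of _ "t ` U"]) auto
          ultimately show ?thesis using deriv_chain[of t w v] by (simp add: o_def)
        qed
        finally have "mval (D u) w = deriv v (t w) * deriv t w / deriv t w" using elim by simp
        moreover have "deriv t w \<noteq> 0" using s(2)[OF elim(1)] by auto
        ultimately show ?case by simp
      qed
      then show ?thesis using mval_at_analytic[OF zH an] by blast
    qed
    then show ?case using v' by (simp add: u_def v_def)
  qed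
qed

lemma satisfies_linear_ode_twisted:
  assumes fuchs: "fuchsian_first_kind \<Gamma>"
  shows "satisfies_linear_ode f t ((k + 1) * (l + 1))"
proof -
  let ?n = "(k + 1) * (l + 1)"
  obtain b where b: "b ?n = 1" "\<And>r. r \<le> ?n \<Longrightarrow> b r \<in> modular_field"
    "(\<Sum>r\<le>?n. b r * (D ^^ r) (mero_of f)) = 0"
    by (rule modular_relation) (rule that, assumption+)
  have iH: "\<i> \<in> \<H>" by (simp add: upper_half_plane_def)
  have "(\<Sum>r\<le>?n. mval (b r) z * (deriv ^^ r) y (t z)) = 0"
    if br: "local_branch f t U y" and z: "z \<in> U" and an: "\<forall>r\<le>?n. mval (b r) analytic_on {z}" for U y z
  proof -
    have zH: "z \<in> \<H>" using br z by (auto simp: local_branch_def)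
    have u: "mval ((D ^^ r) (mero_of f)) z = (deriv ^^ r) y (t z)"
      "mval ((D ^^ r) (mero_of f)) analytic_on {z}" for r
      using local_branch_deriv[OF br, of r] z by auto
    have *: "mval (b r * (D ^^ r) (mero_of f)) analytic_on {z} \<and>
        mval (b r * (D ^^ r) (mero_of f)) z = mval (b r) z * (deriv ^^ r) y (t z)" if "r \<le> ?n" for r
      using mval_mult_analytic[OF zH _ u(2), of "b r" r] an that u(1)[of r] by auto
    have "(\<Sum>r\<le>?n. mval (b r) z * (deriv ^^ r) y (t z)) = (\<Sum>r\<le>?n. mval (b r * (D ^^ r) (mero_of f)) z)"
      using * by (intro sum.cong) auto
    also have "\<dots> = mval (\<Sum>r\<le>?n. b r * (D ^^ r) (mero_of f)) z"
      using mval_sum_analytic[OF zH, of "{..?n}" "\<lambda>r. b r * (D ^^ r) (mero_of f)"] * by simp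
    also have "\<dots> = 0" unfolding b(3) using mval_mconst[OF zH, of 0] by simp
    finally show ?thesis .
  qed
  \<comment> \<open>The relation is monic, so the leading coefficient has the value 1 at \<i> and
    the order is exact.\<close>
  moreover have "mval (b ?n) \<i> \<noteq> 0" using b(1) mval_mconst[OF iH, of 1] by simp
  moreover have "algebraic_over t (mval (b r))" if "r \<le> ?n" for r
    by (rule algebraic_over_modular[OF fuchs b(2)[OF that]])
  ultimately show ?thesis
    unfolding satisfies_linear_ode_def using iH by (intro exI[of _ "\<lambda>r. mval (b r)"]) blast
qed

end

theorem theorem4p1:
  fixes K R :: "real set" and \<sigma> :: "real \<Rightarrow> real"
    and \<Delta> \<Gamma> :: "(real^2^2) set"
    and \<phi> f t :: "complex \<Rightarrow> complex" and k l :: nat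
  assumes "real_quadratic_field K"
    and "nontrivial_automorphism K \<sigma>"
    and "order_of_field K R"
    and "subgroup \<Delta> (SL2 K)"
    and "commensurable (SL2 K) \<Delta> (carrier (SL2 R))"
    and "subgroup \<Gamma> (SL2 K)"
    and "\<Gamma> \<subseteq> \<Delta>"
    and "fuchsian_first_kind \<Gamma>"
    and "equivariant_map \<sigma> \<Gamma> \<phi>"
    and "twisted_modular_form K \<sigma> \<Gamma> \<phi> k l f"
    and "modular_function \<Gamma> t"
    and "\<not> t constant_on upper_half_plane"
  shows "satisfies_linear_ode f t ((k + 1) * (l + 1))"
proof -
  interpret twisted_form K \<sigma> \<Gamma> \<phi> f t k l
    by (intro twisted_form.intro quadratic_group.intro quadratic_field.intro
        quadratic_group_axioms.intro twisted_form_axioms.intro assms)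
  show ?thesis by (rule satisfies_linear_ode_twisted[OF assms(8)])
qed

end
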